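(* Let $L>0$, $\mathbb{T}=\mathbb{R}/(L\mathbb{Z})$, and let $b,\sigma$ be smooth functions on $\mathbb{T}$ with $\sigma^2\ge S_1$ for some constant $S_1>0$. With the notation of the context, where $h=L/N$ for a positive integer $N$, there are constants $C>0$ independent of $h$ such that for all sufficiently small $h$: (i) the stationary distribution $\pi^h$ of the jump process satisfies $$\max_{0\le j\le N-1}\Big|\frac1h\pi^h_j-\pi(x_j)\Big|\le Ch;$$ (ii) the upwind scheme satisfies the uniform-in-time error estimate $$\sup_{t\ge0}\ \sum_{j=0}^{N-1}h\,|\rho(x_j,t)-\rho_j(t)|\le Ch .$$
   Context: Continuous problem: $\rho(x,t)$ solves $\partial_t\rho=-\partial_x(b\rho)+\frac12\partial_{xx}(\sigma^2\rho)$ on $\mathbb{T}$ with smooth initial datum $\rho(\cdot,0)=\rho^0\ge0$, $\rho^0\not\equiv0$. $\pi(\cdot)$ is the density on $\mathbb{T}$ of the (unique) stationary distribution of the SDE $dX=b(X)\,dt+\sigma(X)\,dW$ on $\mathbb{T}$ ($W$ being the standard Wiener process wrapped onto $\mathbb{T}$). Upwind scheme: $h=L/N$, $x_j=jh$, $0\le j\le N-1$, all indices understood modulo $N$. Let $s=b-\sigma\sigma'$, $s_j^+=\max(s(x_j),0)$, $s_j^-=\max(-s(x_j),0)$, $\sigma_{j+1/2}=\sigma(x_j+h/2)$, and $$\alpha_j=\frac{s_j^+}{h}+\frac{\sigma_{j+1/2}^2}{2h^2},\qquad \beta_j=\frac{s_j^-}{h}+\frac{\sigma_{j-1/2}^2}{2h^2}.$$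 $\rho^h(t)=(\rho_j(t))_{0\le j\le N-1}$ solves $\frac{d}{dt}\rho_j=\alpha_{j-1}\rho_{j-1}+\beta_{j+1}\rho_{j+1}-(\alpha_j+\beta_j)\rho_j$ with initial data $\rho_j(0)\ge0$ satisfying, with a constant $C'$ independent of $h$, $\sum_jh|\rho_j(0)-\rho^0(x_j)|\le C'h$ and $\big|\sum_jh\rho_j(0)-\|\rho^0\|_{L^1(\mathbb{T})}\big|\le C'h$. $\pi^h$ is the stationary distribution of the jump process on $\{0,\dots,N-1\}$ (mod $N$) jumping from $j$ to $j+1$ at rate $\alpha_j$ and from $j$ to $j-1$ at rate $\beta_j$, i.e. $\alpha_{j-1}\pi^h_{j-1}+\beta_{j+1}\pi^h_{j+1}-(\alpha_j+\beta_j)\pi^h_j=0$ for all $j$ and $\sum_j\pi^h_j=1$. *)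

theory Defs
  imports
    "HOL-Probability.Probability"
    "HOL-Library.Periodic_Fun"
    "HOL-Library.Real_Mod"
begin

text \<open>
  Functions on the torus \<open>\<real>/(L\<int>)\<close> are represented by \<open>L\<close>-periodic functions on the real line
  (\<^locale>\<open>periodic_fun_simple\<close>).
\<close>

definition smooth :: "(real \<Rightarrow> real) \<Rightarrow> bool" where
  "smooth f \<longleftrightarrow> (\<forall>n. (deriv ^^ n) f differentiable_on UNIV)"


subsection \<open>The stochastic differential equation\<close>

definition brownian_motion ::
    "'w measure \<Rightarrow> (real \<Rightarrow> 'w measure) \<Rightarrow> (real \<Rightarrow> 'w \<Rightarrow> real) \<Rightarrow> bool" where
  "brownian_motion M F W \<longleftrightarrow>
     (\<forall>t\<ge>0. W t \<in> borel_measurable (F t)) \<and>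
     (AE \<omega> in M. W 0 \<omega> = 0) \<and>
     (AE \<omega> in M. continuous_on {0..} (\<lambda>t. W t \<omega>)) \<and>
     (\<forall>s t. 0 \<le> s \<and> s < t \<longrightarrow>
        distributed M lborel (\<lambda>\<omega>. W t \<omega> - W s \<omega>) (normal_density 0 (sqrt (t - s))) \<and>
        prob_space.indep_set M (sets (F s))
          (sets (vimage_algebra (space M) (\<lambda>\<omega>. W t \<omega> - W s \<omega>) borel)))"

text \<open>
  For a bounded adapted integrand \<open>H\<close> with continuous paths, the Ito integral of \<open>H\<close> over \<open>[0, t]\<close>
  is the limit in probability of the left-point Riemann sums; this determines it up to null sets.
  The integral is required to be a random variable, so that the events below are measurable.
\<close>

definition has_ito_integral ::
    "'w measure \<Rightarrow> (real \<Rightarrow> 'w \<Rightarrow> real) \<Rightarrow> (real \<Rightarrow> 'w \<Rightarrow> real) \<Rightarrow> real \<Rightarrow> ('w \<Rightarrow> real) \<Rightarrow> bool" where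
  "has_ito_integral M W H t J \<longleftrightarrow>
     J \<in> borel_measurable M \<and>
     (\<forall>\<epsilon>>0. (\<lambda>n. measure M {\<omega> \<in> space M.
         \<bar>(\<Sum>i<n. H (real i * t / real n) \<omega> *
             (W (real (Suc i) * t / real n) \<omega> - W (real i * t / real n) \<omega>)) - J \<omega>\<bar> > \<epsilon>})
       \<longlonglongrightarrow> 0)"

text \<open>
  A weak solution of \<open>dX = b(X) dt + \<sigma>(X) dW\<close>. With \<open>L\<close>-periodic coefficients, \<open>X\<close> is the lift to
  the real line of a solution on the torus; the solution on the torus is \<open>X rmod L\<close>. The filtration
  is indexed by all reals, but only times \<open>t \<ge> 0\<close> matter.
\<close>

definition sde_solution ::
    "(real \<Rightarrow> real) \<Rightarrow> (real \<Rightarrow> real) \<Rightarrow> 'w measure \<Rightarrow> (real \<Rightarrow> 'w measure) \<Rightarrow>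
     (real \<Rightarrow> 'w \<Rightarrow> real) \<Rightarrow> (real \<Rightarrow> 'w \<Rightarrow> real) \<Rightarrow> bool" where
  "sde_solution b \<sigma> M F W X \<longleftrightarrow>
     prob_space M \<and>
     filtration (space M) F \<and> (\<forall>t. sets (F t) \<subseteq> sets M) \<and>
     brownian_motion M F W \<and>
     (\<forall>t\<ge>0. X t \<in> borel_measurable (F t)) \<and>
     (AE \<omega> in M. continuous_on {0..} (\<lambda>t. X t \<omega>)) \<and>
     (\<forall>t\<ge>0. \<exists>J. has_ito_integral M W (\<lambda>s \<omega>. \<sigma> (X s \<omega>)) t J \<and>
        (AE \<omega> in M. X t \<omega> = X 0 \<omega> + integral {0..t} (\<lambda>s. b (X s \<omega>)) + J \<omega>))"

text \<open>
  \<open>p\<close> is the density on the torus of a stationary distribution, realised by the stationary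
  solution \<open>X\<close>: started from \<open>p\<close>, the wrapped process has law \<open>p\<close> at every time. Densities are
  determined only almost everywhere; \<open>p\<close> is the continuous version.
\<close>

definition stationary_density ::
    "real \<Rightarrow> (real \<Rightarrow> real) \<Rightarrow> (real \<Rightarrow> real) \<Rightarrow> 'w measure \<Rightarrow> (real \<Rightarrow> 'w measure) \<Rightarrow>
     (real \<Rightarrow> 'w \<Rightarrow> real) \<Rightarrow> (real \<Rightarrow> 'w \<Rightarrow> real) \<Rightarrow> (real \<Rightarrow> real) \<Rightarrow> bool" where
  "stationary_density L b \<sigma> M F W X p \<longleftrightarrow>
     periodic_fun_simple p L \<and> continuous_on UNIV p \<and> (\<forall>x. 0 \<le> p x) \<and>
     sde_solution b \<sigma> M F W X \<and>
     (\<forall>t\<ge>0. distributed M lborel (\<lambda>\<omega>. X t \<omega> rmod L)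
        (\<lambda>x. ennreal (p x) * indicator {0..<L} x))"


subsection \<open>The Fokker--Planck equation\<close>

text \<open>
  Classical solutions: continuous up to time \<open>0\<close>, with continuous derivatives
  \<open>\<partial>\<^sub>t\<rho>\<close>, \<open>\<partial>\<^sub>x\<rho>\<close>, \<open>\<partial>\<^sub>x\<^sub>x\<rho>\<close> at positive times.
\<close>

definition fokker_planck_solution ::
    "real \<Rightarrow> (real \<Rightarrow> real) \<Rightarrow> (real \<Rightarrow> real) \<Rightarrow> (real \<Rightarrow> real) \<Rightarrow> (real \<Rightarrow> real \<Rightarrow> real) \<Rightarrow> bool" where
  "fokker_planck_solution L b \<sigma> \<rho>0 \<rho> \<longleftrightarrow>
     (\<forall>t\<ge>0. periodic_fun_simple (\<lambda>x. \<rho> x t) L) \<and>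
     (\<forall>x. \<rho> x 0 = \<rho>0 x) \<and>
     continuous_on (UNIV \<times> {0..}) (\<lambda>(x, t). \<rho> x t) \<and>
     (\<forall>t>0. \<forall>x. (\<lambda>\<tau>. \<rho> x \<tau>) differentiable (at t) \<and>
        (\<lambda>y. \<rho> y t) differentiable (at x) \<and>
        deriv (\<lambda>y. \<rho> y t) differentiable (at x)) \<and>
     continuous_on (UNIV \<times> {0<..}) (\<lambda>(x, t). deriv (\<lambda>\<tau>. \<rho> x \<tau>) t) \<and>
     continuous_on (UNIV \<times> {0<..}) (\<lambda>(x, t). deriv (\<lambda>y. \<rho> y t) x) \<and>
     continuous_on (UNIV \<times> {0<..}) (\<lambda>(x, t). deriv (deriv (\<lambda>y. \<rho> y t)) x) \<and>
     (\<forall>t>0. \<forall>x. deriv (\<lambda>\<tau>. \<rho> x \<tau>) t =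
        - deriv (\<lambda>y. b y * \<rho> y t) x + 1/2 * deriv (deriv (\<lambda>y. (\<sigma> y)\<^sup>2 * \<rho> y t)) x)"


subsection \<open>The upwind scheme and its jump process\<close>

definition mesh :: "real \<Rightarrow> nat \<Rightarrow> real" where
  "mesh L N = L / real N"

definition node :: "real \<Rightarrow> nat \<Rightarrow> nat \<Rightarrow> real" where
  "node L N j = real j * mesh L N"

definition upwind_velocity :: "(real \<Rightarrow> real) \<Rightarrow> (real \<Rightarrow> real) \<Rightarrow> real \<Rightarrow> real" where
  "upwind_velocity b \<sigma> x = b x - \<sigma> x * deriv \<sigma> x"

definition up_rate :: "real \<Rightarrow> (real \<Rightarrow> real) \<Rightarrow> (real \<Rightarrow> real) \<Rightarrow> nat \<Rightarrow> nat \<Rightarrow> real" where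
  "up_rate L b \<sigma> N j = max (upwind_velocity b \<sigma> (node L N j)) 0 / mesh L N
     + (\<sigma> (node L N j + mesh L N / 2))\<^sup>2 / (2 * (mesh L N)\<^sup>2)"

definition down_rate :: "real \<Rightarrow> (real \<Rightarrow> real) \<Rightarrow> (real \<Rightarrow> real) \<Rightarrow> nat \<Rightarrow> nat \<Rightarrow> real" where
  "down_rate L b \<sigma> N j = max (- upwind_velocity b \<sigma> (node L N j)) 0 / mesh L N
     + (\<sigma> (node L N j - mesh L N / 2))\<^sup>2 / (2 * (mesh L N)\<^sup>2)"

text \<open>Here \<open>(j + N - 1) mod N\<close> and \<open>(j + 1) mod N\<close> are the cyclic neighbours of \<open>j < N\<close>.\<close>

definition upwind_op ::
    "real \<Rightarrow> (real \<Rightarrow> real) \<Rightarrow> (real \<Rightarrow> real) \<Rightarrow> nat \<Rightarrow> (nat \<Rightarrow> real) \<Rightarrow> nat \<Rightarrow> real" where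
  "upwind_op L b \<sigma> N u j =
     up_rate L b \<sigma> N ((j + N - 1) mod N) * u ((j + N - 1) mod N)
     + down_rate L b \<sigma> N ((j + 1) mod N) * u ((j + 1) mod N)
     - (up_rate L b \<sigma> N j + down_rate L b \<sigma> N j) * u j"

definition upwind_solution ::
    "real \<Rightarrow> (real \<Rightarrow> real) \<Rightarrow> (real \<Rightarrow> real) \<Rightarrow> nat \<Rightarrow> (nat \<Rightarrow> real \<Rightarrow> real) \<Rightarrow> bool" where
  "upwind_solution L b \<sigma> N r \<longleftrightarrow>
     (\<forall>j<N. \<forall>t\<ge>0. ((\<lambda>\<tau>. r j \<tau>) has_real_derivative upwind_op L b \<sigma> N (\<lambda>i. r i t) j)
        (at t within {0..}))"

definition upwind_stationary ::
    "real \<Rightarrow> (real \<Rightarrow> real) \<Rightarrow> (real \<Rightarrow> real) \<Rightarrow> nat \<Rightarrow> (nat \<Rightarrow> real) \<Rightarrow> bool" where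
  "upwind_stationary L b \<sigma> N p \<longleftrightarrow>
     (\<forall>j<N. 0 \<le> p j) \<and> (\<Sum>j<N. p j) = 1 \<and> (\<forall>j<N. upwind_op L b \<sigma> N p j = 0)"

definition initial_data_approx ::
    "real \<Rightarrow> (real \<Rightarrow> real) \<Rightarrow> real \<Rightarrow> nat \<Rightarrow> (nat \<Rightarrow> real) \<Rightarrow> bool" where
  "initial_data_approx L \<rho>0 C' N u \<longleftrightarrow>
     (\<forall>j<N. 0 \<le> u j) \<and>
     (\<Sum>j<N. mesh L N * \<bar>u j - \<rho>0 (node L N j)\<bar>) \<le> C' * mesh L N \<and>
     \<bar>(\<Sum>j<N. mesh L N * u j) - integral {0..L} (\<lambda>x. \<bar>\<rho>0 x\<bar>)\<bar> \<le> C' * mesh L N"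

end

theory Submission
  imports Defs
begin

text \<open>
  Applied to the invariant law of the wrapped process, a short-time expansion identifies the continuous
  density \<open>\<pi>\<close> with the explicit periodic solution \<open>q\<close> of the stationary equation, whose flux is a
  constant \<open>J\<close>. The flux of the upwind scheme is consistent with the exact one to order \<open>h\<close>. For
  \<open>\<pi>\<^sup>h\<close> this suffices: as the discrete flux of \<open>\<pi>\<^sup>h\<close> is constant, testing it with the differences of
  \<open>\<pi>\<^sup>h / q\<close> shows that this ratio oscillates by \<open>O(h)\<close>.

  For the evolution, write \<open>\<rho> = q f\<close>. The energies \<open>\<integral> q f\<^sup>2\<close> and, through difference quotients,
  \<open>\<integral> q (\<partial>\<^sub>x f)\<^sup>2\<close> are Lyapunov functionals, which bounds \<open>\<partial>\<^sub>x f\<close> in \<open>L\<^sup>2\<close> uniformly in time and \<open>\<partial>\<^sub>x\<^sub>x f\<close> in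
  \<open>L\<^sup>2\<close> of space-time. The error of the scheme satisfies the discrete equation with the divergence of an
  \<open>O(h)\<close> flux as source. The discrete entropy dissipation and a Poincare inequality on the cycle,
  both with constants independent of \<open>h\<close>, make the weighted \<open>\<ell>\<^sup>2\<close> norm of the error decay exponentially up
  to this source, so that it stays \<open>O(h)\<close> for all times.
\<close>

subsection \<open>Stationary solutions of the stochastic differential equation\<close>

text \<open>The exact solution has only two space derivatives, at positive times, and is merely
  continuous down to time 0. Hence the equation cannot be differentiated in x, which forces the
  difference quotients, and the consistency error may use no more than second derivatives, and these
  only in L^2. The stationary flux \<open>J\<close> need not vanish, so the process need not be
  reversible. What saves each energy identity is that a constant flux times the difference of a
  square telescopes around the circle or the cycle. The powers of h balance as follows: rates are of
  order 1/h^2 and stationary weights of order h, so each edge has conductance of order 1/h; the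
  Poincare inequality loses a factor N = L/h, which leaves a decay rate independent of h. The
  hypothesis on the initial data allows an error of order 1 at a single node. Its weighted squared
  l^2 norm would then be of order 1/h, whereas the energy argument needs order 1; therefore this
  part of the error is treated separately in l^1.\<close>

lemma (in prob_space) indep_var_of_indep_set:
  fixes Y D :: "'a \<Rightarrow> real"
  assumes sp: "space G = space M" and sub: "sets G \<subseteq> sets M"
    and Y: "Y \<in> borel_measurable G" and D: "D \<in> borel_measurable M"
    and ind: "indep_set (sets G) (sets (vimage_algebra (space M) D borel))"
  shows "indep_var borel Y borel D"
  unfolding indep_var_eq
proof (intro conjI)
  show "Y \<in> borel_measurable M"
    using Y sp sub by (meson measurable_from_subalg subalgebra_def)
  show "D \<in> borel_measurable M" by (rule D)
  have 1: "sigma_sets (space M) {Y -` A \<inter> space M |A. A \<in> sets borel} \<subseteq> sets G"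
    unfolding sp[symmetric]
    by (rule sets.sigma_sets_subset) (use Y in \<open>auto intro: measurable_sets\<close>)
  have 2: "sigma_sets (space M) {D -` A \<inter> space M |A. A \<in> sets borel}
      \<subseteq> sets (vimage_algebra (space M) D borel)"
    using sets.sigma_sets_subset[of "{D -` A \<inter> space M |A. A \<in> sets borel}"
        "vimage_algebra (space M) D borel"]
    by (auto simp: sets_vimage_algebra)
  show "indep_set (sigma_sets (space M) {Y -` A \<inter> space M |A. A \<in> sets borel})
     (sigma_sets (space M) {D -` A \<inter> space M |A. A \<in> sets borel})"
    using ind unfolding indep_set_def
    by (rule indep_sets_mono_sets) (use 1 2 in \<open>auto split: bool.split\<close>)
qed

section \<open>Gaussian moments and limits in probability\<close>

lemma (in prob_space) normal_moments:
  assumes D: "distributed M lborel X (normal_density 0 s)" and s: "0 < s"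
  shows "integrable M (\<lambda>x. X x ^ k)" "expectation X = 0" "expectation (\<lambda>x. (X x)\<^sup>2) = s\<^sup>2"
    "expectation (\<lambda>x. (X x) ^ 4) = 3 * s ^ 4"
proof -
  show "integrable M (\<lambda>x. X x ^ k)"
    using distributed_integrable[OF D, of "\<lambda>x. x ^ k"] integrable_normal_moment[OF s, of 0 k]
    by simp
  show "expectation X = 0"
    using distributed_integral[OF D, of "\<lambda>x. x"] integral_normal_moment_nz_1[OF s, of 0]
    by simp
  show "expectation (\<lambda>x. (X x)\<^sup>2) = s\<^sup>2"
    using distributed_integral[OF D, of "\<lambda>x. x ^ 2"] integral_normal_moment_even[OF s, of 0 1]
    by simp
  show "expectation (\<lambda>x. (X x) ^ 4) = 3 * s ^ 4"
    using distributed_integral[OF D, of "\<lambda>x. x ^ 4"] integral_normal_moment_even[OF s, of 0 2]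
    by (simp add: fact_numeral power_divide field_simps power_mult[symmetric])
qed

text \<open>A Fatou type bound. The square of \<open>J\<close> is cut off at \<open>k\<close>. Off
  the event that \<open>I n\<close> and \<open>J\<close> differ by more than \<epsilon> it is at
  most twice the square of \<open>I n\<close> plus 2 \<epsilon>^2; on that event the cutoff costs
  \<open>k\<close> times a probability tending to 0. Monotone convergence then removes the cutoff.
  The factor 2 is harmless, since later only the order in t matters.\<close>

lemma (in prob_space) limit_in_probability_moments:
  fixes I :: "nat \<Rightarrow> 'a \<Rightarrow> real" and J :: "'a \<Rightarrow> real"
  assumes I: "\<And>n. I n \<in> borel_measurable M" and J: "J \<in> borel_measurable M"
    and lim: "\<And>\<epsilon>. \<epsilon> > 0 \<Longrightarrow> (\<lambda>n. prob {w \<in> space M. \<bar>I n w - J w\<bar> > \<epsilon>}) \<longlonglongrightarrow> 0"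
    and I2: "\<And>n. integrable M (\<lambda>w. (I n w)\<^sup>2)" "\<And>n. n > 0 \<Longrightarrow> expectation (\<lambda>w. (I n w)\<^sup>2) \<le> c"
    and \<epsilon>: "\<epsilon> > 0"
  shows "integrable M (\<lambda>w. (J w)\<^sup>2)" "expectation (\<lambda>w. (J w)\<^sup>2) \<le> 2 * c + 2 * \<epsilon>\<^sup>2"
proof -
  note [measurable] = I J
  define A where "A n = {w \<in> space M. \<bar>I n w - J w\<bar> > \<epsilon>}" for n
  have A[measurable]: "A n \<in> events" for n unfolding A_def by measurable
  have i: "integrable M (\<lambda>w. min ((J w)\<^sup>2) (real k))" for k
    by (rule integrable_const_bound[of _ "real k"]) auto
  have bd: "expectation (\<lambda>w. min ((J w)\<^sup>2) (real k)) \<le> 2 * c + 2 * \<epsilon>\<^sup>2" for k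
  proof -
    have e: "expectation (\<lambda>w. min ((J w)\<^sup>2) (real k)) \<le> 2 * c + 2 * \<epsilon>\<^sup>2 + real k * prob (A n)"
      if n: "n > 0" for n
    proof -
      have "expectation (\<lambda>w. min ((J w)\<^sup>2) (real k)) \<le>
        expectation (\<lambda>w. 2 * (I n w)\<^sup>2 + 2 * \<epsilon>\<^sup>2 + real k * indicator (A n) w)"
      proof (rule integral_mono[OF i])
        show "integrable M (\<lambda>w. 2 * (I n w)\<^sup>2 + 2 * \<epsilon>\<^sup>2 + real k * indicat_real (A n) w)"
          by (intro Bochner_Integration.integrable_add integrable_mult_right I2)
            (auto simp: less_top[symmetric])
        fix w assume w: "w \<in> space M"
        show "min ((J w)\<^sup>2) (real k) \<le> 2 * (I n w)\<^sup>2 + 2 * \<epsilon>\<^sup>2 + real k * indicat_real (A n) w"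
        proof (cases "w \<in> A n")
          case False
          then have "\<bar>J w - I n w\<bar> \<le> \<epsilon>" using w by (auto simp: A_def)
          then have "(J w - I n w)\<^sup>2 \<le> \<epsilon>\<^sup>2" by (metis abs_ge_zero power2_abs power_mono)
          moreover have "(J w)\<^sup>2 \<le> 2 * (I n w)\<^sup>2 + 2 * (J w - I n w)\<^sup>2"
            using zero_le_power2[of "J w - 2 * I n w"] by (simp add: power2_eq_square algebra_simps)
          ultimately show ?thesis using False by simp
        qed (use zero_le_power2[of "I n w"] in \<open>simp add: min.coboundedI2\<close>)
      qed
      also have "\<dots> = 2 * expectation (\<lambda>w. (I n w)\<^sup>2) + 2 * \<epsilon>\<^sup>2 + real k * prob (A n)"
        using I2(1) by (subst Bochner_Integration.integral_add) (auto simp: prob_space less_top[symmetric])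
      finally show ?thesis using I2(2)[OF n] by simp
    qed
    have "(\<lambda>n. 2 * c + 2 * \<epsilon>\<^sup>2 + real k * prob (A n)) \<longlonglongrightarrow> 2 * c + 2 * \<epsilon>\<^sup>2 + real k * 0"
      unfolding A_def by (intro tendsto_intros lim \<epsilon>)
    then show ?thesis
      using e by (intro LIMSEQ_le_const[of _ "2 * c + 2 * \<epsilon>\<^sup>2"]) (auto intro!: exI[of _ 1])
  qed
  have c0: "0 \<le> 2 * c + 2 * \<epsilon>\<^sup>2" using bd[of 0] by simp
  have sup: "ennreal ((J w)\<^sup>2) = (SUP k. ennreal (min ((J w)\<^sup>2) (real k)))" for w
  proof (rule antisym)
    obtain k where "(J w)\<^sup>2 \<le> real k" using real_arch_simple by blast
    then have "(J w)\<^sup>2 = min ((J w)\<^sup>2) (real k)" by simp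
    then show "ennreal ((J w)\<^sup>2) \<le> (SUP k. ennreal (min ((J w)\<^sup>2) (real k)))"
      by (metis (lifting) SUP_upper UNIV_I)
  qed (auto intro!: SUP_least ennreal_leI)
  have "(\<integral>\<^sup>+w. ennreal ((J w)\<^sup>2) \<partial>M) = (SUP k. \<integral>\<^sup>+w. ennreal (min ((J w)\<^sup>2) (real k)) \<partial>M)"
    unfolding sup
    by (rule nn_integral_monotone_convergence_SUP)
      (auto simp: incseq_def le_fun_def intro!: ennreal_leI)
  also have "\<dots> \<le> ennreal (2 * c + 2 * \<epsilon>\<^sup>2)"
    using bd i by (intro SUP_least) (simp add: nn_integral_eq_integral ennreal_leI)
  finally have n: "(\<integral>\<^sup>+w. ennreal ((J w)\<^sup>2) \<partial>M) \<le> ennreal (2 * c + 2 * \<epsilon>\<^sup>2)" .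
  then show int: "integrable M (\<lambda>w. (J w)\<^sup>2)"
    by (intro integrableI_bounded) (auto simp: le_less_trans[OF _ ennreal_less_top])
  show "expectation (\<lambda>w. (J w)\<^sup>2) \<le> 2 * c + 2 * \<epsilon>\<^sup>2"
    using n c0 int by (simp add: nn_integral_eq_integral)
qed

text \<open>Bounded second moments make the \<open>I n\<close> uniformly integrable, so vanishing
  expectations survive the limit in probability. In quantitative form: with y = I n - J and A the
  event |y| > \<epsilon>, one has |y| <= \<epsilon> + \<epsilon> y^2 + 1_A / \<epsilon>. First n
  tends to infinity, then \<epsilon> to 0.\<close>

lemma (in prob_space) limit_in_probability_expectation:
  fixes I :: "nat \<Rightarrow> 'a \<Rightarrow> real" and J \<xi> :: "'a \<Rightarrow> real"
  assumes I: "\<And>n. I n \<in> borel_measurable M" and J: "J \<in> borel_measurable M"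
    and lim: "\<And>\<epsilon>. \<epsilon> > 0 \<Longrightarrow> (\<lambda>n. prob {w \<in> space M. \<bar>I n w - J w\<bar> > \<epsilon>}) \<longlonglongrightarrow> 0"
    and I2: "\<And>n. integrable M (\<lambda>w. (I n w)\<^sup>2)" "\<And>n. n > 0 \<Longrightarrow> expectation (\<lambda>w. (I n w)\<^sup>2) \<le> c"
    and J2: "integrable M (\<lambda>w. (J w)\<^sup>2)"
    and \<xi>: "\<xi> \<in> borel_measurable M" "\<And>w. \<bar>\<xi> w\<bar> \<le> K"
    and zero: "\<And>n. n > 0 \<Longrightarrow> expectation (\<lambda>w. \<xi> w * I n w) = 0"
  shows "integrable M (\<lambda>w. \<xi> w * J w)" "expectation (\<lambda>w. \<xi> w * J w) = 0"
proof -
  note [measurable] = I J \<xi>(1)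
  have K0: "0 \<le> K" using \<xi>(2) by (meson abs_ge_zero order_trans)
  have iI: "integrable M (I n)" for n
    by (rule square_integrable_imp_integrable) (use I2 in auto)
  have iJ: "integrable M J"
    by (rule square_integrable_imp_integrable) (use J2 in auto)
  have mul: "integrable M (\<lambda>w. \<xi> w * f w)" if "integrable M f" for f
  proof (rule Bochner_Integration.integrable_bound)
    show "integrable M (\<lambda>w. K * f w)" using that by simp
    show "(\<lambda>w. \<xi> w * f w) \<in> borel_measurable M" using that by measurable
    show "AE w in M. norm (\<xi> w * f w) \<le> norm (K * f w)"
      using \<xi>(2) K0 by (auto simp: abs_mult intro!: mult_right_mono)
  qed
  show iJx: "integrable M (\<lambda>w. \<xi> w * J w)" by (rule mul[OF iJ])
  define c' where "c' = 2 * c + 2 * expectation (\<lambda>w. (J w)\<^sup>2)"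
  define P where "P \<epsilon> n = prob {w \<in> space M. \<bar>I n w - J w\<bar> > \<epsilon>}" for \<epsilon> n
  have main: "\<bar>expectation (\<lambda>w. \<xi> w * J w)\<bar> \<le> K * (\<epsilon> + \<epsilon> * c' + P \<epsilon> n / \<epsilon>)"
    if "\<epsilon> > 0" "n > 0" for \<epsilon> n
  proof -
    define A where "A = {w \<in> space M. \<bar>I n w - J w\<bar> > \<epsilon>}"
    have A[measurable]: "A \<in> events" unfolding A_def by measurable
    have 1: "expectation (\<lambda>w. \<xi> w * J w) = expectation (\<lambda>w. \<xi> w * J w - \<xi> w * I n w)"
      using zero[OF that(2)] mul[OF iI] iJx by simp
    have "\<bar>expectation (\<lambda>w. \<xi> w * J w - \<xi> w * I n w)\<bar> \<le> expectation (\<lambda>w. \<bar>\<xi> w * J w - \<xi> w * I n w\<bar>)"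
      by (rule integral_abs_bound)
    also have "\<dots> \<le> expectation (\<lambda>w. K * (\<epsilon> + \<epsilon> * (2 * (I n w)\<^sup>2 + 2 * (J w)\<^sup>2) + indicator A w / \<epsilon>))"
    proof (rule integral_mono)
      show "integrable M (\<lambda>w. K * (\<epsilon> + \<epsilon> * (2 * (I n w)\<^sup>2 + 2 * (J w)\<^sup>2) + indicat_real A w / \<epsilon>))"
        using I2(1) J2 by (auto simp: less_top[symmetric])
      fix w assume w: "w \<in> space M"
      define y where "y = I n w - J w"
      have "\<bar>y\<bar> \<le> \<epsilon> + \<epsilon> * y\<^sup>2 + indicator A w / \<epsilon>"
      proof (cases "w \<in> A")
        case True
        have "\<bar>y\<bar> = (\<epsilon> * \<bar>y\<bar>) * (1 / \<epsilon>)" using that by simp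
        have "0 \<le> (\<epsilon> * \<bar>y\<bar> - 1)\<^sup>2" by simp
        then have "2 * \<bar>y\<bar> * \<epsilon> \<le> \<epsilon>\<^sup>2 * y\<^sup>2 + 1" by (simp add: power2_eq_square algebra_simps)
        then have "2 * \<bar>y\<bar> \<le> (\<epsilon>\<^sup>2 * y\<^sup>2 + 1) / \<epsilon>" using that by (simp add: field_simps)
        also have "\<dots> = \<epsilon> * y\<^sup>2 + 1 / \<epsilon>" using that by (simp add: field_simps power2_eq_square)
        finally show ?thesis using True that by simp
      next
        case False
        then have "\<bar>y\<bar> \<le> \<epsilon>" using w by (auto simp: A_def y_def)
        moreover have "0 \<le> \<epsilon> * y\<^sup>2" using that by simp
        ultimately have "\<bar>y\<bar> \<le> \<epsilon> + \<epsilon> * y\<^sup>2" by linarith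
        then show ?thesis using False by simp
      qed
      also have "y\<^sup>2 \<le> 2 * (I n w)\<^sup>2 + 2 * (J w)\<^sup>2"
        using zero_le_power2[of "I n w + J w"] unfolding y_def
        by (simp add: power2_eq_square algebra_simps)
      finally have y: "\<bar>y\<bar> \<le> \<epsilon> + \<epsilon> * (2 * (I n w)\<^sup>2 + 2 * (J w)\<^sup>2) + indicator A w / \<epsilon>"
        using that by simp
      have "\<bar>\<xi> w * J w - \<xi> w * I n w\<bar> = \<bar>\<xi> w\<bar> * \<bar>y\<bar>"
        unfolding y_def by (simp add: abs_mult[symmetric] abs_minus_commute right_diff_distrib)
      also have "\<dots> \<le> K * (\<epsilon> + \<epsilon> * (2 * (I n w)\<^sup>2 + 2 * (J w)\<^sup>2) + indicator A w / \<epsilon>)"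
        by (intro mult_mono \<xi>(2) y) (use K0 in auto)
      finally show "\<bar>\<xi> w * J w - \<xi> w * I n w\<bar>
        \<le> K * (\<epsilon> + \<epsilon> * (2 * (I n w)\<^sup>2 + 2 * (J w)\<^sup>2) + indicat_real A w / \<epsilon>)" .
    qed (use iJx mul[OF iI] in auto)
    also have "\<dots> = K * (\<epsilon> + \<epsilon> * (2 * expectation (\<lambda>w. (I n w)\<^sup>2) + 2 * expectation (\<lambda>w. (J w)\<^sup>2)) + P \<epsilon> n / \<epsilon>)"
      using I2(1) J2 by (simp add: less_top[symmetric] prob_space P_def A_def[symmetric])
    also have "\<dots> \<le> K * (\<epsilon> + \<epsilon> * c' + P \<epsilon> n / \<epsilon>)"
      using I2(2)[OF that(2)] that K0 by (intro mult_left_mono add_mono) (auto simp: c'_def)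
    finally show ?thesis using 1 by simp
  qed
  have main2: "\<bar>expectation (\<lambda>w. \<xi> w * J w)\<bar> \<le> K * (\<epsilon> + \<epsilon> * c')" if "\<epsilon> > 0" for \<epsilon>
  proof -
    have "(\<lambda>n. K * (\<epsilon> + \<epsilon> * c' + P \<epsilon> n / \<epsilon>)) \<longlonglongrightarrow> K * (\<epsilon> + \<epsilon> * c' + 0 / \<epsilon>)"
      unfolding P_def by (intro tendsto_intros lim that) (use that in auto)
    then show ?thesis
      using main[OF that] that by (intro LIMSEQ_le_const) (auto intro!: exI[of _ 1])
  qed
  have "((\<lambda>\<epsilon>. K * (\<epsilon> + \<epsilon> * c')) \<longlongrightarrow> K * (0 + 0 * c')) (at_right 0)"
    by (intro tendsto_intros)
  then have "\<bar>expectation (\<lambda>w. \<xi> w * J w)\<bar> \<le> K * (0 + 0 * c')"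
    by (rule tendsto_lowerbound)
      (use main2 in \<open>auto simp: eventually_at_right_less intro: eventually_at_rightI[of 0 1]\<close>)
  then show "expectation (\<lambda>w. \<xi> w * J w) = 0" by simp
qed

section \<open>Second moments of Ito integrals with bounded adapted integrands\<close>

locale bounded_sde =
  fixes b \<sigma> :: "real \<Rightarrow> real" and M :: "'w measure" and F :: "real \<Rightarrow> 'w measure"
    and W X :: "real \<Rightarrow> 'w \<Rightarrow> real" and K :: real
  assumes sol: "sde_solution b \<sigma> M F W X"
    and b_cont: "continuous_on UNIV b" and b_bound: "\<And>x. \<bar>b x\<bar> \<le> K"
    and \<sigma>_bound: "\<And>x. \<bar>\<sigma> x\<bar> \<le> K" and \<sigma>_lip: "\<And>x y. \<bar>\<sigma> x - \<sigma> y\<bar> \<le> K * \<bar>x - y\<bar>"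
begin

lemma K_nonneg: "0 \<le> K"
  using b_bound[of 0] by linarith

sublocale prob_space M
  using sol by (simp add: sde_solution_def)

lemma filt: "filtration (space M) F" and sub: "sets (F t) \<subseteq> sets M"
  and bm: "brownian_motion M F W" and XF: "0 \<le> t \<Longrightarrow> X t \<in> borel_measurable (F t)"
  and X_cont: "AE w in M. continuous_on {0..} (\<lambda>t. X t w)"
  and ito: "0 \<le> t \<Longrightarrow> \<exists>J. has_ito_integral M W (\<lambda>s w. \<sigma> (X s w)) t J \<and>
        (AE w in M. X t w = X 0 w + integral {0..t} (\<lambda>s. b (X s w)) + J w)"
  using sol by (auto simp: sde_solution_def)

lemma space_F: "space (F t) = space M"
  using filt by (rule filtration.space_F)

lemma measurable_F_mono:
  assumes "s \<le> t" "f \<in> borel_measurable (F s)"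
  shows "f \<in> borel_measurable (F t)"
  by (rule measurable_from_subalg[OF _ assms(2)])
    (use filtration.sets_F_mono[OF filt assms(1)] space_F in \<open>auto simp: subalgebra_def\<close>)

lemma measurable_F_M: "f \<in> borel_measurable (F s) \<Longrightarrow> f \<in> borel_measurable M"
  by (rule measurable_from_subalg[of M "F s"]) (use sub space_F in \<open>auto simp: subalgebra_def\<close>)

lemma \<sigma>_measurable[measurable]: "\<sigma> \<in> borel_measurable borel"
proof (rule borel_measurable_continuous_onI)
  show "continuous_on UNIV \<sigma>"
  proof (rule continuous_onI)
    fix x e :: real assume e: "e > 0"
    have "dist (\<sigma> y) (\<sigma> x) \<le> e" if "dist y x < e / (K + 1)" for y
    proof -
      have "\<bar>y - x\<bar> * (K + 1) < e" using that K_nonneg by (simp add: dist_real_def field_simps)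
      then show ?thesis using \<sigma>_lip[of y x] abs_ge_zero[of "y - x"]
        by (simp add: dist_real_def algebra_simps)
    qed
    then show "\<exists>d>0. \<forall>y\<in>UNIV. dist y x < d \<longrightarrow> dist (\<sigma> y) (\<sigma> x) \<le> e"
      using e K_nonneg by (intro exI[of _ "e / (K + 1)"]) auto
  qed
qed

lemma b_measurable[measurable]: "b \<in> borel_measurable borel"
  using b_cont by (rule borel_measurable_continuous_onI)

lemma W_measurable: "0 \<le> t \<Longrightarrow> W t \<in> borel_measurable (F t)"
  using bm by (auto simp: brownian_motion_def)

lemma X_measurable: "0 \<le> t \<Longrightarrow> X t \<in> borel_measurable M"
  using XF measurable_F_M by blast

lemma increment:
  assumes "0 \<le> s" "s < t"
  shows "distributed M lborel (\<lambda>w. W t w - W s w) (normal_density 0 (sqrt (t - s)))"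
    "(\<lambda>w. W t w - W s w) \<in> borel_measurable M"
    "Y \<in> borel_measurable (F s) \<Longrightarrow> indep_var borel Y borel (\<lambda>w. W t w - W s w)"
proof -
  show "distributed M lborel (\<lambda>w. W t w - W s w) (normal_density 0 (sqrt (t - s)))"
    using bm assms by (auto simp: brownian_motion_def)
  show m: "(\<lambda>w. W t w - W s w) \<in> borel_measurable M"
    using W_measurable[of s] W_measurable[of t] assms by (auto dest!: measurable_F_M)
  show "indep_var borel Y borel (\<lambda>w. W t w - W s w)" if "Y \<in> borel_measurable (F s)"
    by (rule indep_var_of_indep_set[OF space_F sub that m])
      (use bm assms in \<open>auto simp: brownian_motion_def\<close>)
qed

lemma increment_moments:
  assumes "0 \<le> s" "s < t"
  shows "integrable M (\<lambda>w. (W t w - W s w) ^ k)" "integrable M (\<lambda>w. W t w - W s w)"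
    "expectation (\<lambda>w. W t w - W s w) = 0"
    "expectation (\<lambda>w. (W t w - W s w)\<^sup>2) = t - s"
    "expectation (\<lambda>w. (W t w - W s w) ^ 4) = 3 * (t - s)\<^sup>2"
proof -
  have "sqrt (t - s) ^ 4 = (t - s)\<^sup>2"
    using assms power_mult[of "sqrt (t - s)" 2 2] by simp
  then show "integrable M (\<lambda>w. (W t w - W s w) ^ k)" "integrable M (\<lambda>w. W t w - W s w)"
    "expectation (\<lambda>w. W t w - W s w) = 0"
    "expectation (\<lambda>w. (W t w - W s w)\<^sup>2) = t - s"
    "expectation (\<lambda>w. (W t w - W s w) ^ 4) = 3 * (t - s)\<^sup>2"
    using normal_moments[OF increment(1)[OF assms]] normal_moments(1)[OF increment(1)[OF assms], of 1]
      assms by auto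
qed

lemma integrable_mult_bounded:
  fixes f g :: "'w \<Rightarrow> real"
  assumes "integrable M f" "g \<in> borel_measurable M" "\<And>w. \<bar>g w\<bar> \<le> c"
  shows "integrable M (\<lambda>w. g w * f w)"
proof (rule Bochner_Integration.integrable_bound)
  have "0 \<le> c" using assms(3) by (meson abs_ge_zero order_trans)
  then show "AE w in M. norm (g w * f w) \<le> norm (c * f w)"
    using assms(3) by (auto simp: abs_mult intro!: mult_right_mono)
qed (use assms in auto)

text \<open>One step of the Ito isometry: \<open>Y\<close> belongs to the past of \<open>s\<close>,
  so it is independent of the increment, which is centred with variance
  \<open>t - s\<close>.\<close>

lemma adapted_increment:
  assumes st: "0 \<le> s" "s < t" and Y: "Y \<in> borel_measurable (F s)" and Y2: "integrable M (\<lambda>w. (Y w)\<^sup>2)"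
  shows "integrable M (\<lambda>w. Y w * (W t w - W s w))" "expectation (\<lambda>w. Y w * (W t w - W s w)) = 0"
    "integrable M (\<lambda>w. (Y w * (W t w - W s w))\<^sup>2)"
    "expectation (\<lambda>w. (Y w * (W t w - W s w))\<^sup>2) = expectation (\<lambda>w. (Y w)\<^sup>2) * (t - s)"
proof -
  note m = increment_moments[OF st]
  have Ym: "Y \<in> borel_measurable M" using Y by (rule measurable_F_M)
  have Yi: "integrable M Y" by (rule square_integrable_imp_integrable[OF Ym Y2])
  note i = increment(3)[OF st Y]
  show "integrable M (\<lambda>w. Y w * (W t w - W s w))"
    using indep_var_integrable[OF i Yi m(2)] by simp
  show "expectation (\<lambda>w. Y w * (W t w - W s w)) = 0"
    using indep_var_lebesgue_integral[OF i Yi m(2)] m(3) by simp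
  have sq: "(\<lambda>x::real. x\<^sup>2) \<in> borel_measurable borel" by measurable
  note i2 = indep_var_compose[OF i sq sq, unfolded comp_def]
  show "integrable M (\<lambda>w. (Y w * (W t w - W s w))\<^sup>2)"
    using indep_var_integrable[OF i2 Y2 m(1)] by (simp add: power_mult_distrib)
  show "expectation (\<lambda>w. (Y w * (W t w - W s w))\<^sup>2) = expectation (\<lambda>w. (Y w)\<^sup>2) * (t - s)"
    using indep_var_lebesgue_integral[OF i2 Y2 m(1)] m(4) by (simp add: power_mult_distrib)
qed

text \<open>The discrete Ito isometry. When a term is added, the cross term is a factor known at the
  left grid point times an independent centred increment; it has mean zero, so second moments add.
  Measurability at the last grid time is part of the induction because it makes that factor
  adapted.\<close>

lemma riemann_sum_moments:
  assumes \<delta>: "\<delta> > 0" and h: "\<And>i. h i \<in> borel_measurable (F (real i * \<delta>))" "\<And>i w. \<bar>h i w\<bar> \<le> c"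
  defines "S \<equiv> \<lambda>k w. \<Sum>i<k. h i w * (W (real (Suc i) * \<delta>) w - W (real i * \<delta>) w)"
  shows "S k \<in> borel_measurable (F (real k * \<delta>)) \<and> integrable M (\<lambda>w. (S k w)\<^sup>2) \<and>
    expectation (S k) = 0 \<and> expectation (\<lambda>w. (S k w)\<^sup>2) = (\<Sum>i<k. expectation (\<lambda>w. (h i w)\<^sup>2) * \<delta>)"
proof (induction k)
  case 0
  then show ?case by (simp add: S_def)
next
  case (Suc k)
  define s where "s = real k * \<delta>"
  define t where "t = real (Suc k) * \<delta>"
  define D where "D w = W t w - W s w" for w
  have st: "0 \<le> s" "s < t" "t - s = \<delta>" using \<delta> by (auto simp: s_def t_def algebra_simps)
  have S: "S (Suc k) = (\<lambda>w. S k w + h k w * D w)"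
    by (simp add: S_def D_def s_def t_def)
  have IH: "S k \<in> borel_measurable (F s)" "integrable M (\<lambda>w. (S k w)\<^sup>2)" "expectation (S k) = 0"
    "expectation (\<lambda>w. (S k w)\<^sup>2) = (\<Sum>i<k. expectation (\<lambda>w. (h i w)\<^sup>2) * \<delta>)"
    using Suc by (auto simp: s_def)
  have hk: "h k \<in> borel_measurable (F s)" using h(1)[of k] by (simp add: s_def)
  have hkM: "h k \<in> borel_measurable M" using hk by (rule measurable_F_M)
  have SM: "S k \<in> borel_measurable M" using IH(1) by (rule measurable_F_M)
  have Si: "integrable M (S k)" by (rule square_integrable_imp_integrable[OF SM IH(2)])
  have h2: "(h k w)\<^sup>2 \<le> c\<^sup>2" for w using h(2)[of k w] by (metis abs_ge_zero power2_abs power_mono)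
  have h2i: "integrable M (\<lambda>w. (h k w)\<^sup>2)"
    by (rule integrable_const_bound[of _ "c\<^sup>2"]) (use h2 hkM in auto)
  have Shi: "integrable M (\<lambda>w. (S k w * h k w)\<^sup>2)"
    using integrable_mult_bounded[OF IH(2), of "\<lambda>w. (h k w)\<^sup>2" "c\<^sup>2"] h2 hkM
    by (simp add: power_mult_distrib mult.commute)
  note m1 = adapted_increment[OF st(1,2) hk h2i, folded D_def]
  note m2 = adapted_increment[OF st(1,2) borel_measurable_times[OF IH(1) hk] Shi, folded D_def]
  have Dm: "D \<in> borel_measurable (F t)" unfolding D_def
    using W_measurable[of t] measurable_F_mono[OF _ W_measurable[of s], of t] st by auto
  have Sm: "S (Suc k) \<in> borel_measurable (F t)"
    unfolding S using Dm measurable_F_mono[OF _ IH(1), of t] measurable_F_mono[OF _ hk, of t] st by auto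
  have ex: "(S (Suc k) w)\<^sup>2 = (S k w)\<^sup>2 + 2 * (S k w * h k w * D w) + (h k w * D w)\<^sup>2" for w
    unfolding S by (simp add: power2_eq_square algebra_simps)
  have "integrable M (\<lambda>w. (S (Suc k) w)\<^sup>2)"
    unfolding ex using IH(2) m1(3) m2(1) by auto
  moreover have "expectation (S (Suc k)) = 0"
    unfolding S using m1(1,2) Si IH(3) by simp
  moreover have "expectation (\<lambda>w. (S (Suc k) w)\<^sup>2) = (\<Sum>i<Suc k. expectation (\<lambda>w. (h i w)\<^sup>2) * \<delta>)"
    unfolding ex using IH(2) m1(3,4) m2(1,2) IH(4) st(3) by simp
  ultimately show ?case using Sm by (simp add: t_def)
qed

text \<open>By telescoping, \<open>\<zeta> w * (W t w - W 0 w)\<close> is the Riemann sum of the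
  constant integrand \<zeta> on every grid, so the isometry applies to the integrand \<sigma>(X) -
  \<zeta>. The choice \<zeta> = 0 gives the crude bound, \<zeta> = \<sigma>(X 0) the error of
  freezing the coefficient.\<close>

lemma ito_integral_moments:
  assumes t: "t > 0" and J: "has_ito_integral M W (\<lambda>s w. \<sigma> (X s w)) t J"
    and \<zeta>: "\<zeta> \<in> borel_measurable (F 0)" "\<And>w. \<bar>\<zeta> w\<bar> \<le> K"
    and c: "\<And>s. 0 \<le> s \<Longrightarrow> s \<le> t \<Longrightarrow> expectation (\<lambda>w. (\<sigma> (X s w) - \<zeta> w)\<^sup>2) \<le> c"
  shows "integrable M (\<lambda>w. (J w - \<zeta> w * (W t w - W 0 w))\<^sup>2)" (is ?A)
    "expectation (\<lambda>w. (J w - \<zeta> w * (W t w - W 0 w))\<^sup>2) \<le> 2 * c * t + 2 * t\<^sup>2" (is ?B)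
proof -
  define I where "I n w = (\<Sum>i<n. \<sigma> (X (real i * t / real n) w) *
             (W (real (Suc i) * t / real n) w - W (real i * t / real n) w))" for n w
  define D where "D n w = I n w - \<zeta> w * (W t w - W 0 w)" for n w
  have JM: "J \<in> borel_measurable M"
    and lim: "\<epsilon> > 0 \<Longrightarrow> (\<lambda>n. prob {w \<in> space M. \<bar>I n w - J w\<bar> > \<epsilon>}) \<longlonglongrightarrow> 0" for \<epsilon>
    using J by (auto simp: has_ito_integral_def I_def)
  have \<zeta>M: "\<zeta> \<in> borel_measurable M" using \<zeta>(1) by (rule measurable_F_M)
  have \<zeta>2: "integrable M (\<lambda>w. (\<zeta> w)\<^sup>2)"
    by (rule integrable_const_bound[of _ "K\<^sup>2"])
      (use \<zeta>M \<zeta>(2) in \<open>auto intro!: AE_I2 simp: abs_le_square_iff[symmetric] K_nonneg\<close>)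
  \<comment> \<open>For n = 0 the Riemann sum is empty. Square integrability is required of every
    member of the sequence, the bound on the second moment only for n > 0.\<close>
  have D0: "integrable M (\<lambda>w. (D 0 w)\<^sup>2)" "D 0 \<in> borel_measurable M"
    using adapted_increment(3)[OF _ t \<zeta>(1) \<zeta>2] \<zeta>M increment(2)[OF _ t] by (auto simp: D_def[abs_def] I_def)
  have Dn: "D n \<in> borel_measurable M \<and> integrable M (\<lambda>w. (D n w)\<^sup>2) \<and> expectation (\<lambda>w. (D n w)\<^sup>2) \<le> c * t"
    if n: "n > 0" for n
  proof -
    define \<delta> where "\<delta> = t / real n"
    have \<delta>: "\<delta> > 0" using t n by (simp add: \<delta>_def)
    define h where "h i w = \<sigma> (X (real i * \<delta>) w) - \<zeta> w" for i w
    have h: "h i \<in> borel_measurable (F (real i * \<delta>))" for i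
    proof -
      have [measurable]: "X (real i * \<delta>) \<in> borel_measurable (F (real i * \<delta>))"
        "\<zeta> \<in> borel_measurable (F (real i * \<delta>))"
        using XF[of "real i * \<delta>"] measurable_F_mono[OF _ \<zeta>(1), of "real i * \<delta>"] \<delta> by auto
      show ?thesis unfolding h_def by measurable
    qed
    have hb: "\<bar>h i w\<bar> \<le> 2 * K" for i w
      using \<sigma>_bound[of "X (real i * \<delta>) w"] \<zeta>(2)[of w] unfolding h_def by linarith
    have "(\<Sum>i<k. W (real (Suc i) * \<delta>) w - W (real i * \<delta>) w) = W (real k * \<delta>) w - W 0 w" for k w
      by (subst sum_lessThan_telescope) simp
    from this[of _ n] have tel: "(\<Sum>i<n. W (real (Suc i) * \<delta>) w - W (real i * \<delta>) w) = W t w - W 0 w" for w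
      using n by (simp add: \<delta>_def)
    have D: "D n = (\<lambda>w. \<Sum>i<n. h i w * (W (real (Suc i) * \<delta>) w - W (real i * \<delta>) w))"
    proof
      fix w
      have "I n w = (\<Sum>i<n. \<sigma> (X (real i * \<delta>) w) * (W (real (Suc i) * \<delta>) w - W (real i * \<delta>) w))"
        by (simp add: I_def \<delta>_def)
      then show "D n w = (\<Sum>i<n. h i w * (W (real (Suc i) * \<delta>) w - W (real i * \<delta>) w))"
        unfolding D_def tel[symmetric] h_def by (simp add: left_diff_distrib right_diff_distrib sum_subtractf sum_distrib_left del: of_nat_Suc)
    qed
    have Dw: "(\<Sum>i<n. h i w * (W (real (Suc i) * \<delta>) w - W (real i * \<delta>) w)) = D n w" for w
      by (simp add: D)
    note m = riemann_sum_moments[of \<delta> h "2 * K" n, OF \<delta> h hb, unfolded Dw]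
    have "expectation (\<lambda>w. (D n w)\<^sup>2) = (\<Sum>i<n. expectation (\<lambda>w. (h i w)\<^sup>2) * \<delta>)"
      using m by simp
    also have "\<dots> \<le> (\<Sum>i<n. c * \<delta>)"
    proof (intro sum_mono mult_right_mono)
      fix i assume "i \<in> {..<n}"
      then have "real i * \<delta> \<le> real n * \<delta>" using \<delta> by auto
      also have "real n * \<delta> = t" using n by (simp add: \<delta>_def)
      finally show "expectation (\<lambda>w. (h i w)\<^sup>2) \<le> c"
        unfolding h_def using \<delta> by (intro c) auto
    qed (use \<delta> in auto)
    also have "\<dots> = c * t" using n by (simp add: \<delta>_def)
    finally show ?thesis using m by (auto dest: measurable_F_M)
  qed
  have D: "D n \<in> borel_measurable M" "integrable M (\<lambda>w. (D n w)\<^sup>2)" for n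
    using Dn[of n] D0 by (cases "n = 0"; auto)+
  have JD: "(\<lambda>w. J w - \<zeta> w * (W t w - W 0 w)) \<in> borel_measurable M"
    using JM \<zeta>M increment(2)[OF _ t] by auto
  have eq: "\<bar>D n w - (J w - \<zeta> w * (W t w - W 0 w))\<bar> = \<bar>I n w - J w\<bar>" for n w
    by (simp add: D_def)
  have lim': "(\<lambda>n. prob {w \<in> space M. \<bar>D n w - (J w - \<zeta> w * (W t w - W 0 w))\<bar> > \<epsilon>}) \<longlonglongrightarrow> 0"
    if "\<epsilon> > 0" for \<epsilon>
    unfolding eq by (rule lim[OF that])
  \<comment> \<open>The tolerance in the limit lemma is taken to be \<open>t\<close>; this produces
    the term 2 t^2.\<close>
  show ?A ?B
    using limit_in_probability_moments[OF D(1) JD lim' D(2) _ t, of "c * t"] Dn by auto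
qed

text \<open>A bounded \<xi> known at time 0 can be moved into the integrand without destroying
  adaptedness, so each Riemann sum has zero expectation against \<xi>. With \<xi> = \<phi>'(X 0)
  this removes the martingale part of the increment from the expansion.\<close>

lemma ito_integral_expectation:
  assumes t: "t > 0" and J: "has_ito_integral M W (\<lambda>s w. \<sigma> (X s w)) t J"
    and \<xi>: "\<xi> \<in> borel_measurable (F 0)" "\<And>w. \<bar>\<xi> w\<bar> \<le> c"
  shows "integrable M (\<lambda>w. (J w)\<^sup>2)" "integrable M (\<lambda>w. \<xi> w * J w)" "expectation (\<lambda>w. \<xi> w * J w) = 0"
proof -
  have c0: "0 \<le> c" using \<xi>(2) by (meson abs_ge_zero order_trans)
  define I where "I n w = (\<Sum>i<n. \<sigma> (X (real i * t / real n) w) *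
             (W (real (Suc i) * t / real n) w - W (real i * t / real n) w))" for n w
  have JM: "J \<in> borel_measurable M"
    and lim: "\<epsilon> > 0 \<Longrightarrow> (\<lambda>n. prob {w \<in> space M. \<bar>I n w - J w\<bar> > \<epsilon>}) \<longlonglongrightarrow> 0" for \<epsilon>
    using J by (auto simp: has_ito_integral_def I_def)
  have \<xi>M: "\<xi> \<in> borel_measurable M" using \<xi>(1) by (rule measurable_F_M)
  have In: "I n \<in> borel_measurable M \<and> integrable M (\<lambda>w. (I n w)\<^sup>2) \<and> expectation (\<lambda>w. (I n w)\<^sup>2) \<le> K\<^sup>2 * t
    \<and> expectation (\<lambda>w. \<xi> w * I n w) = 0"
    if n: "n > 0" for n
  proof -
    define \<delta> where "\<delta> = t / real n"
    have \<delta>: "\<delta> > 0" using t n by (simp add: \<delta>_def)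
    define h where "h i w = \<sigma> (X (real i * \<delta>) w)" for i w
    define h' where "h' i w = \<xi> w * \<sigma> (X (real i * \<delta>) w)" for i w
    have h: "h i \<in> borel_measurable (F (real i * \<delta>))" "h' i \<in> borel_measurable (F (real i * \<delta>))" for i
    proof -
      have [measurable]: "X (real i * \<delta>) \<in> borel_measurable (F (real i * \<delta>))"
        "\<xi> \<in> borel_measurable (F (real i * \<delta>))"
        using XF[of "real i * \<delta>"] measurable_F_mono[OF _ \<xi>(1), of "real i * \<delta>"] \<delta> by auto
      show "h i \<in> borel_measurable (F (real i * \<delta>))" "h' i \<in> borel_measurable (F (real i * \<delta>))"
        unfolding h_def h'_def by measurable
    qed
    have hb: "\<bar>h i w\<bar> \<le> K" "\<bar>h' i w\<bar> \<le> c * K" for i w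
      using \<sigma>_bound \<xi>(2) c0 by (auto simp: h_def h'_def abs_mult intro!: mult_mono)
    have I: "I n = (\<lambda>w. \<Sum>i<n. h i w * (W (real (Suc i) * \<delta>) w - W (real i * \<delta>) w))"
      by (simp add: I_def h_def \<delta>_def fun_eq_iff)
    have I': "(\<lambda>w. \<Sum>i<n. h' i w * (W (real (Suc i) * \<delta>) w - W (real i * \<delta>) w)) = (\<lambda>w. \<xi> w * I n w)"
      by (simp add: I h_def h'_def sum_distrib_left mult.assoc)
    have Iw: "(\<Sum>i<n. h i w * (W (real (Suc i) * \<delta>) w - W (real i * \<delta>) w)) = I n w" for w
      by (simp add: I)
    note m = riemann_sum_moments[of \<delta> h K n, OF \<delta> h(1) hb(1), unfolded Iw]
    note m' = riemann_sum_moments[of \<delta> h' "c * K" n, OF \<delta> h(2) hb(2), unfolded I']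
    have "expectation (\<lambda>w. (I n w)\<^sup>2) = (\<Sum>i<n. expectation (\<lambda>w. (h i w)\<^sup>2) * \<delta>)"
      using m by simp
    also have "\<dots> \<le> (\<Sum>i<n. K\<^sup>2 * \<delta>)"
    proof (intro sum_mono mult_right_mono)
      fix i assume "i \<in> {..<n}"
      have "(h i w)\<^sup>2 \<le> K\<^sup>2" for w using hb(1)[of i w] by (metis abs_ge_zero power2_abs power_mono)
      moreover have "h i \<in> borel_measurable M" using h(1) by (rule measurable_F_M)
      ultimately have "expectation (\<lambda>w. (h i w)\<^sup>2) \<le> expectation (\<lambda>w. K\<^sup>2)"
        by (intro integral_mono integrable_const_bound[of _ "K\<^sup>2"]) (auto simp: less_top[symmetric])
      then show "expectation (\<lambda>w. (h i w)\<^sup>2) \<le> K\<^sup>2" by (simp add: prob_space)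
    qed (use \<delta> in auto)
    also have "\<dots> = K\<^sup>2 * t" using n by (simp add: \<delta>_def)
    finally show ?thesis using m m' by (auto dest: measurable_F_M)
  qed
  have I: "I n \<in> borel_measurable M" "integrable M (\<lambda>w. (I n w)\<^sup>2)" for n
  proof -
    have I0: "I 0 = (\<lambda>_. 0)" by (simp add: I_def fun_eq_iff)
    show "I n \<in> borel_measurable M" "integrable M (\<lambda>w. (I n w)\<^sup>2)"
      using In[of n] I0 by (cases "n = 0"; simp)+
  qed
  show J2: "integrable M (\<lambda>w. (J w)\<^sup>2)"
    by (rule limit_in_probability_moments(1)[OF I(1) JM lim I(2) _ t, of "K\<^sup>2 * t"]) (use In in auto)
  show "integrable M (\<lambda>w. \<xi> w * J w)" "expectation (\<lambda>w. \<xi> w * J w) = 0"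
    using limit_in_probability_expectation[OF I(1) JM lim I(2) _ J2 \<xi>M \<xi>(2), of "K\<^sup>2 * t"] In by auto
qed

lemma drift_bound:
  assumes "t \<ge> 0" "AE w in M. X t w = X 0 w + integral {0..t} (\<lambda>s. b (X s w)) + J w"
  shows "AE w in M. \<bar>X t w - X 0 w - J w\<bar> \<le> K * t"
  using assms(2) X_cont
proof eventually_elim
  case (elim w)
  have "continuous_on {0..t} (\<lambda>s. b (X s w))"
    using continuous_on_compose2[OF b_cont elim(2)] by (rule continuous_on_subset) auto
  then have "norm (integral {0..t} (\<lambda>s. b (X s w))) \<le> K * (t - 0)"
    using assms(1) b_bound by (intro integral_bound) auto
  with elim(1) show ?case by simp
qed

text \<open>The drift moves \<open>X\<close> by at most \<open>K * t\<close> and the Ito integral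
  has second moment of order t; the Lipschitz bound transfers this to \<sigma>. For t <= 1 the
  quadratic terms are absorbed into the linear one.\<close>

lemma X_increment_moment:
  assumes t: "0 \<le> t" "t \<le> 1"
  shows "expectation (\<lambda>w. (\<sigma> (X t w) - \<sigma> (X 0 w))\<^sup>2) \<le> K\<^sup>2 * (6 * K\<^sup>2 + 4) * t"
proof (cases "t = 0")
  case False
  then have t0: "t > 0" using t by simp
  obtain J where J: "has_ito_integral M W (\<lambda>s w. \<sigma> (X s w)) t J"
      and XJ: "AE w in M. X t w = X 0 w + integral {0..t} (\<lambda>s. b (X s w)) + J w"
    using ito[OF t(1)] by blast
  have [measurable]: "X t \<in> borel_measurable M" "X 0 \<in> borel_measurable M"
    using X_measurable t by auto
  have k2: "expectation (\<lambda>w. (\<sigma> (X s w) - 0)\<^sup>2) \<le> K\<^sup>2" if "0 \<le> s" for s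
  proof -
    have [measurable]: "X s \<in> borel_measurable M" using X_measurable that by auto
    have *: "(\<sigma> x)\<^sup>2 \<le> K\<^sup>2" for x
      using \<sigma>_bound[of x] by (metis abs_ge_zero power2_abs power_mono)
    have "expectation (\<lambda>w. (\<sigma> (X s w) - 0)\<^sup>2) \<le> expectation (\<lambda>w. K\<^sup>2)"
      using * by (intro integral_mono integrable_const_bound[of _ "K\<^sup>2"]) (auto simp: less_top[symmetric])
    then show ?thesis by (simp add: prob_space)
  qed
  have J2: "integrable M (\<lambda>w. (J w)\<^sup>2)" "expectation (\<lambda>w. (J w)\<^sup>2) \<le> 2 * K\<^sup>2 * t + 2 * t\<^sup>2"
    using ito_integral_moments[OF t0 J, of "\<lambda>_. 0" "K\<^sup>2"] k2 K_nonneg by auto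
  have ae: "AE w in M. (\<sigma> (X t w) - \<sigma> (X 0 w))\<^sup>2 \<le> K\<^sup>2 * (2 * (K * t)\<^sup>2 + 2 * (J w)\<^sup>2)"
    using drift_bound[OF t(1) XJ]
  proof eventually_elim
    case (elim w)
    define y where "y = X t w - X 0 w - J w"
    have "(\<sigma> (X t w) - \<sigma> (X 0 w))\<^sup>2 = \<bar>\<sigma> (X t w) - \<sigma> (X 0 w)\<bar>\<^sup>2" by simp
    also have "\<dots> \<le> (K * \<bar>X t w - X 0 w\<bar>)\<^sup>2" by (intro power_mono \<sigma>_lip) simp
    also have "\<dots> = K\<^sup>2 * (y + J w)\<^sup>2" by (simp add: power_mult_distrib y_def)
    also have "(y + J w)\<^sup>2 \<le> 2 * y\<^sup>2 + 2 * (J w)\<^sup>2"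
      using zero_le_power2[of "y - J w"] by (simp add: power2_eq_square algebra_simps)
    also have "y\<^sup>2 \<le> (K * t)\<^sup>2" using elim unfolding y_def by (metis abs_ge_zero power2_abs power_mono)
    finally show ?case by (simp add: mult_left_mono)
  qed
  have "expectation (\<lambda>w. (\<sigma> (X t w) - \<sigma> (X 0 w))\<^sup>2) \<le> expectation (\<lambda>w. K\<^sup>2 * (2 * (K * t)\<^sup>2 + 2 * (J w)\<^sup>2))"
  proof (rule integral_mono_AE)
    show i: "integrable M (\<lambda>w. K\<^sup>2 * (2 * (K * t)\<^sup>2 + 2 * (J w)\<^sup>2))"
      using J2 by (auto simp: less_top[symmetric])
    show "integrable M (\<lambda>w. (\<sigma> (X t w) - \<sigma> (X 0 w))\<^sup>2)"
      by (rule Bochner_Integration.integrable_bound[OF i]) (use ae in auto)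
  qed (rule ae)
  also have "\<dots> = K\<^sup>2 * (2 * (K * t)\<^sup>2 + 2 * expectation (\<lambda>w. (J w)\<^sup>2))"
    using J2(1) by (simp add: prob_space less_top[symmetric])
  also have "\<dots> \<le> K\<^sup>2 * ((6 * K\<^sup>2 + 4) * t)"
  proof (rule mult_left_mono)
    have "t\<^sup>2 \<le> t" using t by (simp add: power2_eq_square mult_left_le)
    then have "K\<^sup>2 * t\<^sup>2 \<le> K\<^sup>2 * t" by (intro mult_left_mono) auto
    then show "2 * (K * t)\<^sup>2 + 2 * expectation (\<lambda>w. (J w)\<^sup>2) \<le> (6 * K\<^sup>2 + 4) * t"
      using J2(2) \<open>t\<^sup>2 \<le> t\<close> by (simp add: power_mult_distrib algebra_simps)
  qed simp
  finally show ?thesis by (simp add: mult.assoc)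
qed auto

end

section \<open>Short-time expansion and the generator\<close>

lemma taylor_first_order:
  fixes f f' f'' :: "real \<Rightarrow> real"
  assumes "\<And>x. (f has_real_derivative f' x) (at x)" "\<And>x. (f' has_real_derivative f'' x) (at x)"
    and "\<And>x. \<bar>f'' x\<bar> \<le> K"
  shows "\<bar>f (y + d) - f y - f' y * d\<bar> \<le> K * d\<^sup>2" "\<bar>f' (y + d) - f' y\<bar> \<le> K * \<bar>d\<bar>"
proof -
  have lip: "\<bar>f' u - f' v\<bar> \<le> K * \<bar>u - v\<bar>" for u v
    using field_differentiable_bound[of UNIV f' f'' K u v] assms by auto
  from lip[of "y + d" y] show "\<bar>f' (y + d) - f' y\<bar> \<le> K * \<bar>d\<bar>" by simp
  have K: "0 \<le> K" using assms(3)[of 0] by linarith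
  have "\<bar>(f (y + d) - f' y * (y + d)) - (f y - f' y * y)\<bar> \<le> (K * \<bar>d\<bar>) * \<bar>(y + d) - y\<bar>"
  proof -
    have "((\<lambda>x. f x - f' y * x) has_field_derivative f' x - f' y) (at x within cball y \<bar>d\<bar>)" for x
      using assms(1)[of x] by (auto intro!: derivative_eq_intros intro: has_field_derivative_at_within)
    moreover have "\<bar>f' x - f' y\<bar> \<le> K * \<bar>d\<bar>" if "x \<in> cball y \<bar>d\<bar>" for x
      using order_trans[OF lip[of x y] mult_left_mono[OF _ K, of "\<bar>x - y\<bar>" "\<bar>d\<bar>"]] that
      by (simp add: dist_real_def abs_minus_commute)
    ultimately show ?thesis
      using field_differentiable_bound[of "cball y \<bar>d\<bar>" "\<lambda>x. f x - f' y * x" "\<lambda>x. f' x - f' y" "K * \<bar>d\<bar>" "y + d" y]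
      by (auto simp: dist_real_def)
  qed
  then show "\<bar>f (y + d) - f y - f' y * d\<bar> \<le> K * d\<^sup>2"
    by (simp add: algebra_simps power2_eq_square)
qed

text \<open>As \<open>f''\<close> has a modulus of continuity but no derivative, the intermediate
  point is split into two regimes. Nearby, \<open>f''\<close> varies by at most \<epsilon>; at
  distance at least \<delta> it varies by at most 2 K <= 2 K g^2 / \<delta>^2. The second regime
  costs a fourth power of \<open>g\<close>, whose expectation is of order t^2 for a Gaussian
  displacement and so disappears after division by t.\<close>

lemma taylor_second_order:
  fixes f f' f'' :: "real \<Rightarrow> real"
  assumes "\<And>x. (f has_real_derivative f' x) (at x)" "\<And>x. (f' has_real_derivative f'' x) (at x)"
    and K: "\<And>x. \<bar>f'' x\<bar> \<le> K" and \<delta>: "\<delta> > 0" "\<And>x y. \<bar>x - y\<bar> < \<delta> \<Longrightarrow> \<bar>f'' x - f'' y\<bar> \<le> \<epsilon>" and "\<epsilon> \<ge> 0"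
  shows "\<bar>f (x + g) - f x - f' x * g - f'' x * g\<^sup>2 / 2\<bar> \<le> \<epsilon> / 2 * g\<^sup>2 + K / \<delta>\<^sup>2 * g ^ 4"
proof (cases "g = 0")
  case False
  define d where "d m = (if m = 0 then f else if m = 1 then f' else f'')" for m :: nat
  have "\<forall>m t. m < 2 \<and> min x (x + g) \<le> t \<and> t \<le> max x (x + g) \<longrightarrow> DERIV (d m) t :> d (Suc m) t"
    using assms(1,2) by (auto simp: d_def)
  from Taylor[of 2 d f, OF _ _ this, of x "x + g"] False
  obtain t where t: "if x + g < x then x + g < t \<and> t < x else x < t \<and> t < x + g"
    and e: "f (x + g) = (\<Sum>m<2. d m x / fact m * (x + g - x) ^ m) + d 2 t / fact 2 * (x + g - x) ^ 2"
    by (auto simp: d_def)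
  have "f (x + g) - f x - f' x * g - f'' x * g\<^sup>2 / 2 = (f'' t - f'' x) * g\<^sup>2 / 2"
    using e by (simp add: d_def lessThan_nat_numeral numeral_2_eq_2 field_simps)
  moreover have "\<bar>f'' t - f'' x\<bar> \<le> \<epsilon> + 2 * K * g\<^sup>2 / \<delta>\<^sup>2"
  proof (cases "\<bar>t - x\<bar> < \<delta>")
    case True
    have "0 \<le> K" using K[of 0] by linarith
    then have "0 \<le> 2 * K * g\<^sup>2 / \<delta>\<^sup>2" by simp
    then show ?thesis using \<delta>(2)[OF True] by linarith
  next
    case False
    have "\<bar>t - x\<bar> \<le> \<bar>g\<bar>" using t by (auto split: if_splits)
    then have "\<delta> \<le> \<bar>g\<bar>" using False by linarith
    then have "\<delta>\<^sup>2 \<le> g\<^sup>2" using \<delta>(1) by (metis less_eq_real_def power2_abs power_mono)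
    then have "1 \<le> g\<^sup>2 / \<delta>\<^sup>2" using \<delta>(1) by simp
    have "\<bar>f'' t - f'' x\<bar> \<le> 2 * K * 1" using K[of t] K[of x] by linarith
    also have "\<dots> \<le> 2 * K * (g\<^sup>2 / \<delta>\<^sup>2)"
      using \<open>1 \<le> g\<^sup>2 / \<delta>\<^sup>2\<close> K[of 0] by (intro mult_left_mono) auto
    finally show ?thesis using assms(6) by simp
  qed
  then have "\<bar>f'' t - f'' x\<bar> * (g\<^sup>2 / 2) \<le> (\<epsilon> + 2 * K * g\<^sup>2 / \<delta>\<^sup>2) * (g\<^sup>2 / 2)"
    by (rule mult_right_mono) simp
  moreover have "\<bar>(f'' t - f'' x) * g\<^sup>2 / 2\<bar> = \<bar>f'' t - f'' x\<bar> * (g\<^sup>2 / 2)"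
    by (simp add: abs_mult)
  ultimately have "\<bar>f (x + g) - f x - f' x * g - f'' x * g\<^sup>2 / 2\<bar> \<le> (\<epsilon> + 2 * K * g\<^sup>2 / \<delta>\<^sup>2) * (g\<^sup>2 / 2)"
    by presburger
  also have "\<dots> = \<epsilon> / 2 * g\<^sup>2 + K / \<delta>\<^sup>2 * (g\<^sup>2 * g\<^sup>2)"
    by (simp add: distrib_right)
  also have "g\<^sup>2 * g\<^sup>2 = g ^ 4" by (simp add: power4_eq_xxxx power2_eq_square)
  finally show ?thesis .
qed simp

lemma integral_average_at_0:
  fixes g :: "real \<Rightarrow> real"
  assumes "continuous_on {0..} g"
  shows "(\<lambda>n. integral {0..1 / real (Suc n)} g * real (Suc n)) \<longlonglongrightarrow> g 0"
proof -
  have "continuous_on {0..1} g" using assms by (rule continuous_on_subset) auto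
  from integral_has_real_derivative[OF this, of 0]
  have "((\<lambda>y. (integral {0..y} g - integral {0..0} g) / (y - 0)) \<longlongrightarrow> g 0) (at 0 within {0..1})"
    by (simp add: has_field_derivative_iff)
  moreover have "filterlim (\<lambda>n. 1 / real (Suc n)) (at 0 within {0..1}) sequentially"
    unfolding filterlim_at using LIMSEQ_Suc[OF lim_1_over_n] by (auto intro!: always_eventually)
  ultimately have "(\<lambda>n. (integral {0..1 / real (Suc n)} g - integral {0..0} g) / (1 / real (Suc n) - 0)) \<longlonglongrightarrow> g 0"
    by (rule filterlim_compose)
  then show ?thesis by simp
qed

context bounded_sde begin

text \<open>The increment \<open>X t - X 0\<close> is split into the frozen Gaussian part \<open>\<sigma> (X 0) (W t - W 0)\<close>, whose
  square gives the second order term, the drift, and \<open>J - \<sigma> (X 0) (W t - W 0)\<close>, whose second moment is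
  \<open>O(t\<^sup>2)\<close>. With this splitting only moments of the Gaussian part of order above two are needed.\<close>

lemma short_time_expansion:
  fixes \<phi> \<phi>' \<phi>'' :: "real \<Rightarrow> real"
  assumes d1: "\<And>x. (\<phi> has_real_derivative \<phi>' x) (at x)" and d2: "\<And>x. (\<phi>' has_real_derivative \<phi>'' x) (at x)"
    and bd: "\<And>x. \<bar>\<phi> x\<bar> \<le> R" "\<And>x. \<bar>\<phi>' x\<bar> \<le> R" "\<And>x. \<bar>\<phi>'' x\<bar> \<le> R"
    and m2: "\<phi>'' \<in> borel_measurable borel"
    and \<delta>: "\<delta> > 0" "\<And>x y. \<bar>x - y\<bar> < \<delta> \<Longrightarrow> \<bar>\<phi>'' x - \<phi>'' y\<bar> \<le> \<epsilon>" and \<epsilon>: "\<epsilon> \<ge> 0"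
    and t: "0 < t" "t \<le> 1"
    and stat: "expectation (\<lambda>w. \<phi> (X t w)) = expectation (\<lambda>w. \<phi> (X 0 w))"
    and J: "has_ito_integral M W (\<lambda>s w. \<sigma> (X s w)) t J"
    and XJ: "AE w in M. X t w = X 0 w + integral {0..t} (\<lambda>s. b (X s w)) + J w"
  defines "c \<equiv> 2 * (K\<^sup>2 * (6 * K\<^sup>2 + 4)) + 2"
  shows "\<bar>expectation (\<lambda>w. \<phi>' (X 0 w) * ((X t w - X 0 w - J w) / t))
      + expectation (\<lambda>w. \<phi>'' (X 0 w) * (\<sigma> (X 0 w))\<^sup>2) / 2\<bar>
    \<le> R * (t + sqrt t / 2) * (2 * K\<^sup>2 + 2 * c) + (R * sqrt t / 2 + \<epsilon> / 2) * K\<^sup>2 + 3 * (R / \<delta>\<^sup>2) * K ^ 4 * t"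
proof -
  have R: "0 \<le> R" using bd(1)[of 0] by linarith
  have "continuous_on UNIV \<phi>" "continuous_on UNIV \<phi>'"
    using d1 d2 by (auto intro!: DERIV_continuous_on intro: has_field_derivative_at_within)
  then have [measurable]: "\<phi> \<in> borel_measurable borel" "\<phi>' \<in> borel_measurable borel" "\<phi>'' \<in> borel_measurable borel"
    using m2 by (auto intro: borel_measurable_continuous_onI)
  have [measurable]: "X t \<in> borel_measurable M" "X 0 \<in> borel_measurable M" "J \<in> borel_measurable M"
    using X_measurable t J by (auto simp: has_ito_integral_def)
  have XF0[measurable]: "X 0 \<in> borel_measurable (F 0)" using XF by simp
  define N where "N w = W t w - W 0 w" for w
  define G where "G w = \<sigma> (X 0 w) * N w" for w
  define B where "B w = X t w - X 0 w - J w" for w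
  define D where "D w = J w - G w" for w
  have N[measurable]: "N \<in> borel_measurable M" unfolding N_def using increment(2)[of 0 t] t by simp
  have [measurable]: "G \<in> borel_measurable M" "B \<in> borel_measurable M" "D \<in> borel_measurable M"
    unfolding G_def[abs_def] B_def[abs_def] D_def[abs_def] by measurable
  note mom = increment_moments[of 0 t, simplified, OF t(1), folded N_def]
  have B_bound: "AE w in M. \<bar>B w\<bar> \<le> K * t"
    unfolding B_def using drift_bound[OF _ XJ] t by simp
  have \<sigma>0: "(\<lambda>w. \<sigma> (X 0 w)) \<in> borel_measurable (F 0)" by measurable
  have D2: "integrable M (\<lambda>w. (D w)\<^sup>2)" "expectation (\<lambda>w. (D w)\<^sup>2) \<le> c * t\<^sup>2"
  proof -
    have "expectation (\<lambda>w. (\<sigma> (X s w) - \<sigma> (X 0 w))\<^sup>2) \<le> K\<^sup>2 * (6 * K\<^sup>2 + 4) * t" if "0 \<le> s" "s \<le> t" for s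
      using X_increment_moment[of s] that t
        mult_left_mono[of s t "K\<^sup>2 * (6 * K\<^sup>2 + 4)"] by auto
    from ito_integral_moments[OF t(1) J \<sigma>0 \<sigma>_bound this]
    show "integrable M (\<lambda>w. (D w)\<^sup>2)" "expectation (\<lambda>w. (D w)\<^sup>2) \<le> c * t\<^sup>2"
      by (auto simp: D_def G_def N_def c_def algebra_simps power2_eq_square)
  qed
  have \<phi>0: "(\<lambda>w. \<phi>' (X 0 w)) \<in> borel_measurable (F 0)" by measurable
  note EJ = ito_integral_expectation[OF t(1) J \<phi>0 bd(2)]
  define Q where "Q w = \<phi> (X t w) - \<phi> (X 0 w) - \<phi>' (X 0 w) * (B w + J w) - \<phi>'' (X 0 w) * (G w)\<^sup>2 / 2" for w
  have iB: "integrable M (\<lambda>w. \<phi>' (X 0 w) * B w)"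
  proof (rule integrable_const_bound[of _ "R * (K * t)"])
    show "AE w in M. norm (\<phi>' (X 0 w) * B w) \<le> R * (K * t)"
      using B_bound by eventually_elim (use bd(2) R in \<open>auto simp: abs_mult intro!: mult_mono\<close>)
  qed measurable
  have i\<phi>: "integrable M (\<lambda>w. \<phi> (X t w))" "integrable M (\<lambda>w. \<phi> (X 0 w))"
    using bd(1) by (auto intro!: integrable_const_bound[of _ R])
  have \<sigma>2: "\<bar>(\<sigma> x)\<^sup>2\<bar> \<le> K\<^sup>2" for x
    using \<sigma>_bound[of x] by (metis abs_ge_zero abs_power2 power2_abs power_mono)
  define H where "H w = \<phi>'' (X 0 w) * (\<sigma> (X 0 w))\<^sup>2" for w
  have HF: "H \<in> borel_measurable (F 0)" unfolding H_def[abs_def] by measurable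
  have HM[measurable]: "H \<in> borel_measurable M" unfolding H_def[abs_def] by measurable
  have Hb: "\<bar>H w\<bar> \<le> R * K\<^sup>2" for w
    unfolding H_def abs_mult by (intro mult_mono bd \<sigma>2) (use R in auto)
  have Hi: "integrable M H" using Hb by (auto intro!: integrable_const_bound[of _ "R * K\<^sup>2"])
  have iG: "integrable M (\<lambda>w. \<phi>'' (X 0 w) * (G w)\<^sup>2)"
    and EG: "expectation (\<lambda>w. \<phi>'' (X 0 w) * (G w)\<^sup>2) = expectation H * t"
  proof -
    have eq: "\<phi>'' (X 0 w) * (G w)\<^sup>2 = H w * (N w)\<^sup>2" for w
      by (simp add: G_def H_def power_mult_distrib)
    have id: "(\<lambda>x::real. x) \<in> borel_measurable borel" and sq: "(\<lambda>x::real. x\<^sup>2) \<in> borel_measurable borel" by measurable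
    have "indep_var borel H borel N" unfolding N_def by (rule increment(3)[OF _ t(1) HF]) simp
    from indep_var_compose[OF this id sq]
    have ind: "indep_var borel H borel (\<lambda>w. (N w)\<^sup>2)" by (simp add: comp_def)
    show "integrable M (\<lambda>w. \<phi>'' (X 0 w) * (G w)\<^sup>2)"
      unfolding eq by (rule indep_var_integrable[OF ind Hi mom(1)])
    show "expectation (\<lambda>w. \<phi>'' (X 0 w) * (G w)\<^sup>2) = expectation H * t"
      unfolding eq using indep_var_lebesgue_integral[OF ind Hi mom(1)] mom(4) by simp
  qed
  have EQ: "expectation Q = - (expectation (\<lambda>w. \<phi>' (X 0 w) * B w) + expectation H * t / 2)"
    unfolding Q_def using i\<phi> iB EJ(2,3) iG EG stat by (simp add: distrib_left)
  have iQ: "integrable M Q"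
    unfolding Q_def using i\<phi> iB EJ(2) iG by (simp add: distrib_left)
  have st: "sqrt t > 0" "sqrt t * sqrt t = t" using t by auto
  define S where "S w = (R + R / (2 * sqrt t)) * (2 * (K * t)\<^sup>2 + 2 * (D w)\<^sup>2)
      + (R * sqrt t / 2 + \<epsilon> / 2) * (K\<^sup>2 * (N w)\<^sup>2) + R / \<delta>\<^sup>2 * (K ^ 4 * (N w) ^ 4)" for w
  have QS: "AE w in M. \<bar>Q w\<bar> \<le> S w"
    using B_bound
  proof eventually_elim
    case (elim w)
    define x g d where "x = X 0 w" and "g = G w" and "d = B w + D w"
    have Xt: "X t w = x + g + d" by (simp add: x_def g_def d_def B_def D_def)
    have BJ: "B w + J w = g + d" by (simp add: g_def d_def D_def)
    \<comment> \<open>Second order accuracy is needed only in the Gaussian displacement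
      \<open>g\<close>; in the smaller \<open>d\<close> a first order expansion about
      \<open>x + g\<close> suffices.\<close>
    have "Q w = (\<phi> (x + g + d) - \<phi> (x + g) - \<phi>' (x + g) * d) + (\<phi>' (x + g) - \<phi>' x) * d
        + (\<phi> (x + g) - \<phi> x - \<phi>' x * g - \<phi>'' x * g\<^sup>2 / 2)"
      unfolding Q_def Xt BJ by (simp add: x_def[symmetric] g_def[symmetric] algebra_simps)
    moreover have "\<bar>\<phi> (x + g + d) - \<phi> (x + g) - \<phi>' (x + g) * d\<bar> \<le> R * d\<^sup>2"
      by (rule taylor_first_order(1)[OF d1 d2 bd(3)])
    \<comment> \<open>Here \<open>g\<close> is of order sqrt t and \<open>d\<close> of order t in
      mean square. Young's inequality with weight sqrt t makes both resulting terms of order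
      t^(3/2), still small after division by t.\<close>
    moreover have "\<bar>(\<phi>' (x + g) - \<phi>' x) * d\<bar> \<le> R * (sqrt t * g\<^sup>2 / 2 + d\<^sup>2 / (2 * sqrt t))"
    proof -
      have "\<bar>(\<phi>' (x + g) - \<phi>' x) * d\<bar> \<le> R * (\<bar>g\<bar> * \<bar>d\<bar>)"
        unfolding abs_mult mult.assoc[symmetric]
        by (intro mult_right_mono taylor_first_order(2)[OF d1 d2 bd(3)]) auto
      also have "\<bar>g\<bar> * \<bar>d\<bar> \<le> sqrt t * g\<^sup>2 / 2 + d\<^sup>2 / (2 * sqrt t)"
      proof -
        have "0 \<le> (sqrt t * \<bar>g\<bar> - \<bar>d\<bar>)\<^sup>2" by simp
        then have "2 * sqrt t * (\<bar>g\<bar> * \<bar>d\<bar>) \<le> t * g\<^sup>2 + d\<^sup>2"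
          using st by (simp add: power2_diff power_mult_distrib)
        then have "\<bar>g\<bar> * \<bar>d\<bar> \<le> (t * g\<^sup>2 + d\<^sup>2) / (2 * sqrt t)"
          using st by (simp add: field_simps)
        also have "\<dots> = sqrt t * g\<^sup>2 / 2 + d\<^sup>2 / (2 * sqrt t)"
        proof -
          have "(r * r * g\<^sup>2 + d\<^sup>2) / (2 * r) = r * g\<^sup>2 / 2 + d\<^sup>2 / (2 * r)" if "r > 0" for r
            using that by (simp add: add_divide_distrib)
          from this[OF st(1)] show ?thesis unfolding st(2) .
        qed
        finally show ?thesis .
      qed
      finally show ?thesis using R by (simp add: mult.assoc mult_left_mono)
    qed
    moreover have "\<bar>\<phi> (x + g) - \<phi> x - \<phi>' x * g - \<phi>'' x * g\<^sup>2 / 2\<bar> \<le> \<epsilon> / 2 * g\<^sup>2 + R / \<delta>\<^sup>2 * g ^ 4"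
      by (rule taylor_second_order[OF d1 d2 bd(3) \<delta> \<epsilon>])
    ultimately have "\<bar>Q w\<bar> \<le> R * d\<^sup>2 + R * (sqrt t * g\<^sup>2 / 2 + d\<^sup>2 / (2 * sqrt t)) + (\<epsilon> / 2 * g\<^sup>2 + R / \<delta>\<^sup>2 * g ^ 4)"
      by linarith
    also have "\<dots> = (R + R / (2 * sqrt t)) * d\<^sup>2 + (R * sqrt t / 2 + \<epsilon> / 2) * g\<^sup>2 + R / \<delta>\<^sup>2 * g ^ 4"
      by (simp add: algebra_simps)
    also have "\<dots> \<le> S w"
      unfolding S_def
    proof (intro add_mono mult_left_mono)
      have "(B w)\<^sup>2 \<le> (K * t)\<^sup>2" using elim by (metis abs_ge_zero power2_abs power_mono)
      moreover have "d\<^sup>2 \<le> 2 * (B w)\<^sup>2 + 2 * (D w)\<^sup>2"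
        using zero_le_power2[of "B w - D w"] by (simp add: d_def power2_eq_square algebra_simps)
      ultimately show "d\<^sup>2 \<le> 2 * (K * t)\<^sup>2 + 2 * (D w)\<^sup>2" by linarith
      have s: "(\<sigma> x)\<^sup>2 \<le> K\<^sup>2" using \<sigma>2[of x] by linarith
      show "g\<^sup>2 \<le> K\<^sup>2 * (N w)\<^sup>2"
        unfolding g_def G_def power_mult_distrib x_def[symmetric] by (intro mult_right_mono s) auto
      have "(\<sigma> x)\<^sup>2 * (\<sigma> x)\<^sup>2 \<le> K\<^sup>2 * K\<^sup>2" by (intro mult_mono s) auto
      then have "(\<sigma> x) ^ 4 \<le> K ^ 4" by (simp add: power4_eq_xxxx power2_eq_square mult.assoc)
      then show "g ^ 4 \<le> K ^ 4 * N w ^ 4"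
        unfolding g_def G_def power_mult_distrib x_def[symmetric] by (intro mult_right_mono) auto
    qed (use R st \<epsilon> in auto)
    finally show ?case .
  qed
  have iS: "integrable M S"
    unfolding S_def[abs_def] using D2(1) mom(1)[of 2] mom(1)[of 4]
    by (intro Bochner_Integration.integrable_add integrable_mult_right) (auto simp: less_top[symmetric])
  have ES: "expectation S = (R + R / (2 * sqrt t)) * (2 * (K * t)\<^sup>2 + 2 * expectation (\<lambda>w. (D w)\<^sup>2))
      + (R * sqrt t / 2 + \<epsilon> / 2) * (K\<^sup>2 * t) + R / \<delta>\<^sup>2 * (K ^ 4 * (3 * t\<^sup>2))"
    unfolding S_def[abs_def] using D2(1) mom(1)[of 2] mom(1)[of 4] mom(4,5)
    by (simp add: less_top[symmetric] prob_space)
  have "\<bar>expectation Q\<bar> \<le> expectation S"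
    using QS iQ iS by (intro order_trans[OF integral_abs_bound] integral_mono_AE) auto
  also have "\<dots> \<le> (R + R / (2 * sqrt t)) * (2 * (K * t)\<^sup>2 + 2 * (c * t\<^sup>2))
      + (R * sqrt t / 2 + \<epsilon> / 2) * (K\<^sup>2 * t) + R / \<delta>\<^sup>2 * (K ^ 4 * (3 * t\<^sup>2))"
    unfolding ES using D2(2) R st \<epsilon> by (intro add_mono mult_left_mono) (auto intro!: add_nonneg_nonneg)
  also have "\<dots> = t * (R * (t + sqrt t / 2) * (2 * K\<^sup>2 + 2 * c) + (R * sqrt t / 2 + \<epsilon> / 2) * K\<^sup>2 + 3 * (R / \<delta>\<^sup>2) * K ^ 4 * t)"
  proof -
    have "(R + R / (2 * r)) * (r * r) = R * (r * r + r / 2)" if "r > 0" for r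
      using that by (simp add: field_simps)
    from this[OF st(1)] have "(R + R / (2 * sqrt t)) * t = R * (t + sqrt t / 2)"
      unfolding st(2) .
    then have "(R + R / (2 * sqrt t)) * t * (t * (2 * K\<^sup>2 + 2 * c)) = R * (t + sqrt t / 2) * (t * (2 * K\<^sup>2 + 2 * c))"
      by simp
    moreover have "(R + R / (2 * sqrt t)) * (2 * (K * t)\<^sup>2 + 2 * (c * t\<^sup>2)) = (R + R / (2 * sqrt t)) * t * (t * (2 * K\<^sup>2 + 2 * c))"
      by (simp add: power2_eq_square algebra_simps)
    moreover have "u * (K\<^sup>2 * t) + v * (K ^ 4 * (3 * t\<^sup>2)) = t * (u * K\<^sup>2 + 3 * v * K ^ 4 * t)" for u v
      by (simp add: power2_eq_square algebra_simps)
    ultimately show ?thesis by (simp add: distrib_left mult.left_commute add.assoc)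
  qed
  finally have "\<bar>expectation Q\<bar> \<le> t * (R * (t + sqrt t / 2) * (2 * K\<^sup>2 + 2 * c) + (R * sqrt t / 2 + \<epsilon> / 2) * K\<^sup>2 + 3 * (R / \<delta>\<^sup>2) * K ^ 4 * t)" .
  moreover have "\<bar>expectation Q\<bar> = t * \<bar>expectation (\<lambda>w. \<phi>' (X 0 w) * (B w / t)) + expectation H / 2\<bar>"
  proof -
    have "expectation (\<lambda>w. \<phi>' (X 0 w) * (B w / t)) = expectation (\<lambda>w. \<phi>' (X 0 w) * B w) / t"
      by simp
    then have "t * (expectation (\<lambda>w. \<phi>' (X 0 w) * (B w / t)) + expectation H / 2) = - expectation Q"
      unfolding EQ using t by (simp add: field_simps)
    then show ?thesis using t by (metis abs_minus_cancel abs_mult abs_of_pos)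
  qed
  ultimately show ?thesis
    using t unfolding B_def H_def by (simp add: mult_le_cancel_left_pos)
qed

text \<open>Under stationarity the left side of the expansion is zero. After division by t the drift
  quotient converges to \<open>b (X 0)\<close> by continuity of paths and dominated convergence, and
  all errors vanish as t tends to 0 except one proportional to the oscillation \<epsilon> of
  \<phi>'', which is arbitrary.\<close>

lemma stationary_generator_mean_zero:
  fixes \<phi> \<phi>' \<phi>'' :: "real \<Rightarrow> real"
  assumes d1: "\<And>x. (\<phi> has_real_derivative \<phi>' x) (at x)" and d2: "\<And>x. (\<phi>' has_real_derivative \<phi>'' x) (at x)"
    and bd: "\<And>x. \<bar>\<phi> x\<bar> \<le> R" "\<And>x. \<bar>\<phi>' x\<bar> \<le> R" "\<And>x. \<bar>\<phi>'' x\<bar> \<le> R"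
    and uc: "uniformly_continuous_on UNIV \<phi>''"
    and stat: "\<And>t. t \<ge> 0 \<Longrightarrow> expectation (\<lambda>w. \<phi> (X t w)) = expectation (\<lambda>w. \<phi> (X 0 w))"
  shows "expectation (\<lambda>w. b (X 0 w) * \<phi>' (X 0 w) + (\<sigma> (X 0 w))\<^sup>2 * \<phi>'' (X 0 w) / 2) = 0"
proof -
  have R: "0 \<le> R" using bd(1)[of 0] by linarith
  have "continuous_on UNIV \<phi>'"
    using d2 by (auto intro!: DERIV_continuous_on intro: has_field_derivative_at_within)
  then have [measurable]: "\<phi>' \<in> borel_measurable borel" "\<phi>'' \<in> borel_measurable borel"
    using uc by (auto intro: borel_measurable_continuous_onI uniformly_continuous_imp_continuous)
  have X0[measurable]: "X 0 \<in> borel_measurable M" using X_measurable by simp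
  \<comment> \<open>A sequence of times, so that the integrated equation holds for all of them
    outside one null set.\<close>
  define t where "t n = 1 / real (Suc n)" for n
  have t: "0 < t n" "t n \<le> 1" for n by (auto simp: t_def)
  have "\<forall>n. \<exists>J. has_ito_integral M W (\<lambda>s w. \<sigma> (X s w)) (t n) J \<and>
        (AE w in M. X (t n) w = X 0 w + integral {0..t n} (\<lambda>s. b (X s w)) + J w)"
    using ito[OF less_imp_le[OF t(1)]] by blast
  from choice[OF this] obtain J where JXJ: "\<forall>n. has_ito_integral M W (\<lambda>s w. \<sigma> (X s w)) (t n) (J n) \<and>
        (AE w in M. X (t n) w = X 0 w + integral {0..t n} (\<lambda>s. b (X s w)) + J n w)" ..
  have J: "has_ito_integral M W (\<lambda>s w. \<sigma> (X s w)) (t n) (J n)"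
    and XJ: "AE w in M. X (t n) w = X 0 w + integral {0..t n} (\<lambda>s. b (X s w)) + J n w" for n
    using JXJ[rule_format, of n] by blast+
  have JM[measurable]: "J n \<in> borel_measurable M" for n using J by (auto simp: has_ito_integral_def)
  have XM[measurable]: "X (t n) \<in> borel_measurable M" for n by (rule X_measurable[OF less_imp_le[OF t(1)]])
  define B where "B n w = (X (t n) w - X 0 w - J n w) / t n" for n w
  have "AE w in M. \<forall>n. X (t n) w = X 0 w + integral {0..t n} (\<lambda>s. b (X s w)) + J n w"
    using XJ by (simp add: AE_all_countable)
  then have conv: "AE w in M. (\<lambda>n. \<phi>' (X 0 w) * B n w) \<longlonglongrightarrow> \<phi>' (X 0 w) * b (X 0 w)"
    using X_cont
  proof eventually_elim
    case (elim w)
    have "continuous_on {0..} (\<lambda>s. b (X s w))"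
      using continuous_on_compose2[OF b_cont elim(2)] by auto
    from integral_average_at_0[OF this]
    have "(\<lambda>n. B n w) \<longlonglongrightarrow> b (X 0 w)"
      using elim(1) by (simp add: B_def t_def)
    then show ?case by (intro tendsto_mult tendsto_const)
  qed
  have lim: "(\<lambda>n. expectation (\<lambda>w. \<phi>' (X 0 w) * B n w)) \<longlonglongrightarrow> expectation (\<lambda>w. \<phi>' (X 0 w) * b (X 0 w))"
  proof (rule integral_dominated_convergence[where w = "\<lambda>_. R * K"])
    show "AE w in M. norm (\<phi>' (X 0 w) * B n w) \<le> R * K" for n
      using drift_bound[OF less_imp_le[OF t(1)] XJ, of n]
    proof eventually_elim
      case (elim w)
      then have "\<bar>B n w\<bar> \<le> K" using t[of n] by (simp add: B_def field_simps)
      then show ?case using bd(2) R by (auto simp: abs_mult intro!: mult_mono)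
    qed
    show "(\<lambda>w. \<phi>' (X 0 w) * B n w) \<in> borel_measurable M" for n
      unfolding B_def by measurable
  qed (use conv in auto)
  define A where "A = expectation (\<lambda>w. \<phi>' (X 0 w) * b (X 0 w)) + expectation (\<lambda>w. \<phi>'' (X 0 w) * (\<sigma> (X 0 w))\<^sup>2) / 2"
  have small: "\<bar>A\<bar> \<le> \<epsilon> / 2 * K\<^sup>2" if "\<epsilon> > 0" for \<epsilon>
  proof -
    obtain \<delta> where \<delta>: "\<delta> > 0" "\<And>x y. \<bar>x - y\<bar> < \<delta> \<Longrightarrow> \<bar>\<phi>'' x - \<phi>'' y\<bar> \<le> \<epsilon>"
      using uc \<open>\<epsilon> > 0\<close> unfolding uniformly_continuous_on_def dist_real_def
      by (metis UNIV_I less_imp_le)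
    define c where "c = 2 * (K\<^sup>2 * (6 * K\<^sup>2 + 4)) + 2"
    have bnd: "\<bar>expectation (\<lambda>w. \<phi>' (X 0 w) * B n w) + expectation (\<lambda>w. \<phi>'' (X 0 w) * (\<sigma> (X 0 w))\<^sup>2) / 2\<bar>
      \<le> R * (t n + sqrt (t n) / 2) * (2 * K\<^sup>2 + 2 * c) + (R * sqrt (t n) / 2 + \<epsilon> / 2) * K\<^sup>2 + 3 * (R / \<delta>\<^sup>2) * K ^ 4 * t n" for n
      unfolding B_def c_def
      by (rule short_time_expansion[OF d1 d2 bd _ \<delta> _ t stat J XJ]) (use that t[of n] in auto)
    have t0: "t \<longlonglongrightarrow> 0" unfolding t_def by (rule LIMSEQ_Suc[OF lim_1_over_n])
    have l1: "(\<lambda>n. \<bar>expectation (\<lambda>w. \<phi>' (X 0 w) * B n w) + expectation (\<lambda>w. \<phi>'' (X 0 w) * (\<sigma> (X 0 w))\<^sup>2) / 2\<bar>) \<longlonglongrightarrow> \<bar>A\<bar>"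
      unfolding A_def by (intro tendsto_intros lim)
    have l2: "(\<lambda>n. R * (t n + sqrt (t n) / 2) * (2 * K\<^sup>2 + 2 * c) + (R * sqrt (t n) / 2 + \<epsilon> / 2) * K\<^sup>2 + 3 * (R / \<delta>\<^sup>2) * K ^ 4 * t n)
      \<longlonglongrightarrow> R * (0 + sqrt 0 / 2) * (2 * K\<^sup>2 + 2 * c) + (R * sqrt 0 / 2 + \<epsilon> / 2) * K\<^sup>2 + 3 * (R / \<delta>\<^sup>2) * K ^ 4 * 0"
      by (intro tendsto_intros t0) auto
    have "\<bar>A\<bar> \<le> R * (0 + sqrt 0 / 2) * (2 * K\<^sup>2 + 2 * c) + (R * sqrt 0 / 2 + \<epsilon> / 2) * K\<^sup>2 + 3 * (R / \<delta>\<^sup>2) * K ^ 4 * 0"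
      by (rule LIMSEQ_le[OF l1 l2]) (use bnd in auto)
    then show ?thesis by simp
  qed
  have "((\<lambda>\<epsilon>. \<epsilon> / 2 * K\<^sup>2) \<longlongrightarrow> 0 / 2 * K\<^sup>2) (at_right 0)"
    by (intro tendsto_intros) auto
  then have "\<bar>A\<bar> \<le> 0 / 2 * K\<^sup>2"
    by (rule tendsto_lowerbound)
      (use small in \<open>auto simp: eventually_at_right_less intro: eventually_at_rightI[of 0 1]\<close>)
  then have A0: "A = 0" by simp
  have "integrable M (\<lambda>w. \<phi>' (X 0 w) * b (X 0 w))"
    using bd(2) b_bound R by (intro integrable_const_bound[of _ "R * K"]) (auto simp: abs_mult intro!: mult_mono)
  moreover have "integrable M (\<lambda>w. \<phi>'' (X 0 w) * (\<sigma> (X 0 w))\<^sup>2)"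
  proof -
    have "(\<sigma> x)\<^sup>2 \<le> K\<^sup>2" for x
      using \<sigma>_bound[of x] by (metis abs_ge_zero power2_abs power_mono)
    then show ?thesis
      using bd(3) R by (intro integrable_const_bound[of _ "R * K\<^sup>2"]) (auto simp: abs_mult intro!: mult_mono)
  qed
  ultimately show ?thesis using A0 by (simp add: A_def mult.commute)
qed

end

subsection \<open>Periodic functions\<close>

lemma periodic_reduce:
  assumes "periodic_fun_simple f L" "L > (0::real)"
  shows "f (x rmod L) = f x"
proof -
  interpret periodic_fun_simple f L by fact
  have "f (x - of_int \<lfloor>x / L\<rfloor> * L) = f x" by (rule minus_of_int)
  then show ?thesis using assms(2) by (simp add: rmod_def mult.commute)
qed

lemma rmod_range: "L > 0 \<Longrightarrow> x rmod L \<in> {0..<L}"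
  using rmod_less[of L x] rmod_nonneg[of L x] by auto

lemma periodic_bounded:
  fixes f :: "real \<Rightarrow> real"
  assumes "periodic_fun_simple f L" "L > 0" "continuous_on UNIV f"
  obtains K where "K > 0" "\<And>x. \<bar>f x\<bar> \<le> K"
proof -
  have "compact (f ` {0..L})"
    by (intro compact_continuous_image continuous_on_subset[OF assms(3)]) auto
  then obtain K where K: "\<And>y. y \<in> f ` {0..L} \<Longrightarrow> norm y \<le> K"
    using compact_imp_bounded bounded_iff by metis
  have b: "\<bar>f x\<bar> \<le> max K 1" for x
  proof -
    have "f (x rmod L) \<in> f ` {0..L}" using rmod_range[OF assms(2), of x] by auto
    from K[OF this] show ?thesis using periodic_reduce[OF assms(1,2), of x] by simp
  qed
  show ?thesis by (rule that[of "max K 1"]) (use b in auto)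
qed

lemma periodic_bounded_below:
  fixes f :: "real \<Rightarrow> real"
  assumes "periodic_fun_simple f L" "L > 0" "continuous_on UNIV f" "\<And>x. f x > 0"
  obtains m where "m > 0" "\<And>x. m \<le> f x"
proof -
  have "periodic_fun_simple (\<lambda>x. 1 / f x) L" using assms(1) by (simp add: periodic_fun_simple_def)
  moreover have "continuous_on UNIV (\<lambda>x. 1 / f x)"
    using assms(3,4) by (intro continuous_intros) (auto simp: less_le)
  ultimately obtain K where "K > 0" "\<And>x. \<bar>1 / f x\<bar> \<le> K" using periodic_bounded assms(2) by blast
  have "1 / K \<le> f x" for x
  proof -
    have "1 / f x \<le> K" using \<open>\<And>x. \<bar>1 / f x\<bar> \<le> K\<close>[of x] by linarith
    then show ?thesis using assms(4)[of x] \<open>K > 0\<close> by (simp add: field_simps)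
  qed
  then show ?thesis using that[of "1 / K"] \<open>K > 0\<close> by auto
qed

lemma periodic_uniformly_continuous:
  fixes f :: "real \<Rightarrow> real"
  assumes "periodic_fun_simple f L" "L > 0" "continuous_on UNIV f"
  shows "uniformly_continuous_on UNIV f"
proof -
  interpret periodic_fun_simple f L by fact
  have uc: "uniformly_continuous_on {-L..2*L} f"
    by (intro compact_uniformly_continuous continuous_on_subset[OF assms(3)]) auto
  show ?thesis unfolding uniformly_continuous_on_def
  proof safe
    fix e :: real assume "e > 0"
    then obtain d where d: "d > 0" "\<And>x y. x \<in> {-L..2*L} \<Longrightarrow> y \<in> {-L..2*L} \<Longrightarrow> dist y x < d \<Longrightarrow> dist (f y) (f x) < e"
      using uc unfolding uniformly_continuous_on_def by metis
    \<comment> \<open>Distance below \<open>L\<close> keeps the translate of \<open>y\<close> in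
      [-L, 2L] once \<open>x\<close> has been moved to [0, L).\<close>
    have "dist (f y) (f x) < e" if "dist y x < min d L" for x y
    proof -
      define n where "n = \<lfloor>x / L\<rfloor>"
      have x: "x - of_int n * L \<in> {0..<L}"
        using rmod_range[OF assms(2), of x] assms(2) by (simp add: rmod_def n_def mult.commute)
      have "dist (f (y - of_int n * L)) (f (x - of_int n * L)) < e"
        by (rule d(2)) (use x that in \<open>auto simp: dist_real_def\<close>)
      then show ?thesis by (simp add: minus_of_int)
    qed
    then show "\<exists>d>0. \<forall>x\<in>UNIV. \<forall>x'\<in>UNIV. dist x' x < d \<longrightarrow> dist (f x') (f x) < e"
      using d(1) assms(2) by (intro exI[of _ "min d L"]) auto
  qed
qed

lemma antiderivative:
  fixes f :: "real \<Rightarrow> real"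
  assumes "continuous_on UNIV f"
  obtains A where "\<And>x. (A has_real_derivative f x) (at x)"
  using einterval_antiderivative[of "-\<infinity>" "\<infinity>" f] assms
  by (auto simp: continuous_on_eq_continuous_at has_real_derivative_iff_has_vector_derivative)

lemma integral_derivative:
  fixes f :: "real \<Rightarrow> real"
  assumes "a \<le> b" "\<And>x. (A has_real_derivative f x) (at x)"
  shows "integral {a..b} f = A b - A a"
  by (intro integral_unique fundamental_theorem_of_calculus assms(1))
    (use assms(2) in \<open>auto simp flip: has_real_derivative_iff_has_vector_derivative
      intro: has_field_derivative_at_within\<close>)

lemma continuous_of_derivative:
  "(\<And>x. (f has_real_derivative f' x) (at x)) \<Longrightarrow> continuous_on UNIV f"
  by (rule DERIV_continuous_on) (blast intro: has_field_derivative_at_within)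

lemma derivative_zero_eq:
  fixes f :: "real \<Rightarrow> real"
  assumes "\<And>x. (f has_real_derivative 0) (at x)"
  shows "f x = f y"
  using DERIV_isconst_all[of f x y] assms by blast

lemma periodic_integral_derivative:
  fixes f :: "real \<Rightarrow> real"
  assumes "periodic_fun_simple A L" "L > 0" "\<And>x. (A has_real_derivative f x) (at x)"
  shows "integral {0..L} f = 0"
proof -
  interpret periodic_fun_simple A L by fact
  show ?thesis using integral_derivative[of 0 L A f] assms plus_period[of 0] by simp
qed

lemma periodic_derivative:
  fixes f f' :: "real \<Rightarrow> real"
  assumes "periodic_fun_simple f L" "\<And>x. (f has_real_derivative f' x) (at x)"
  shows "periodic_fun_simple f' L"
proof
  fix x
  interpret periodic_fun_simple f L by fact
  have "((\<lambda>y. f (y + L)) has_real_derivative f' (x + L)) (at x)"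
    using DERIV_shift[of f "f' (x + L)" x L] assms(2)[of "x + L"] by simp
  then have "(f has_real_derivative f' (x + L)) (at x)" by (simp add: plus_period)
  then show "f' (x + L) = f' x" using assms(2) DERIV_unique by blast
qed

lemma periodic_antiderivative:
  fixes f A :: "real \<Rightarrow> real"
  assumes "periodic_fun_simple f L" "\<And>x. (A has_real_derivative f x) (at x)"
  shows "A (x + L) - A x = A L - A 0"
proof -
  interpret periodic_fun_simple f L by fact
  have "((\<lambda>x. A (x + L) - A x) has_real_derivative 0) (at x)" for x
  proof -
    have "((\<lambda>x. A (x + L)) has_real_derivative f x) (at x)"
      using DERIV_shift[of A "f (x + L)" x L] assms(2)[of "x + L"] by (simp add: plus_period)
    then show ?thesis by (auto intro!: derivative_eq_intros assms(2))
  qed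
  from derivative_zero_eq[OF this, of x 0] show ?thesis by simp
qed

lemma periodic_integral_shift:
  fixes f :: "real \<Rightarrow> real"
  assumes "periodic_fun_simple f L" "L > 0" "continuous_on UNIV f"
  shows "integral {a..a + L} f = integral {0..L} f"
proof -
  obtain A where A: "\<And>x. (A has_real_derivative f x) (at x)" using antiderivative[OF assms(3)] by metis
  show ?thesis
    using integral_derivative[of a "a + L" A f] integral_derivative[of 0 L A f] A assms(2)
      periodic_antiderivative[OF assms(1) A, of a] by simp
qed

lemma periodic_integral_translate:
  fixes f :: "real \<Rightarrow> real"
  assumes "periodic_fun_simple f L" "L > 0" "continuous_on UNIV f"
  shows "integral {0..L} (\<lambda>x. f (x + k)) = integral {0..L} f"
proof -
  obtain A where A: "\<And>x. (A has_real_derivative f x) (at x)" using antiderivative[OF assms(3)] by metis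
  have "((\<lambda>x. A (x + k)) has_real_derivative f (x + k)) (at x)" for x
    using DERIV_shift[of A "f (x + k)" x k] A[of "x + k"] by simp
  from integral_derivative[OF _ this, of 0 L]
  show ?thesis
    using integral_derivative[of 0 L A f] A assms(2)
      periodic_antiderivative[OF assms(1) A, of k] by (simp add: add.commute)
qed

lemma integrable_cont: "continuous_on UNIV f \<Longrightarrow> f integrable_on {a..b::real}"
  for f :: "real \<Rightarrow> real"
  by (rule integrable_continuous_real) (rule continuous_on_subset, auto)

lemma integral_mono_cont:
  fixes f g :: "real \<Rightarrow> real"
  assumes "continuous_on UNIV f" "continuous_on UNIV g" "\<And>x. a \<le> x \<Longrightarrow> x \<le> b \<Longrightarrow> f x \<le> g x"
  shows "integral {a..b} f \<le> integral {a..b} g"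
  by (intro integral_le integrable_cont assms) (use assms in auto)

text \<open>Integrate (|f| - m)^2 >= 0, where m is the mean of |f|.\<close>

lemma integral_abs_Cauchy_Schwarz:
  fixes f :: "real \<Rightarrow> real"
  assumes "continuous_on UNIV f" "a \<le> b"
  shows "(integral {a..b} (\<lambda>x. \<bar>f x\<bar>))\<^sup>2 \<le> (b - a) * integral {a..b} (\<lambda>x. (f x)\<^sup>2)"
proof (cases "a = b")
  case False
  then have ab: "b - a > 0" using assms by simp
  define m where "m = integral {a..b} (\<lambda>x. \<bar>f x\<bar>) / (b - a)"
  have c: "continuous_on UNIV (\<lambda>x. \<bar>f x\<bar>)" "continuous_on UNIV (\<lambda>x. (f x)\<^sup>2)" using assms by (auto intro!: continuous_intros)
  have "integral {a..b} (\<lambda>x. 2 * m * \<bar>f x\<bar> - m\<^sup>2) \<le> integral {a..b} (\<lambda>x. (f x)\<^sup>2)"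
  proof (rule integral_mono_cont)
    fix x
    have "0 \<le> (\<bar>f x\<bar> - m)\<^sup>2" by simp
    then show "2 * m * \<bar>f x\<bar> - m\<^sup>2 \<le> (f x)\<^sup>2" by (simp add: power2_diff mult_ac)
  qed (intro continuous_intros assms)+
  moreover have "integral {a..b} (\<lambda>x. 2 * m * \<bar>f x\<bar> - m\<^sup>2) = 2 * m * integral {a..b} (\<lambda>x. \<bar>f x\<bar>) - m\<^sup>2 * (b - a)"
    using integrable_cont[OF c(1)] assms(2)
    by (subst integral_diff) (auto intro: integrable_on_mult_right)
  moreover have "integral {a..b} (\<lambda>x. \<bar>f x\<bar>) = m * (b - a)" using ab by (simp add: m_def)
  ultimately have "m\<^sup>2 * (b - a) \<le> integral {a..b} (\<lambda>x. (f x)\<^sup>2)" by (simp add: power2_eq_square)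
  then have "(b - a) * (m\<^sup>2 * (b - a)) \<le> (b - a) * integral {a..b} (\<lambda>x. (f x)\<^sup>2)"
    using ab by (intro mult_left_mono) auto
  then show ?thesis
    using \<open>integral {a..b} (\<lambda>x. \<bar>f x\<bar>) = m * (b - a)\<close> by (simp add: power2_eq_square mult_ac)
qed simp

subsection \<open>The stationary density\<close>

locale stationary_data =
  fixes L :: real and b b' \<sigma> \<sigma>' \<sigma>'' :: "real \<Rightarrow> real"
  assumes L: "L > 0"
    and b_per: "periodic_fun_simple b L" and \<sigma>_per: "periodic_fun_simple \<sigma> L"
    and db: "\<And>x. (b has_real_derivative b' x) (at x)" and b'_cont: "continuous_on UNIV b'"
    and d\<sigma>: "\<And>x. (\<sigma> has_real_derivative \<sigma>' x) (at x)"
    and d\<sigma>': "\<And>x. (\<sigma>' has_real_derivative \<sigma>'' x) (at x)" and \<sigma>''_cont: "continuous_on UNIV \<sigma>''"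
    and \<sigma>_nz: "\<And>x. \<sigma> x \<noteq> 0"
begin

lemma b_cont: "continuous_on UNIV b" and \<sigma>_cont: "continuous_on UNIV \<sigma>" and \<sigma>'_cont: "continuous_on UNIV \<sigma>'"
  using db d\<sigma> d\<sigma>' by (auto intro: continuous_of_derivative)

text \<open>\<open>v x = exp (A x) * \<integral>{x..x + L} exp (- A y) dy\<close> with \<open>A' = 2 b / \<sigma>\<^sup>2\<close> is periodic because \<open>A (x + L) - A x\<close> is
  constant, and \<open>q\<close> is \<open>v / \<sigma>\<^sup>2\<close>, normalised.\<close>

lemma stationary_density_exists:
  obtains q q' q'' :: "real \<Rightarrow> real" and J :: real
  where "periodic_fun_simple q L" "\<And>x. q x > 0" "integral {0..L} q = 1"
    "\<And>x. (q has_real_derivative q' x) (at x)" "\<And>x. (q' has_real_derivative q'' x) (at x)"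
    "continuous_on UNIV q''" "\<And>x. b x * q x - (\<sigma> x * \<sigma>' x * q x + (\<sigma> x)\<^sup>2 * q' x / 2) = J"
proof -
  interpret b: periodic_fun_simple b L by (rule b_per)
  interpret \<sigma>: periodic_fun_simple \<sigma> L by (rule \<sigma>_per)
  define r r' r'' where "r x = 1 / (\<sigma> x)\<^sup>2" and "r' x = - 2 * \<sigma>' x / \<sigma> x ^ 3"
    and "r'' x = - 2 * \<sigma>'' x / \<sigma> x ^ 3 + 6 * (\<sigma>' x)\<^sup>2 / \<sigma> x ^ 4" for x
  have dr: "(r has_real_derivative r' x) (at x)" for x
    unfolding r_def[abs_def] r'_def using \<sigma>_nz[of x]
    by (auto intro!: derivative_eq_intros d\<sigma> simp: field_simps power2_eq_square power3_eq_cube)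
  have dr': "(r' has_real_derivative r'' x) (at x)" for x
    unfolding r'_def[abs_def] r''_def using \<sigma>_nz[of x]
    by (auto intro!: derivative_eq_intros d\<sigma> d\<sigma>' simp: field_simps power2_eq_square power3_eq_cube power4_eq_xxxx)
  have r''_cont: "continuous_on UNIV r''"
    unfolding r''_def[abs_def] by (intro continuous_intros \<sigma>_cont \<sigma>'_cont \<sigma>''_cont) (use \<sigma>_nz in auto)
  have r_cont: "continuous_on UNIV r" "continuous_on UNIV r'" using dr dr' by (auto intro: continuous_of_derivative)
  define g where "g x = 2 * b x * r x" for x
  have g_per: "periodic_fun_simple g L" by standard (simp add: g_def r_def b.plus_period \<sigma>.plus_period)
  define g' where "g' x = 2 * b' x * r x + 2 * b x * r' x" for x
  have dg: "(g has_real_derivative g' x) (at x)" for x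
    unfolding g_def[abs_def] g'_def by (auto intro!: derivative_eq_intros db dr)
  have g_cont: "continuous_on UNIV g" using dg by (rule continuous_of_derivative)
  have g'_cont: "continuous_on UNIV g'"
    unfolding g'_def[abs_def] by (intro continuous_intros b_cont b'_cont r_cont)
  obtain A where A: "\<And>x. (A has_real_derivative g x) (at x)" using antiderivative[OF g_cont] by metis
  define \<kappa> where "\<kappa> = A L - A 0"
  have A_shift: "A (x + L) = A x + \<kappa>" for x
    using periodic_antiderivative[OF g_per A, of x] by (simp add: \<kappa>_def)
  have eA_cont: "continuous_on UNIV (\<lambda>x. exp (- A x))"
    by (intro continuous_intros continuous_of_derivative[OF A])
  obtain I where I: "\<And>x. (I has_real_derivative exp (- A x)) (at x)" using antiderivative[OF eA_cont] by metis
  define v where "v x = exp (A x) * (I (x + L) - I x)" for x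
  \<comment> \<open>\<open>c\<close> is the inhomogeneity in v' = g v + c and, up to normalisation,
    the stationary flux: \<open>J = - c / (2 * Z)\<close>. It vanishes exactly when \<kappa> = 0,
    that is when the potential \<open>A\<close> is periodic.\<close>
  define c where "c = exp (- \<kappa>) - 1"
  have I': "((\<lambda>x. I (x + L)) has_real_derivative exp (- A x) * exp (- \<kappa>)) (at x)" for x
    using DERIV_shift[of I "exp (- A (x + L))" x L] I[of "x + L"]
    by (simp add: A_shift exp_add[symmetric])
  have dv: "(v has_real_derivative g x * v x + c) (at x)" for x
    unfolding v_def[abs_def] by (auto intro!: derivative_eq_intros A I I' simp: algebra_simps c_def simp flip: exp_add)
  have I_mono: "I x < I (x + L)" for x
  proof (rule DERIV_pos_imp_increasing_open[of x "x + L"])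
    show "x < x + L" using L by simp
    show "continuous_on {x..x + L} I"
      using continuous_of_derivative[OF I] by (rule continuous_on_subset) auto
    show "\<exists>z. DERIV I y :> z \<and> 0 < z" for y using I[of y] exp_gt_zero by blast
  qed
  have v_pos: "v x > 0" for x using I_mono[of x] by (simp add: v_def)
  have v_per: "v (x + L) = v x" for x
  proof -
    have "((\<lambda>x. I (x + L) - exp (- \<kappa>) * I x) has_real_derivative 0) (at x)" for x
      by (auto intro!: derivative_eq_intros I I')
    from derivative_zero_eq[OF this, of "x + L" x]
    have "I (x + L + L) - I (x + L) = exp (- \<kappa>) * (I (x + L) - I x)" by (simp add: algebra_simps)
    then have "v (x + L) = exp (A x) * (exp \<kappa> * exp (- \<kappa>)) * (I (x + L) - I x)"
      by (simp add: v_def A_shift exp_add)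
    also have "exp \<kappa> * exp (- \<kappa>) = 1" by (simp flip: exp_add)
    finally show ?thesis by (simp add: v_def)
  qed
  have v_cont: "continuous_on UNIV v" using dv by (rule continuous_of_derivative)
  define Z where "Z = integral {0..L} (\<lambda>x. v x * r x)"
  have vr_cont: "continuous_on UNIV (\<lambda>x. v x * r x)" by (intro continuous_intros v_cont r_cont)
  have r_pos: "r x > 0" for x using \<sigma>_nz[of x] by (simp add: r_def)
  have "Z \<noteq> 0"
    unfolding Z_def
  proof (subst integral_eq_0_iff)
    show "continuous_on {0..L} (\<lambda>x. v x * r x)" using vr_cont by (rule continuous_on_subset) auto
    show "\<not> (\<forall>x\<in>{0..L}. v x * r x = 0)"
      using v_pos[of 0] r_pos[of 0] L by (auto intro!: bexI[of _ 0])
  qed (use L v_pos r_pos in \<open>auto simp: less_imp_le\<close>)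
  moreover have "Z \<ge> 0" unfolding Z_def
    by (intro integral_nonneg integrable_cont vr_cont) (use v_pos r_pos in \<open>auto simp: less_imp_le\<close>)
  ultimately have Z: "Z > 0" by simp
  define q where "q x = v x * r x / Z" for x
  define v' where "v' x = g x * v x + c" for x
  define v'' where "v'' x = g' x * v x + g x * v' x" for x
  define q' where "q' x = (v' x * r x + v x * r' x) / Z" for x
  define q'' where "q'' x = (v'' x * r x + 2 * v' x * r' x + v x * r'' x) / Z" for x
  have dv1: "(v has_real_derivative v' x) (at x)" for x using dv by (simp add: v'_def)
  have dv': "(v' has_real_derivative v'' x) (at x)" for x
    unfolding v'_def[abs_def] v''_def by (auto intro!: derivative_eq_intros dg dv)
  have v'_cont: "continuous_on UNIV v'" using dv' by (rule continuous_of_derivative)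
  have v''_cont: "continuous_on UNIV v''"
    unfolding v''_def[abs_def] by (intro continuous_intros g'_cont g_cont v_cont v'_cont)
  show ?thesis
  proof (rule that[of q q' q'' "- c / (2 * Z)"])
    show "periodic_fun_simple q L" by standard (simp add: q_def v_per r_def \<sigma>.plus_period)
    show "q x > 0" for x using v_pos[of x] r_pos[of x] Z by (simp add: q_def)
    show "integral {0..L} q = 1" using Z by (simp add: q_def[abs_def] Z_def[symmetric] integral_divide)
    show "(q has_real_derivative q' x) (at x)" for x
      unfolding q_def[abs_def] q'_def using Z by (auto intro!: derivative_eq_intros dv1 dr simp: field_simps)
    show "(q' has_real_derivative q'' x) (at x)" for x
      unfolding q'_def[abs_def] q''_def using Z
      by (auto intro!: derivative_eq_intros dv1 dv' dr dr' simp: field_simps)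
    show "continuous_on UNIV q''"
      unfolding q''_def[abs_def]
      by (intro continuous_intros v''_cont v'_cont v_cont r_cont r''_cont) (use Z in auto)
    show "b x * q x - (\<sigma> x * \<sigma>' x * q x + (\<sigma> x)\<^sup>2 * q' x / 2) = - c / (2 * Z)" for x
    proof -
      have 1: "(\<sigma> x)\<^sup>2 * r x = 1" using \<sigma>_nz[of x] by (simp add: r_def)
      have 2: "(\<sigma> x)\<^sup>2 * r' x = - 2 * \<sigma> x * \<sigma>' x * r x" using \<sigma>_nz[of x] by (simp add: r_def r'_def field_simps power2_eq_square power3_eq_cube)
      have "(\<sigma> x)\<^sup>2 * q' x = (((\<sigma> x)\<^sup>2 * r x) * v' x + v x * ((\<sigma> x)\<^sup>2 * r' x)) / Z"
        by (simp add: q'_def algebra_simps)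
      also have "\<dots> = (v' x - 2 * \<sigma> x * \<sigma>' x * r x * v x) / Z"
        unfolding 1 2 by simp
      finally have "(\<sigma> x)\<^sup>2 * q' x = (2 * b x * r x * v x + c - 2 * \<sigma> x * \<sigma>' x * r x * v x) / Z"
        by (simp add: v'_def g_def)
      then show ?thesis using Z by (simp add: q_def field_simps)
    qed
  qed
qed

text \<open>Testing stationarity against the solution \<open>\<phi>\<close> of \<open>b \<phi>' + \<sigma>\<^sup>2 \<phi>'' / 2 = p / q - 1\<close>
  gives \<open>\<integral> q (p / q - 1)\<^sup>2 = 0\<close>.\<close>

lemma stationary_density_unique:
  assumes q_per: "periodic_fun_simple q L" and q_pos: "\<And>x. q x > 0" and q_int: "integral {0..L} q = 1"
    and dq: "\<And>x. (q has_real_derivative q' x) (at x)"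
    and flux: "\<And>x. b x * q x - (\<sigma> x * \<sigma>' x * q x + (\<sigma> x)\<^sup>2 * q' x / 2) = J"
    and p_per: "periodic_fun_simple p L" and p_cont: "continuous_on UNIV p" and p_int: "integral {0..L} p = 1"
    and weak: "\<And>\<phi> \<phi>' \<phi>''. periodic_fun_simple \<phi> L \<Longrightarrow> (\<And>x. (\<phi> has_real_derivative \<phi>' x) (at x)) \<Longrightarrow>
       (\<And>x. (\<phi>' has_real_derivative \<phi>'' x) (at x)) \<Longrightarrow> continuous_on UNIV \<phi>'' \<Longrightarrow>
       integral {0..L} (\<lambda>x. (b x * \<phi>' x + (\<sigma> x)\<^sup>2 * \<phi>'' x / 2) * p x) = 0"
  shows "p x = q x"
proof -
  interpret b: periodic_fun_simple b L by (rule b_per)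
  interpret \<sigma>: periodic_fun_simple \<sigma> L by (rule \<sigma>_per)
  interpret q: periodic_fun_simple q L by (rule q_per)
  interpret p: periodic_fun_simple p L by (rule p_per)
  have q_cont: "continuous_on UNIV q" using dq by (rule continuous_of_derivative)
  define r where "r x = 1 / (\<sigma> x)\<^sup>2" for x
  have \<sigma>r: "(\<sigma> x)\<^sup>2 * r x = 1" for x using \<sigma>_nz[of x] by (simp add: r_def)
  have r_cont: "continuous_on UNIV r" unfolding r_def[abs_def] by (intro continuous_intros \<sigma>_cont) (use \<sigma>_nz in auto)
  define g where "g x = p x / q x - 1" for x
  have g_cont: "continuous_on UNIV g" unfolding g_def[abs_def]
    by (intro continuous_intros q_cont p_cont) (use q_pos in \<open>auto simp: less_le\<close>)
  have gq: "g x * q x = p x - q x" for x using q_pos[of x] by (simp add: g_def field_simps)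
  define a where "a x = 2 * b x * r x" for x
  have a_per: "periodic_fun_simple a L" by standard (simp add: a_def r_def b.plus_period \<sigma>.plus_period)
  obtain A where A: "\<And>x. (A has_real_derivative a x) (at x)"
    by (rule antiderivative[of a]) (auto simp: a_def[abs_def] intro!: continuous_intros b_cont r_cont)
  have A_cont: "continuous_on UNIV A" using A by (rule continuous_of_derivative)
  obtain P where P: "\<And>x. (P has_real_derivative 2 * g x * r x * exp (A x)) (at x)"
    by (rule antiderivative[of "\<lambda>x. 2 * g x * r x * exp (A x)"]) (auto intro!: continuous_intros A_cont g_cont r_cont)
  have P_cont: "continuous_on UNIV P" using P by (rule continuous_of_derivative)
  obtain E where E: "\<And>x. (E has_real_derivative exp (- A x)) (at x)"
    by (rule antiderivative[of "\<lambda>x. exp (- A x)"]) (auto intro!: continuous_intros A_cont)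
  obtain H where H: "\<And>x. (H has_real_derivative P x * exp (- A x)) (at x)"
    by (rule antiderivative[of "\<lambda>x. P x * exp (- A x)"]) (auto intro!: continuous_intros A_cont P_cont)
  have E_mono: "E 0 < E L"
  proof (rule DERIV_pos_imp_increasing_open[OF L])
    show "\<exists>z. DERIV E y :> z \<and> 0 < z" for y using E[of y] exp_gt_zero by blast
    show "continuous_on {0..L} E"
      using continuous_of_derivative[OF E] by (rule continuous_on_subset) auto
  qed
  \<comment> \<open>The equation for \<phi> is first order in \<psi> = \<phi>', with integrating
    factor exp A. Its one free constant is spent on \<phi> L = \<phi> 0.\<close>
  define c where "c = - (H L - H 0) / (E L - E 0)"
  define \<psi> where "\<psi> x = exp (- A x) * (c + P x)" for x
  define \<phi> where "\<phi> x = c * E x + H x" for x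
  define \<psi>' where "\<psi>' x = - a x * \<psi> x + 2 * g x * r x" for x
  have d\<phi>: "(\<phi> has_real_derivative \<psi> x) (at x)" for x
    unfolding \<phi>_def[abs_def] \<psi>_def by (auto intro!: derivative_eq_intros E H simp: algebra_simps)
  have d\<psi>: "(\<psi> has_real_derivative \<psi>' x) (at x)" for x
    unfolding \<psi>_def[abs_def] \<psi>'_def by (auto intro!: derivative_eq_intros A P simp: algebra_simps simp flip: exp_add)
  have \<psi>_cont: "continuous_on UNIV \<psi>" using d\<psi> by (rule continuous_of_derivative)
  have \<psi>'_cont: "continuous_on UNIV \<psi>'" unfolding \<psi>'_def[abs_def] a_def
    by (intro continuous_intros b_cont r_cont \<psi>_cont g_cont)
  have \<phi>L: "\<phi> L = \<phi> 0" using E_mono by (simp add: \<phi>_def c_def field_simps)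
  have gen: "b x * \<psi> x + (\<sigma> x)\<^sup>2 * \<psi>' x / 2 = g x" for x
  proof -
    have "(\<sigma> x)\<^sup>2 * \<psi>' x = ((\<sigma> x)\<^sup>2 * r x) * (- 2 * b x * \<psi> x + 2 * g x)" by (simp add: \<psi>'_def a_def algebra_simps)
    then have "(\<sigma> x)\<^sup>2 * \<psi>' x = 2 * g x - 2 * b x * \<psi> x" by (simp add: \<sigma>r)
    then show ?thesis by (simp add: field_simps)
  qed
  \<comment> \<open>With \<phi> periodic, periodicity of \<psi> is the solvability condition. The
    derivative of \<open>m\<close> is the generator applied to \<phi>, times \<open>q\<close>, which
    is p - q. As \<open>p\<close> and \<open>q\<close> have equal mass, \<open>m\<close> agrees at 0
    and \<open>L\<close>, and since \<phi>, \<sigma> and \<open>q\<close> agree there too, so does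
    \<psi>.\<close>
  define m where "m x = (\<sigma> x)\<^sup>2 * q x * \<psi> x / 2 + J * \<phi> x" for x
  have dm: "(m has_real_derivative p x - q x) (at x)" for x
  proof -
    have "(m has_real_derivative (2 * \<sigma> x * \<sigma>' x * q x * \<psi> x + (\<sigma> x)\<^sup>2 * q' x * \<psi> x + (\<sigma> x)\<^sup>2 * q x * \<psi>' x) / 2 + J * \<psi> x) (at x)"
      unfolding m_def[abs_def] by (auto intro!: derivative_eq_intros d\<sigma> dq d\<psi> d\<phi> simp: algebra_simps)
    also have "(2 * \<sigma> x * \<sigma>' x * q x * \<psi> x + (\<sigma> x)\<^sup>2 * q' x * \<psi> x + (\<sigma> x)\<^sup>2 * q x * \<psi>' x) / 2 + J * \<psi> x
      = (b x * \<psi> x + (\<sigma> x)\<^sup>2 * \<psi>' x / 2) * q x"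
      unfolding flux[of x, symmetric] by (simp add: algebra_simps)
    finally show ?thesis by (simp only: gen gq)
  qed
  have "m L = m 0"
    using integral_derivative[OF _ dm, of 0 L] L q_int p_int integral_diff[OF integrable_cont[OF p_cont] integrable_cont[OF q_cont], of 0 L] by simp
  then have \<psi>L: "\<psi> L = \<psi> 0"
    using \<phi>L q.plus_period[of 0] \<sigma>.plus_period[of 0] q_pos[of 0] \<sigma>_nz[of 0] by (simp add: m_def)
  have g_per: "periodic_fun_simple g L" by standard (simp add: g_def q.plus_period p.plus_period)
  interpret g: periodic_fun_simple g L by (rule g_per)
  have \<psi>_per: "\<psi> (x + L) = \<psi> x" for x
  proof -
    have s: "((\<lambda>x. \<psi> (x + L)) has_real_derivative - a x * \<psi> (x + L) + 2 * g x * r x) (at x)" for x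
      using DERIV_shift[of \<psi> "\<psi>' (x + L)" x L] d\<psi>[of "x + L"]
      by (simp add: \<psi>'_def a_def r_def b.plus_period \<sigma>.plus_period g.plus_period)
    have "((\<lambda>x. (\<psi> (x + L) - \<psi> x) * exp (A x)) has_real_derivative 0) (at x)" for x
      by (auto intro!: derivative_eq_intros s d\<psi> A simp: \<psi>'_def algebra_simps)
    from derivative_zero_eq[OF this, of x 0] show ?thesis using \<psi>L by simp
  qed
  have \<phi>_per: "periodic_fun_simple \<phi> L"
  proof
    fix x show "\<phi> (x + L) = \<phi> x"
      using periodic_antiderivative[of \<psi> L \<phi> x] \<psi>_per d\<phi> \<phi>L by (simp add: periodic_fun_simple_def)
  qed
  have c1: "continuous_on UNIV (\<lambda>x. g x * p x)" "continuous_on UNIV (\<lambda>x. g x * q x)"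
    "continuous_on UNIV (\<lambda>x. q x * (g x)\<^sup>2)"
    by (intro continuous_intros g_cont p_cont q_cont)+
  have "integral {0..L} (\<lambda>x. g x * p x) = 0"
    using weak[OF \<phi>_per d\<phi> d\<psi> \<psi>'_cont] by (simp add: gen)
  moreover have "integral {0..L} (\<lambda>x. g x * q x) = 0"
    unfolding gq using q_int p_int integral_diff[OF integrable_cont[OF p_cont] integrable_cont[OF q_cont], of 0 L] by simp
  moreover have "(\<lambda>x. q x * (g x)\<^sup>2) = (\<lambda>x. g x * p x - g x * q x)"
  proof
    fix x
    have "q x * (g x)\<^sup>2 = g x * (g x * q x)" by (simp add: power2_eq_square)
    then show "q x * (g x)\<^sup>2 = g x * p x - g x * q x" unfolding gq by (simp add: right_diff_distrib gq)
  qed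
  ultimately have "integral {0..L} (\<lambda>x. q x * (g x)\<^sup>2) = 0"
    using integral_diff[OF integrable_cont[OF c1(1)] integrable_cont[OF c1(2)], of 0 L] by simp
  then have z: "\<forall>x\<in>{0..L}. q x * (g x)\<^sup>2 = 0"
    using integral_eq_0_iff[of 0 L "\<lambda>x. q x * (g x)\<^sup>2"] L q_pos continuous_on_subset[OF c1(3)]
    by (auto simp: less_imp_le)
  have "g (x rmod L) = 0"
    using z[rule_format, of "x rmod L"] rmod_range[OF L, of x] q_pos[of "x rmod L"] by auto
  then have "g x = 0" using periodic_reduce[OF g_per L, of x] by simp
  then show ?thesis using q_pos[of x] by (simp add: g_def field_simps)
qed

end

section \<open>From the law of the wrapped process to its density\<close>

lemma distributed_torus_expectation:
  fixes p \<psi> :: "real \<Rightarrow> real"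
  assumes "L > 0" and "continuous_on UNIV p" "\<And>x. 0 \<le> p x"
    and D: "distributed M lborel Y (\<lambda>x. ennreal (p x) * indicator {0..<L} x)" and \<psi>: "continuous_on UNIV \<psi>"
  shows "integral\<^sup>L M (\<lambda>\<omega>. \<psi> (Y \<omega>)) = integral {0..L} (\<lambda>x. \<psi> x * p x)"
proof -
  have [measurable]: "\<psi> \<in> borel_measurable borel" "p \<in> borel_measurable borel"
    using assms by (auto intro: borel_measurable_continuous_onI)
  have "(\<lambda>x. ennreal (p x) * indicator {0..<L} x) = (\<lambda>x. ennreal (p x * indicator {0..<L} x))"
    by (auto simp: fun_eq_iff indicator_def)
  then have D': "distributed M lborel Y (\<lambda>x. ennreal (p x * indicator {0..<L} x))" using D by simp
  have "integral\<^sup>L M (\<lambda>\<omega>. \<psi> (Y \<omega>)) = (\<integral>x. (p x * indicator {0..<L} x) * \<psi> x \<partial>lborel)"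
    by (rule distributed_integral[OF D', symmetric]) (use assms(3) in auto)
  also have "\<dots> = (\<integral>x. indicator {0..L} x *\<^sub>R (\<psi> x * p x) \<partial>lborel)"
  proof (rule integral_cong_AE)
    show "AE x in lborel. (p x * indicator {0..<L} x) * \<psi> x = indicator {0..L} x *\<^sub>R (\<psi> x * p x)"
      using AE_lborel_singleton[of L] by eventually_elim (auto simp: indicator_def)
  qed measurable
  also have "\<dots> = integral {0..L} (\<lambda>x. \<psi> x * p x)"
  proof -
    have "continuous_on {0..L} (\<lambda>x. \<psi> x * p x)"
      by (intro continuous_intros continuous_on_subset[OF assms(2)] continuous_on_subset[OF \<psi>]) auto
    from borel_integrable_atLeastAtMost'[OF this] show ?thesis
      using set_borel_integral_eq_integral(2)[of "{0..L}" "\<lambda>x. \<psi> x * p x"]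
      by (simp add: set_lebesgue_integral_def)
  qed
  finally show ?thesis .
qed

context stationary_data begin

text \<open>A periodic test function does not distinguish \<open>X t\<close> from
  \<open>X t rmod L\<close>, whose density is \<open>p\<close> at every time. Its expectation along
  the lift is therefore constant in time, and the vanishing mean of the generator becomes the weak
  stationary equation for \<open>p\<close>.\<close>

lemma stationary_density_eq:
  assumes q_per: "periodic_fun_simple q L" and q_pos: "\<And>x. q x > 0" and q_int: "integral {0..L} q = 1"
    and dq: "\<And>x. (q has_real_derivative q' x) (at x)"
    and flux: "\<And>x. b x * q x - (\<sigma> x * \<sigma>' x * q x + (\<sigma> x)\<^sup>2 * q' x / 2) = J"
    and stat: "stationary_density L b \<sigma> M F W X p"
  shows "p x = q x"
proof -
  have p_per: "periodic_fun_simple p L" and p_cont: "continuous_on UNIV p" and p_nonneg: "\<And>x. 0 \<le> p x"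
    and sol: "sde_solution b \<sigma> M F W X"
    and D: "\<And>t. t \<ge> 0 \<Longrightarrow> distributed M lborel (\<lambda>\<omega>. X t \<omega> rmod L) (\<lambda>x. ennreal (p x) * indicator {0..<L} x)"
    using stat by (auto simp: stationary_density_def)
  obtain K1 where K1: "K1 > 0" "\<And>x. \<bar>b x\<bar> \<le> K1" using periodic_bounded[OF b_per L b_cont] by metis
  obtain K2 where K2: "K2 > 0" "\<And>x. \<bar>\<sigma> x\<bar> \<le> K2" using periodic_bounded[OF \<sigma>_per L \<sigma>_cont] by metis
  obtain K3 where K3: "K3 > 0" "\<And>x. \<bar>\<sigma>' x\<bar> \<le> K3"
    using periodic_bounded[OF periodic_derivative[OF \<sigma>_per d\<sigma>] L \<sigma>'_cont] by metis
  define K where "K = max K1 (max K2 K3)"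
  interpret bounded_sde b \<sigma> M F W X K
  proof
    show "\<bar>b x\<bar> \<le> K" "\<bar>\<sigma> x\<bar> \<le> K" for x using K1(2)[of x] K2(2)[of x] by (auto simp: K_def)
    show "\<bar>\<sigma> x - \<sigma> y\<bar> \<le> K * \<bar>x - y\<bar>" for x y
    proof -
      have "\<bar>\<sigma> x - \<sigma> y\<bar> \<le> K3 * \<bar>x - y\<bar>"
        using field_differentiable_bound[of UNIV \<sigma> \<sigma>' K3 x y] d\<sigma> K3 by auto
      also have "\<dots> \<le> K * \<bar>x - y\<bar>" by (intro mult_right_mono) (auto simp: K_def)
      finally show ?thesis .
    qed
  qed (rule sol b_cont)+
  have ex: "expectation (\<lambda>\<omega>. \<psi> (X t \<omega>)) = integral {0..L} (\<lambda>x. \<psi> x * p x)"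
    if "t \<ge> 0" "periodic_fun_simple \<psi> L" "continuous_on UNIV \<psi>" for \<psi> t
    using distributed_torus_expectation[OF L p_cont p_nonneg D[OF that(1)] that(3)]
    by (simp add: periodic_reduce[OF that(2) L])
  have one: "integral {0..L} p = 1"
    using ex[of 0 "\<lambda>_. 1"] by (simp add: prob_space periodic_fun_simple_def)
  show ?thesis
  proof (rule stationary_density_unique[OF q_per q_pos q_int dq flux p_per p_cont one])
    fix \<phi> \<phi>' \<phi>'' :: "real \<Rightarrow> real"
    assume \<phi>: "periodic_fun_simple \<phi> L" "\<And>x. (\<phi> has_real_derivative \<phi>' x) (at x)"
       "\<And>x. (\<phi>' has_real_derivative \<phi>'' x) (at x)" "continuous_on UNIV \<phi>''"
    have per: "periodic_fun_simple \<phi>' L" "periodic_fun_simple \<phi>'' L"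
      using periodic_derivative \<phi> by blast+
    have cont: "continuous_on UNIV \<phi>" "continuous_on UNIV \<phi>'" using \<phi> by (auto intro: continuous_of_derivative)
    obtain R1 where R1: "\<And>x. \<bar>\<phi> x\<bar> \<le> R1" using periodic_bounded[OF \<phi>(1) L cont(1)] by metis
    obtain R2 where R2: "\<And>x. \<bar>\<phi>' x\<bar> \<le> R2" using periodic_bounded[OF per(1) L cont(2)] by metis
    obtain R3 where R3: "\<And>x. \<bar>\<phi>'' x\<bar> \<le> R3" using periodic_bounded[OF per(2) L \<phi>(4)] by metis
    define R where "R = max R1 (max R2 R3)"
    have R: "\<bar>\<phi> x\<bar> \<le> R" "\<bar>\<phi>' x\<bar> \<le> R" "\<bar>\<phi>'' x\<bar> \<le> R" for x
      using R1[of x] R2[of x] R3[of x] by (auto simp: R_def)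
    have g_per: "periodic_fun_simple (\<lambda>x. b x * \<phi>' x + (\<sigma> x)\<^sup>2 * \<phi>'' x / 2) L"
      using b_per \<sigma>_per per by (simp add: periodic_fun_simple_def)
    have g_cont: "continuous_on UNIV (\<lambda>x. b x * \<phi>' x + (\<sigma> x)\<^sup>2 * \<phi>'' x / 2)"
      by (intro continuous_intros b_cont \<sigma>_cont cont \<phi>) auto
    have "expectation (\<lambda>\<omega>. b (X 0 \<omega>) * \<phi>' (X 0 \<omega>) + (\<sigma> (X 0 \<omega>))\<^sup>2 * \<phi>'' (X 0 \<omega>) / 2) = 0"
      by (rule stationary_generator_mean_zero[OF \<phi>(2,3) R periodic_uniformly_continuous[OF per(2) L \<phi>(4)]])
        (use ex[OF _ \<phi>(1) cont(1)] in auto)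
    then show "integral {0..L} (\<lambda>x. (b x * \<phi>' x + (\<sigma> x)\<^sup>2 * \<phi>'' x / 2) * p x) = 0"
      using ex[OF _ g_per g_cont, of 0] by simp
  qed
qed

end

subsection \<open>Nearest-neighbour jump processes on a cycle\<close>

locale cycle_chain =
  fixes N :: nat and \<alpha> \<beta> :: "nat \<Rightarrow> real"
  assumes N: "N > 0" and \<alpha>_nonneg: "\<And>j. j < N \<Longrightarrow> 0 \<le> \<alpha> j" and \<beta>_nonneg: "\<And>j. j < N \<Longrightarrow> 0 \<le> \<beta> j"
begin

definition nxt :: "nat \<Rightarrow> nat" where "nxt j = (j + 1) mod N"
definition prv :: "nat \<Rightarrow> nat" where "prv j = (j + N - 1) mod N"

definition gen :: "(nat \<Rightarrow> real) \<Rightarrow> nat \<Rightarrow> real" where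
  "gen u j = \<alpha> (prv j) * u (prv j) + \<beta> (nxt j) * u (nxt j) - (\<alpha> j + \<beta> j) * u j"

definition flux :: "(nat \<Rightarrow> real) \<Rightarrow> nat \<Rightarrow> real" where
  "flux u j = \<alpha> j * u j - \<beta> (nxt j) * u (nxt j)"

lemma nxt_less: "nxt j < N" and prv_less: "prv j < N"
  using N by (auto simp: nxt_def prv_def)

lemma nxt_prv: "j < N \<Longrightarrow> nxt (prv j) = j"
  using N by (cases j) (auto simp: nxt_def prv_def mod_Suc)

lemma prv_nxt: "j < N \<Longrightarrow> prv (nxt j) = j"
  using N by (auto simp: nxt_def prv_def mod_Suc)

lemma bij_nxt: "bij_betw nxt {..<N} {..<N}"
  by (rule bij_betw_byWitness[of _ prv]) (auto simp: nxt_prv prv_nxt nxt_less prv_less)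

lemma sum_nxt: "(\<Sum>j<N. F (nxt j)) = (\<Sum>j<N. F j)" for F :: "nat \<Rightarrow> real"
  using sum.reindex_bij_betw[OF bij_nxt] .

lemma sum_prv: "(\<Sum>j<N. F (prv j)) = (\<Sum>j<N. F j)" for F :: "nat \<Rightarrow> real"
  using sum_nxt[of "\<lambda>j. F (prv j)"] by (simp add: prv_nxt)

lemma gen_flux: "j < N \<Longrightarrow> gen u j = flux u (prv j) - flux u j"
  by (simp add: gen_def flux_def nxt_prv algebra_simps)

lemma sum_by_parts: "(\<Sum>j<N. f j * (G (prv j) - G j)) = (\<Sum>j<N. G j * (f (nxt j) - f j))"
  for f G :: "nat \<Rightarrow> real"
proof -
  have "(\<Sum>j<N. f j * G (prv j)) = (\<Sum>j<N. f (nxt j) * G j)"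
    using sum_nxt[of "\<lambda>j. f j * G (prv j)"] by (simp add: prv_nxt)
  then show ?thesis by (simp add: right_diff_distrib sum_subtractf mult.commute)
qed

lemma sum_gen: "(\<Sum>j<N. gen u j) = 0"
  using sum_prv[of "flux u"] by (simp add: gen_flux sum_subtractf)

lemma stationary_flux_const:
  assumes "\<And>j. j < N \<Longrightarrow> gen p j = 0" "j < N"
  shows "flux p j = flux p 0"
  using assms(2)
proof (induction j)
  case (Suc j)
  then have "prv (Suc j) = j" by (simp add: prv_def)
  then show ?case using Suc assms(1)[of "Suc j"] by (simp add: gen_flux)
qed simp

text \<open>An identity on each edge: (a f - c f')(f' - f) = (a - c)/2 (f'^2 - f^2) - (a + c)/2 (f'
  - f)^2, where a and c are the two one-way flows of \<open>q\<close>. Their difference, the net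
  flux, multiplies a difference of squares; their sum is the conductance. It is used once with
  \<open>q\<close> the sampled continuous density, whose flux is nearly constant, and once with the
  discrete stationary distribution, whose flux is constant.\<close>

lemma flux_energy:
  assumes "\<And>j. j < N \<Longrightarrow> u j = q j * f j"
  shows "(\<Sum>j<N. flux u j * (f (nxt j) - f j)) =
    (\<Sum>j<N. flux q j / 2 * ((f (nxt j))\<^sup>2 - (f j)\<^sup>2))
    - (\<Sum>j<N. (\<alpha> j * q j + \<beta> (nxt j) * q (nxt j)) / 2 * (f (nxt j) - f j)\<^sup>2)"
  unfolding sum_subtractf[symmetric]
proof (rule sum.cong)
  fix j assume "j \<in> {..<N}"
  then show "flux u j * (f (nxt j) - f j) = flux q j / 2 * ((f (nxt j))\<^sup>2 - (f j)\<^sup>2)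
     - (\<alpha> j * q j + \<beta> (nxt j) * q (nxt j)) / 2 * (f (nxt j) - f j)\<^sup>2"
    using assms[of j] assms[OF nxt_less, of j]
    by (simp add: flux_def power2_eq_square field_simps)
qed simp

lemma sum_sq_telescope: "(\<Sum>j<N. c * ((f (nxt j))\<^sup>2 - (f j)\<^sup>2)) = 0" for f :: "nat \<Rightarrow> real"
  using sum_nxt[of "\<lambda>j. c * (f j)\<^sup>2"] by (simp add: right_diff_distrib sum_subtractf)

section \<open>Oscillation bounds and the Poincare inequality on the cycle\<close>

lemma oscillation:
  fixes f :: "nat \<Rightarrow> real"
  assumes "i < N" "j < N"
  shows "\<bar>f i - f j\<bar> \<le> (\<Sum>k<N. \<bar>f (nxt k) - f k\<bar>)"
  using assms
proof (induction i j rule: linorder_wlog)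
  case (le i j)
  have "\<bar>f j - f i\<bar> = \<bar>\<Sum>k=i..<j. f (Suc k) - f k\<bar>" using le by (subst sum_Suc_diff') auto
  also have "\<dots> \<le> (\<Sum>k=i..<j. \<bar>f (Suc k) - f k\<bar>)" by (rule sum_abs)
  also have "\<dots> = (\<Sum>k=i..<j. \<bar>f (nxt k) - f k\<bar>)" using le by (intro sum.cong) (auto simp: nxt_def)
  also have "\<dots> \<le> (\<Sum>k<N. \<bar>f (nxt k) - f k\<bar>)" using le by (intro sum_mono2) auto
  finally show ?case by (simp add: abs_minus_commute)
qed (simp add: abs_minus_commute)

lemma sum_abs_sq: "(\<Sum>k<N. \<bar>d k\<bar>)\<^sup>2 \<le> real N * (\<Sum>k<N. (d k)\<^sup>2)" for d :: "nat \<Rightarrow> real"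
  using Cauchy_Schwarz_ineq_sum[of "\<lambda>_. 1" "\<lambda>k. \<bar>d k\<bar>" "{..<N}"] by simp

text \<open>Summing \<open>flux p j * (f (nxt j) - f j)\<close> with \<open>f = p / q\<close> gives zero, because \<open>flux p\<close> is constant;
  the energy identity then bounds the differences of \<open>f\<close> by the variation of \<open>flux q\<close>.\<close>

lemma stationary_ratio_oscillation:
  assumes p: "\<And>j. j < N \<Longrightarrow> gen p j = 0" "\<And>j. j < N \<Longrightarrow> 0 \<le> p j" and q: "\<And>j. j < N \<Longrightarrow> q j > 0"
    and A: "A > 0" "\<And>j. j < N \<Longrightarrow> A \<le> (\<alpha> j * q j + \<beta> (nxt j) * q (nxt j)) / 2"
    and e: "\<And>j. j < N \<Longrightarrow> \<bar>flux q j - J\<bar> \<le> e"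
    and M: "\<And>j. j < N \<Longrightarrow> p j / q j \<le> M"
    and ij: "i < N" "j < N"
  shows "\<bar>p i / q i - p j / q j\<bar> \<le> real N * e * M / A"
proof -
  define f where "f j = p j / q j" for j
  define d where "d j = f (nxt j) - f j" for j
  define S where "S = (\<Sum>k<N. \<bar>d k\<bar>)"
  have e0: "0 \<le> e" using e[OF N] by linarith
  have f0: "0 \<le> f j" if "j < N" for j using p(2)[OF that] q[OF that] by (simp add: f_def)
  have M0: "0 \<le> M" using f0[OF N] M[OF N] by (simp add: f_def)
  have pf: "p j = q j * f j" if "j < N" for j using q[OF that] by (simp add: f_def)
  have "(\<Sum>j<N. flux p j * (f (nxt j) - f j)) = (\<Sum>j<N. flux p 0 * (f (nxt j) - f j))"
    by (rule sum.cong[OF refl], subst stationary_flux_const[of p, OF p(1)]) auto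
  also have "\<dots> = 0" using sum_nxt[of "\<lambda>j. flux p 0 * f j"] by (simp add: right_diff_distrib sum_subtractf)
  finally have "(\<Sum>j<N. (\<alpha> j * q j + \<beta> (nxt j) * q (nxt j)) / 2 * (d j)\<^sup>2)
      = (\<Sum>j<N. flux q j / 2 * ((f (nxt j))\<^sup>2 - (f j)\<^sup>2))"
    using flux_energy[of p q f, OF pf] by (simp add: d_def)
  also have "\<dots> = (\<Sum>j<N. (flux q j - J) / 2 * ((f (nxt j))\<^sup>2 - (f j)\<^sup>2))"
    using sum_sq_telescope[of "J / 2" f] by (simp add: diff_divide_distrib left_diff_distrib sum_subtractf)
  also have "\<dots> \<le> (\<Sum>j<N. e * M * \<bar>d j\<bar>)"
  proof (rule sum_mono)
    fix j assume "j \<in> {..<N}" then have j: "j < N" by simp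
    have "(flux q j - J) / 2 * ((f (nxt j))\<^sup>2 - (f j)\<^sup>2) \<le> \<bar>(flux q j - J) / 2 * ((f (nxt j))\<^sup>2 - (f j)\<^sup>2)\<bar>" by simp
    also have "\<dots> = \<bar>flux q j - J\<bar> * (\<bar>f (nxt j) + f j\<bar> / 2) * \<bar>d j\<bar>"
      by (simp add: abs_mult d_def power2_eq_square square_diff_square_factored)
    also have "\<dots> \<le> e * M * \<bar>d j\<bar>"
      using e[OF j] f0[OF j] f0[OF nxt_less, of j] M[OF j] M[OF nxt_less, of j] e0
      by (intro mult_right_mono mult_mono) (auto simp: f_def)
    finally show "(flux q j - J) / 2 * ((f (nxt j))\<^sup>2 - (f j)\<^sup>2) \<le> e * M * \<bar>d j\<bar>" .
  qed
  also have "\<dots> = e * M * S" by (simp add: S_def sum_distrib_left)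
  finally have 1: "(\<Sum>j<N. (\<alpha> j * q j + \<beta> (nxt j) * q (nxt j)) / 2 * (d j)\<^sup>2) \<le> e * M * S" .
  have "A * (\<Sum>j<N. (d j)\<^sup>2) \<le> (\<Sum>j<N. (\<alpha> j * q j + \<beta> (nxt j) * q (nxt j)) / 2 * (d j)\<^sup>2)"
    unfolding sum_distrib_left by (intro sum_mono mult_right_mono A) auto
  with 1 have "A * (\<Sum>j<N. (d j)\<^sup>2) \<le> e * M * S" by linarith
  then have "real N * (A * (\<Sum>j<N. (d j)\<^sup>2)) \<le> real N * (e * M * S)" by (intro mult_left_mono) auto
  moreover have "A * S\<^sup>2 \<le> A * (real N * (\<Sum>j<N. (d j)\<^sup>2))"
    unfolding S_def using A(1) by (intro mult_left_mono sum_abs_sq) auto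
  ultimately have "A * S\<^sup>2 \<le> real N * (e * M * S)" by (simp add: mult_ac)
  \<comment> \<open>The dissipation is quadratic in the total variation \<open>S\<close> and the
    flux defect contributes linearly, so one factor \<open>S\<close> cancels.\<close>
  then have "(A * S) * S \<le> (real N * e * M) * S" by (simp add: power2_eq_square mult_ac)
  moreover have "0 \<le> S" unfolding S_def by (rule sum_nonneg) simp
  ultimately have "A * S \<le> real N * e * M"
    using e0 M0 by (cases "S = 0") (auto simp: mult_le_cancel_right)
  then have "S \<le> real N * e * M / A" using A(1) by (simp add: field_simps)
  moreover have "\<bar>f i - f j\<bar> \<le> S" unfolding S_def d_def by (rule oscillation[OF ij])
  ultimately show ?thesis by (simp add: f_def)
qed

text \<open>The oscillation of the ratio is bounded by \<eta> times its maximum \<open>M\<close>, so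
  all ratios lie between M (1 - \<eta>) and M. The masses of \<open>p\<close> and \<open>q\<close>,
  which differ by at most \<eta>, then pin \<open>M\<close> near 1. The factor 4 comes from 1 / (1 -
  \<eta>)^2 <= 1 + 4 \<eta>, valid for \<eta> <= 1/4.\<close>

lemma stationary_ratio_near_1:
  assumes p: "\<And>j. j < N \<Longrightarrow> gen p j = 0" "\<And>j. j < N \<Longrightarrow> 0 \<le> p j" "(\<Sum>j<N. p j) = 1"
    and q: "\<And>j. j < N \<Longrightarrow> q j > 0"
    and A: "A > 0" "\<And>j. j < N \<Longrightarrow> A \<le> (\<alpha> j * q j + \<beta> (nxt j) * q (nxt j)) / 2"
    and e: "\<And>j. j < N \<Longrightarrow> \<bar>flux q j - J\<bar> \<le> e"
    and \<eta>: "real N * e / A \<le> \<eta>" "\<bar>(\<Sum>j<N. q j) - 1\<bar> \<le> \<eta>" "\<eta> \<le> 1 / 4"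
    and j: "j < N"
  shows "\<bar>p j / q j - 1\<bar> \<le> 4 * \<eta>"
proof -
  define f where "f j = p j / q j" for j
  define M where "M = Max (f ` {..<N})"
  define Q where "Q = (\<Sum>j<N. q j)"
  have fin: "finite (f ` {..<N})" "f ` {..<N} \<noteq> {}" using N by auto
  have fM: "f j \<le> M" if "j < N" for j unfolding M_def using that by (intro Max_ge) auto
  obtain k where k: "k < N" "M = f k" using Max_in[OF fin] unfolding M_def by auto
  have pf: "p j = q j * f j" if "j < N" for j using q[OF that] by (simp add: f_def)
  have M0: "0 \<le> M" using p(2)[OF k(1)] q[OF k(1)] by (simp add: k(2) f_def)
  have \<eta>0: "0 \<le> \<eta>" using \<eta>(2) by linarith
  have low: "M * (1 - \<eta>) \<le> f i" if "i < N" for i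
  proof -
    have "\<bar>f k - f i\<bar> \<le> real N * e * M / A"
      using stationary_ratio_oscillation[OF p(1,2) q A e _ k(1) that, where M = M] fM by (simp add: f_def)
    also have "\<dots> = (real N * e / A) * M" by simp
    also have "\<dots> \<le> \<eta> * M" using \<eta>(1) M0 by (intro mult_right_mono) auto
    finally show ?thesis using k(2) by (simp add: algebra_simps)
  qed
  have Q: "1 - \<eta> \<le> Q" "Q \<le> 1 + \<eta>" using \<eta>(2) by (auto simp: Q_def)
  have "1 = (\<Sum>j<N. q j * f j)" using p(3) pf by simp
  also have "\<dots> \<le> (\<Sum>j<N. q j * M)" using q fM by (intro sum_mono mult_left_mono) (auto simp: less_imp_le)
  finally have u: "1 \<le> Q * M" by (simp add: Q_def sum_distrib_right)
  have "(\<Sum>j<N. q j * (M * (1 - \<eta>))) \<le> (\<Sum>j<N. q j * f j)"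
    using q low by (intro sum_mono mult_left_mono) (auto simp: less_imp_le)
  also have "\<dots> = 1" using p(3) pf by simp
  finally have l: "Q * (M * (1 - \<eta>)) \<le> 1" by (simp add: Q_def sum_distrib_right)
  have "(1 - \<eta>) * (M * (1 - \<eta>)) \<le> Q * (M * (1 - \<eta>))"
    using Q M0 \<eta>(3) by (intro mult_right_mono) auto
  with l have "M * (1 - \<eta>)\<^sup>2 \<le> 1" by (simp add: power2_eq_square mult_ac)
  moreover have "1 \<le> (1 + 4 * \<eta>) * (1 - \<eta>)\<^sup>2"
  proof -
    have "(1 + 4 * \<eta>) * (1 - \<eta>)\<^sup>2 - 1 = \<eta> * (2 - 7 * \<eta> + 4 * \<eta>\<^sup>2)"
      by (simp add: power2_eq_square algebra_simps)
    moreover have "0 \<le> \<eta> * (2 - 7 * \<eta> + 4 * \<eta>\<^sup>2)"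
      using \<eta>0 \<eta>(3) zero_le_power2[of \<eta>] by (intro mult_nonneg_nonneg) auto
    ultimately show ?thesis by linarith
  qed
  ultimately have "M * (1 - \<eta>)\<^sup>2 \<le> (1 + 4 * \<eta>) * (1 - \<eta>)\<^sup>2" by linarith
  then have Mu: "M \<le> 1 + 4 * \<eta>" using \<eta>(3) by (simp add: mult_le_cancel_right)
  have "1 \<le> (1 + \<eta>) * M" using u mult_right_mono[OF Q(2) M0] by linarith
  then have "(1 - \<eta>) * 1 \<le> (1 - \<eta>) * ((1 + \<eta>) * M)" using \<eta>(3) by (intro mult_left_mono) auto
  also have "\<dots> = (1 + \<eta>) * (M * (1 - \<eta>))" by simp
  also have "\<dots> \<le> (1 + \<eta>) * f j" using low[OF j] \<eta>0 by (intro mult_left_mono) auto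
  finally have "1 - \<eta> \<le> (1 + \<eta>) * f j" by simp
  moreover have "(1 + \<eta>) * (1 - 2 * \<eta>) \<le> 1 - \<eta>" using zero_le_power2[of \<eta>] by (simp add: power2_eq_square algebra_simps)
  ultimately have "(1 + \<eta>) * (1 - 2 * \<eta>) \<le> (1 + \<eta>) * f j" by linarith
  then have "1 - 2 * \<eta> \<le> f j" using \<eta>0 by (simp add: mult_le_cancel_left)
  then show ?thesis using Mu fM[OF j] \<eta>0 by (auto simp: f_def abs_le_iff)
qed

text \<open>With f = Z / p the constant flux of \<open>p\<close> drops out and only the dissipation
  remains. Half of it absorbs the source by Young's inequality; the other half becomes decay through
  a Poincare inequality, which follows from the total variation of \<open>f\<close> around the cycle
  and Cauchy-Schwarz over \<open>N\<close> edges.\<close>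

lemma energy_dissipation:
  assumes p: "\<And>j. j < N \<Longrightarrow> gen p j = 0" "\<And>j. j < N \<Longrightarrow> 0 < p j" "(\<Sum>j<N. p j) = 1"
    and A: "A > 0" "\<And>j. j < N \<Longrightarrow> A \<le> (\<alpha> j * p j + \<beta> (nxt j) * p (nxt j)) / 2"
    and Z: "(\<Sum>j<N. Z j) = 0"
  shows "(\<Sum>j<N. 2 * (Z j / p j) * (gen Z j + (e (prv j) - e j)))
    \<le> - (A / real N) * (\<Sum>j<N. (Z j)\<^sup>2 / p j) + (\<Sum>j<N. (e j)\<^sup>2) / A"
proof -
  define f where "f j = Z j / p j" for j
  define d where "d j = f (nxt j) - f j" for j
  have Zf: "Z j = p j * f j" if "j < N" for j using p(2)[OF that] by (simp add: f_def)
  have "(\<Sum>j<N. 2 * (Z j / p j) * (gen Z j + (e (prv j) - e j)))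
    = 2 * (\<Sum>j<N. f j * (flux Z (prv j) - flux Z j)) + 2 * (\<Sum>j<N. f j * (e (prv j) - e j))"
    by (simp add: gen_flux f_def sum_distrib_left sum.distrib[symmetric] distrib_left mult.assoc)
  also have "\<dots> = 2 * (\<Sum>j<N. flux Z j * d j) + 2 * (\<Sum>j<N. e j * d j)"
    by (simp add: sum_by_parts d_def)
  also have "(\<Sum>j<N. flux Z j * d j) = - (\<Sum>j<N. (\<alpha> j * p j + \<beta> (nxt j) * p (nxt j)) / 2 * (d j)\<^sup>2)"
  proof -
    have "(\<Sum>j<N. flux p j / 2 * ((f (nxt j))\<^sup>2 - (f j)\<^sup>2)) = (\<Sum>j<N. flux p 0 / 2 * ((f (nxt j))\<^sup>2 - (f j)\<^sup>2))"
      by (rule sum.cong[OF refl], subst stationary_flux_const[of p, OF p(1)]) auto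
    then show ?thesis using flux_energy[of Z p f, OF Zf] sum_sq_telescope[of "flux p 0 / 2" f] by (simp add: d_def)
  qed
  also have "2 * (- (\<Sum>j<N. (\<alpha> j * p j + \<beta> (nxt j) * p (nxt j)) / 2 * (d j)\<^sup>2)) + 2 * (\<Sum>j<N. e j * d j)
    \<le> - (2 * A) * (\<Sum>j<N. (d j)\<^sup>2) + (\<Sum>j<N. A * (d j)\<^sup>2 + (e j)\<^sup>2 / A)"
  proof -
    have "A * (\<Sum>j<N. (d j)\<^sup>2) \<le> (\<Sum>j<N. (\<alpha> j * p j + \<beta> (nxt j) * p (nxt j)) / 2 * (d j)\<^sup>2)"
      unfolding sum_distrib_left by (intro sum_mono mult_right_mono A) auto
    moreover have "2 * (\<Sum>j<N. e j * d j) \<le> (\<Sum>j<N. A * (d j)\<^sup>2 + (e j)\<^sup>2 / A)"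
      unfolding sum_distrib_left
    proof (rule sum_mono)
      fix j
      have "0 \<le> (A * d j - e j)\<^sup>2 / A" using A(1) by simp
      also have "\<dots> = A * (d j)\<^sup>2 + (e j)\<^sup>2 / A - 2 * (e j * d j)"
        using A(1) by (simp add: power2_eq_square field_simps)
      finally show "2 * (e j * d j) \<le> A * (d j)\<^sup>2 + (e j)\<^sup>2 / A" by simp
    qed
    ultimately show ?thesis by (simp add: algebra_simps)
  qed
  also have "\<dots> = - A * (\<Sum>j<N. (d j)\<^sup>2) + (\<Sum>j<N. (e j)\<^sup>2) / A"
    by (simp add: sum.distrib sum_distrib_left[symmetric] sum_divide_distrib)
  also have "\<dots> \<le> - (A / real N) * (\<Sum>j<N. (Z j)\<^sup>2 / p j) + (\<Sum>j<N. (e j)\<^sup>2) / A"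
  proof -
    define D where "D = real N * (\<Sum>j<N. (d j)\<^sup>2)"
    have osc: "(f i - f j)\<^sup>2 \<le> D" if "i < N" "j < N" for i j
    proof -
      have "(f i - f j)\<^sup>2 = \<bar>f i - f j\<bar>\<^sup>2" by simp
      also have "\<dots> \<le> (\<Sum>k<N. \<bar>d k\<bar>)\<^sup>2" unfolding d_def by (intro power_mono oscillation that) simp
      also have "\<dots> \<le> D" unfolding D_def by (rule sum_abs_sq)
      finally show ?thesis .
    qed
    have sum0: "(\<Sum>j<N. p j * f j) = 0" using Z Zf by simp
    have f2: "(f i)\<^sup>2 \<le> D" if i: "i < N" for i
    proof -
      \<comment> \<open>\<open>f\<close> has mean zero against positive weights, so it cannot keep
        the sign of \<open>f i\<close>. At an index of opposite sign (or zero), the difference to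
        \<open>f i\<close> is at least |f i|, so the oscillation bounds \<open>f\<close>
        itself.\<close>
      have "\<exists>j<N. f i * f j \<le> 0"
      proof (rule ccontr)
        assume "\<not> ?thesis"
        then have pos: "0 < f i * f j" if "j < N" for j using that by (auto simp: not_le)
        have "0 < (\<Sum>j<N. p j * (f i * f j))"
          by (intro sum_pos) (use N pos p(2) in auto)
        also have "\<dots> = f i * (\<Sum>j<N. p j * f j)" by (simp add: sum_distrib_left mult_ac)
        finally show False using sum0 by simp
      qed
      then obtain j where j: "j < N" "f i * f j \<le> 0" by blast
      have "(f i - f j)\<^sup>2 = (f i)\<^sup>2 + (f j)\<^sup>2 - 2 * (f i * f j)" by (simp add: power2_diff)
      then show ?thesis using osc[OF i j(1)] j(2) zero_le_power2[of "f j"] by linarith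
    qed
    have "(\<Sum>j<N. (Z j)\<^sup>2 / p j) = (\<Sum>j<N. p j * (f j)\<^sup>2)"
      using p(2) by (intro sum.cong) (auto simp: f_def power2_eq_square)
    also have "\<dots> \<le> (\<Sum>j<N. p j * D)" using p(2) f2 by (intro sum_mono mult_left_mono) (auto simp: less_imp_le)
    also have "\<dots> = D" using p(3) by (simp add: sum_distrib_right[symmetric])
    finally have "(A / real N) * (\<Sum>j<N. (Z j)\<^sup>2 / p j) \<le> (A / real N) * D"
      using A(1) by (intro mult_left_mono) auto
    also have "\<dots> = A * (\<Sum>j<N. (d j)\<^sup>2)" using N by (simp add: D_def)
    finally show ?thesis by simp
  qed
  finally show ?thesis .
qed

text \<open>The semigroup is \<open>e\<^sup>-\<^sup>c\<^sup>t \<Sum>k. t\<^sup>k B\<^sup>k / k!\<close> with \<open>B = gen + c\<close>, a nonnegative matrix with all column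
  sums \<open>c\<close>; this gives existence and contractivity in \<open>\<ell>\<^sup>1\<close> at once.\<close>

lemma contraction_semigroup:
  obtains Y :: "nat \<Rightarrow> real \<Rightarrow> real" where
    "\<And>j. j < N \<Longrightarrow> Y j 0 = y j"
    "\<And>j t. j < N \<Longrightarrow> (Y j has_real_derivative gen (\<lambda>i. Y i t) j) (at t)"
    "\<And>t. t \<ge> 0 \<Longrightarrow> (\<Sum>j<N. \<bar>Y j t\<bar>) \<le> (\<Sum>j<N. \<bar>y j\<bar>)"
proof -
  \<comment> \<open>The sum of all rates is a convenient constant dominating every exit rate, which
    makes the entries of \<open>B\<close> nonnegative. The growth c^k of the iterates is compensated
    exactly by the factor exp (- c t).\<close>
  define c where "c = (\<Sum>j<N. \<alpha> j + \<beta> j)"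
  have c: "\<alpha> j + \<beta> j \<le> c" if "j < N" for j
    unfolding c_def using that \<alpha>_nonneg \<beta>_nonneg by (intro member_le_sum) auto
  define B where "B u j = gen u j + c * u j" for u j
  define a where "a k = (B ^^ k) y" for k
  define S where "S = (\<Sum>j<N. \<bar>y j\<bar>)"
  have a0: "a 0 = y" and aS: "a (Suc k) = B (a k)" for k by (simp_all add: a_def)
  have B1: "(\<Sum>j<N. \<bar>B u j\<bar>) \<le> c * (\<Sum>j<N. \<bar>u j\<bar>)" for u
  proof -
    have "(\<Sum>j<N. \<bar>B u j\<bar>) \<le> (\<Sum>j<N. \<alpha> (prv j) * \<bar>u (prv j)\<bar> + \<beta> (nxt j) * \<bar>u (nxt j)\<bar> + (c - (\<alpha> j + \<beta> j)) * \<bar>u j\<bar>)"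
    proof (rule sum_mono)
      fix j assume "j \<in> {..<N}" then have j: "j < N" by simp
      have "B u j = \<alpha> (prv j) * u (prv j) + \<beta> (nxt j) * u (nxt j) + (c - (\<alpha> j + \<beta> j)) * u j"
        by (simp add: B_def gen_def algebra_simps)
      also have "\<bar>\<dots>\<bar> \<le> \<bar>\<alpha> (prv j) * u (prv j)\<bar> + \<bar>\<beta> (nxt j) * u (nxt j)\<bar> + \<bar>(c - (\<alpha> j + \<beta> j)) * u j\<bar>" by linarith
      also have "\<dots> = \<alpha> (prv j) * \<bar>u (prv j)\<bar> + \<beta> (nxt j) * \<bar>u (nxt j)\<bar> + (c - (\<alpha> j + \<beta> j)) * \<bar>u j\<bar>"
        using \<alpha>_nonneg[OF prv_less, of j] \<beta>_nonneg[OF nxt_less, of j] c[OF j] by (simp add: abs_mult)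
      finally show "\<bar>B u j\<bar> \<le> \<alpha> (prv j) * \<bar>u (prv j)\<bar> + \<beta> (nxt j) * \<bar>u (nxt j)\<bar> + (c - (\<alpha> j + \<beta> j)) * \<bar>u j\<bar>" .
    qed
    also have "\<dots> = (\<Sum>j<N. \<alpha> j * \<bar>u j\<bar>) + (\<Sum>j<N. \<beta> j * \<bar>u j\<bar>) + (\<Sum>j<N. (c - (\<alpha> j + \<beta> j)) * \<bar>u j\<bar>)"
      using sum_prv[of "\<lambda>j. \<alpha> j * \<bar>u j\<bar>"] sum_nxt[of "\<lambda>j. \<beta> j * \<bar>u j\<bar>"] by (simp add: sum.distrib)
    also have "\<dots> = c * (\<Sum>j<N. \<bar>u j\<bar>)"
      by (simp add: sum.distrib[symmetric] sum_distrib_left algebra_simps)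
    finally show ?thesis .
  qed
  have c0: "0 \<le> c" using c[OF N] \<alpha>_nonneg[OF N] \<beta>_nonneg[OF N] by linarith
  have ak: "(\<Sum>j<N. \<bar>a k j\<bar>) \<le> c ^ k * S" for k
  proof (induction k)
    case (Suc k)
    have "(\<Sum>j<N. \<bar>a (Suc k) j\<bar>) \<le> c * (\<Sum>j<N. \<bar>a k j\<bar>)" unfolding aS by (rule B1)
    also have "\<dots> \<le> c * (c ^ k * S)" by (intro mult_left_mono Suc c0)
    finally show ?case by (simp add: mult.assoc)
  qed (simp add: a0 S_def)
  have akj: "\<bar>a k j\<bar> \<le> c ^ k * S" if "j < N" for k j
    using order_trans[OF member_le_sum[of j "{..<N}" "\<lambda>j. \<bar>a k j\<bar>"] ak[of k]] that by auto
  have summ: "summable (\<lambda>k. a k j / fact k * t ^ k)" and summ': "summable (\<lambda>k. \<bar>a k j / fact k * t ^ k\<bar>)"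
    if "j < N" for j t
  proof -
    have sexp: "summable (\<lambda>k. S * (inverse (fact k) * (c * \<bar>t\<bar>) ^ k))"
      using summable_exp[of "c * \<bar>t\<bar>"] by (rule summable_mult)
    have "norm \<bar>a k j / fact k * t ^ k\<bar> \<le> S * (inverse (fact k) * (c * \<bar>t\<bar>) ^ k)" for k
    proof -
      have "norm \<bar>a k j / fact k * t ^ k\<bar> = \<bar>a k j\<bar> * (\<bar>t\<bar> ^ k / fact k)" by (simp add: abs_mult power_abs)
      also have "\<dots> \<le> (c ^ k * S) * (\<bar>t\<bar> ^ k / fact k)" by (intro mult_right_mono akj that) simp
      also have "\<dots> = S * (inverse (fact k) * (c * \<bar>t\<bar>) ^ k)" by (simp add: power_mult_distrib field_simps)
      finally show ?thesis .
    qed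
    then show *: "summable (\<lambda>k. \<bar>a k j / fact k * t ^ k\<bar>)" by (intro summable_comparison_test'[OF sexp, of 0])
    then show "summable (\<lambda>k. a k j / fact k * t ^ k)" by (rule summable_rabs_cancel)
  qed
  define U where "U j t = (\<Sum>k. a k j / fact k * t ^ k)" for j t
  have dU: "(U j has_real_derivative B (\<lambda>i. U i t) j) (at t)" if j: "j < N" for j t
  proof -
    have "((\<lambda>x. \<Sum>k. a k j / fact k * x ^ k) has_real_derivative (\<Sum>k. diffs (\<lambda>k. a k j / fact k) k * t ^ k)) (at t)"
      by (rule termdiffs_strong_converges_everywhere[OF summ[OF j]])
    also have "(\<Sum>k. diffs (\<lambda>k. a k j / fact k) k * t ^ k) = (\<Sum>k. a (Suc k) j / fact k * t ^ k)"
      by (simp add: diffs_def del: of_nat_Suc)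
    also have "(\<lambda>k. a (Suc k) j / fact k * t ^ k) = (\<lambda>k. \<alpha> (prv j) * (a k (prv j) / fact k * t ^ k)
       + \<beta> (nxt j) * (a k (nxt j) / fact k * t ^ k) + (c - (\<alpha> j + \<beta> j)) * (a k j / fact k * t ^ k))"
      by (simp add: aS B_def gen_def fun_eq_iff field_simps)
    also have "suminf \<dots> = \<alpha> (prv j) * U (prv j) t + \<beta> (nxt j) * U (nxt j) t + (c - (\<alpha> j + \<beta> j)) * U j t"
      unfolding U_def using summ[OF prv_less] summ[OF nxt_less] summ[OF j]
      by (subst suminf_add[symmetric] | subst suminf_mult | (intro summable_add summable_mult; simp) | simp)+
    also have "\<dots> = B (\<lambda>i. U i t) j" by (simp add: B_def gen_def algebra_simps)
    finally show ?thesis by (simp add: U_def[abs_def])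
  qed
  have U1: "(\<Sum>j<N. \<bar>U j t\<bar>) \<le> S * exp (c * t)" if t: "t \<ge> 0" for t
  proof -
    have "(\<Sum>j<N. \<bar>U j t\<bar>) \<le> (\<Sum>j<N. \<Sum>k. \<bar>a k j / fact k * t ^ k\<bar>)"
      unfolding U_def by (intro sum_mono summable_rabs summ') simp
    also have "\<dots> = (\<Sum>k. \<Sum>j<N. \<bar>a k j / fact k * t ^ k\<bar>)"
      by (intro suminf_sum[symmetric] summ') simp
    also have "\<dots> \<le> (\<Sum>k. S * (inverse (fact k) * (c * t) ^ k))"
    proof (rule suminf_le)
      show "summable (\<lambda>k. \<Sum>j<N. \<bar>a k j / fact k * t ^ k\<bar>)" by (intro summable_sum summ') simp
      show "summable (\<lambda>k. S * (inverse (fact k) * (c * t) ^ k))"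
        using summable_exp[of "c * t"] by (rule summable_mult)
      fix k
      have "(\<Sum>j<N. \<bar>a k j / fact k * t ^ k\<bar>) = (\<Sum>j<N. \<bar>a k j\<bar>) * (t ^ k / fact k)"
        using t by (simp add: abs_mult sum_distrib_right sum_divide_distrib)
      also have "\<dots> \<le> (c ^ k * S) * (t ^ k / fact k)" using t by (intro mult_right_mono ak) auto
      also have "\<dots> = S * (inverse (fact k) * (c * t) ^ k)" by (simp add: power_mult_distrib field_simps)
      finally show "(\<Sum>j<N. \<bar>a k j / fact k * t ^ k\<bar>) \<le> S * (inverse (fact k) * (c * t) ^ k)" .
    qed
    also have "\<dots> = S * exp (c * t)"
      using suminf_mult[OF summable_exp[of "c * t"], of S] by (simp add: exp_def)
    finally show ?thesis .
  qed
  show ?thesis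
  proof (rule that[of "\<lambda>j t. exp (- c * t) * U j t"])
    show "exp (- c * 0) * U j 0 = y j" for j
      using powser_zero[of "\<lambda>k. a k j / fact k"] by (simp add: U_def a0)
    show "((\<lambda>t. exp (- c * t) * U j t) has_real_derivative gen (\<lambda>i. exp (- c * t) * U i t) j) (at t)" if "j < N" for j t
      by (rule derivative_eq_intros refl dU that)+
        (simp add: B_def gen_def algebra_simps)
    show "(\<Sum>j<N. \<bar>exp (- c * t) * U j t\<bar>) \<le> (\<Sum>j<N. \<bar>y j\<bar>)" if "t \<ge> 0" for t
    proof -
      have "(\<Sum>j<N. \<bar>exp (- c * t) * U j t\<bar>) = exp (- c * t) * (\<Sum>j<N. \<bar>U j t\<bar>)"
        by (simp add: abs_mult sum_distrib_left)
      also have "\<dots> \<le> exp (- c * t) * (S * exp (c * t))" by (intro mult_left_mono U1 that) simp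
      also have "\<dots> = S * (exp (- c * t) * exp (c * t))" by simp
      also have "exp (- c * t) * exp (c * t) = 1" by (simp flip: exp_add)
      finally show ?thesis by (simp add: S_def)
    qed
  qed
qed

end

subsection \<open>Energy estimates for the Fokker--Planck equation\<close>

lemma integral_linear3:
  fixes f g h :: "real \<Rightarrow> real"
  assumes "continuous_on UNIV f" "continuous_on UNIV g" "continuous_on UNIV h"
  shows "integral {a..b} (\<lambda>x. A * f x + B * g x + D * h x)
    = A * integral {a..b} f + B * integral {a..b} g + D * integral {a..b} h"
  by (intro integral_unique has_integral_add has_integral_mult_right integrable_integral integrable_cont assms)

lemma integral_time_derivative:
  fixes g g' :: "real \<Rightarrow> real \<Rightarrow> real"
  assumes d: "\<And>t x. t > 0 \<Longrightarrow> ((\<lambda>s. g s x) has_real_derivative g' t x) (at t)"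
    and c: "\<And>t. t > 0 \<Longrightarrow> continuous_on UNIV (g t)"
    and c': "continuous_on ({0<..} \<times> UNIV) (\<lambda>(t, x). g' t x)" and t: "t > 0"
  shows "((\<lambda>t. integral {a..b} (g t)) has_real_derivative integral {a..b} (g' t)) (at t)"
proof -
  have "((\<lambda>t. integral (cbox a b) (g t)) has_real_derivative integral (cbox a b) (g' t)) (at t within {0<..})"
  proof (rule leibniz_rule_field_derivative)
    show "((\<lambda>s. g s x) has_real_derivative g' t x) (at t within {0<..})" if "t \<in> {0<..}" for t x
      using d[of t x] that by (auto intro: has_field_derivative_at_within)
    show "g t integrable_on cbox a b" if "t \<in> {0<..}" for t
      using integrable_cont[OF c[of t], of a b] that by simp
    show "continuous_on ({0<..} \<times> cbox a b) (\<lambda>(t, x). g' t x)"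
      by (rule continuous_on_subset[OF c']) auto
  qed (use t in auto)
  moreover have "at t within {0<..} = at t" using t by (intro at_within_open) auto
  ultimately show ?thesis by simp
qed

lemma integral_time_continuous:
  fixes g :: "real \<Rightarrow> real \<Rightarrow> real"
  assumes "continuous_on ({0..} \<times> UNIV) (\<lambda>(t, x). g t x)"
  shows "continuous_on {0..} (\<lambda>t. integral {a..b} (g t))"
proof -
  have "continuous_on {0..} (\<lambda>t. integral (cbox a b) (g t))"
    by (rule integral_continuous_on_param) (rule continuous_on_subset[OF assms], auto)
  then show ?thesis by simp
qed

text \<open>Derivatives of the solution are available at positive times only; the value at time 0 is
  reached by continuity.\<close>

lemma nonincreasing_from_0:
  fixes V V' :: "real \<Rightarrow> real"
  assumes d: "\<And>t. t > 0 \<Longrightarrow> (V has_real_derivative V' t) (at t)" "\<And>t. t > 0 \<Longrightarrow> V' t \<le> 0"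
    and c: "continuous_on {0..} V" and t: "t > 0"
  shows "V t \<le> V 0"
proof (rule DERIV_nonpos_imp_decreasing_open[of 0 t])
  show "continuous_on {0..t} V" by (rule continuous_on_subset[OF c]) auto
qed (use t d in \<open>auto\<close>)

text \<open>Pointwise, (f (x + k) - f x)^2 is at most k times the integral of f'^2 over [x, x + k].
  Integration over x and exchange of the two integrals gives the second factor k. The exchange is
  carried out with a second antiderivative \<open>GG\<close> of f'^2, whose second difference is
  evaluated through G (x + L) - G x = P.\<close>

lemma periodic_difference_L2:
  fixes f f' :: "real \<Rightarrow> real"
  assumes L: "L > 0" and per: "periodic_fun_simple f' L"
    and d: "\<And>x. (f has_real_derivative f' x) (at x)" and c: "continuous_on UNIV f'" and k: "k \<ge> 0"
  shows "integral {0..L} (\<lambda>x. (f (x + k) - f x)\<^sup>2) \<le> k\<^sup>2 * integral {0..L} (\<lambda>x. (f' x)\<^sup>2)"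
proof -
  define P where "P = integral {0..L} (\<lambda>x. (f' x)\<^sup>2)"
  have per2: "periodic_fun_simple (\<lambda>x. (f' x)\<^sup>2) L" using per by (simp add: periodic_fun_simple_def)
  have c2: "continuous_on UNIV (\<lambda>x. (f' x)\<^sup>2)" "continuous_on UNIV (\<lambda>x. \<bar>f' x\<bar>)" using c by (auto intro!: continuous_intros)
  obtain G where G: "\<And>x. (G has_real_derivative (f' x)\<^sup>2) (at x)" using antiderivative[OF c2(1)] by metis
  have G_cont: "continuous_on UNIV G" using G by (rule continuous_of_derivative)
  obtain GG where GG: "\<And>x. (GG has_real_derivative G x) (at x)" using antiderivative[OF G_cont] by metis
  have GL: "G (x + L) - G x = P" for x
    using integral_derivative[OF _ G, of x "x + L"] periodic_integral_shift[OF per2 L c2(1), of x] L by (simp add: P_def)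
  have f_cont: "continuous_on UNIV f" using d by (rule continuous_of_derivative)
  have shift: "continuous_on UNIV (\<lambda>x. h (x + k))" if "continuous_on UNIV h" for h :: "real \<Rightarrow> real"
    by (rule continuous_on_compose2[OF that]) (auto intro!: continuous_intros)
  have pw: "(f (x + k) - f x)\<^sup>2 \<le> k * (G (x + k) - G x)" for x
  proof -
    have "\<bar>f (x + k) - f x\<bar> = \<bar>integral {x..x + k} f'\<bar>" using integral_derivative[OF _ d, of x "x + k"] k by simp
    also have "\<dots> \<le> integral {x..x + k} (\<lambda>x. \<bar>f' x\<bar>)"
      using integral_norm_bound_integral[OF integrable_cont[OF c] integrable_cont[OF c2(2)], of x "x + k"] by simp
    finally have "(f (x + k) - f x)\<^sup>2 \<le> (integral {x..x + k} (\<lambda>x. \<bar>f' x\<bar>))\<^sup>2"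
      by (metis abs_ge_zero power2_abs power_mono)
    also have "\<dots> \<le> k * integral {x..x + k} (\<lambda>x. (f' x)\<^sup>2)"
      using integral_abs_Cauchy_Schwarz[OF c, of x "x + k"] k by simp
    finally show ?thesis using integral_derivative[OF _ G, of x "x + k"] k by simp
  qed
  have dm: "((\<lambda>y. (GG (L + y) - GG y) - y * P) has_real_derivative 0) (at y)" for y
  proof -
    have "((\<lambda>y. GG (L + y)) has_real_derivative G (L + y)) (at y)"
      using DERIV_shift[of GG "G (L + y)" y L] GG[of "L + y"] by (simp add: add.commute)
    then have "((\<lambda>y. (GG (L + y) - GG y) - y * P) has_real_derivative G (L + y) - G y - P) (at y)"
      by (auto intro!: derivative_eq_intros GG)
    then show ?thesis using GL[of y] by (simp add: add.commute)
  qed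
  have GGk: "GG (L + k) - GG k - (GG L - GG 0) = k * P"
    using derivative_zero_eq[OF dm, of k 0] by simp
  have GGd: "((\<lambda>x. GG (x + k) - GG x) has_real_derivative G (x + k) - G x) (at x)" for x
    using DERIV_shift[of GG "G (x + k)" x k] GG[of "x + k"] by (auto intro!: derivative_eq_intros GG)
  have "integral {0..L} (\<lambda>x. (f (x + k) - f x)\<^sup>2) \<le> integral {0..L} (\<lambda>x. k * (G (x + k) - G x))"
    by (intro integral_mono_cont pw continuous_intros shift f_cont G_cont)
  also have "\<dots> = k * (GG (L + k) - GG L - (GG k - GG 0))"
    using integral_derivative[OF _ GGd, of 0 L] L by simp
  also have "\<dots> = k\<^sup>2 * P" using GGk by (simp add: power2_eq_square algebra_simps)
  finally show ?thesis by (simp add: P_def)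
qed

text \<open>In terms of \<open>f = \<rho> / q\<close>, where \<open>q\<close> is the stationary density, the Fokker--Planck equation reads
  \<open>q \<partial>\<^sub>t f = \<partial>\<^sub>x (u \<partial>\<^sub>x f / 2) - J \<partial>\<^sub>x f\<close> with \<open>u = \<sigma>\<^sup>2 q\<close> and \<open>J\<close> the constant stationary flux.\<close>

locale ratio_equation =
  fixes L J :: real and q q' q'' u u' :: "real \<Rightarrow> real" and f ft fx fxx :: "real \<Rightarrow> real \<Rightarrow> real" and f0' :: "real \<Rightarrow> real"
  assumes L: "L > 0"
    and q_per: "periodic_fun_simple q L" and q_pos: "\<And>x. q x > 0" and q_int: "integral {0..L} q = 1"
    and dq: "\<And>x. (q has_real_derivative q' x) (at x)" and dq': "\<And>x. (q' has_real_derivative q'' x) (at x)"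
    and q''_cont: "continuous_on UNIV q''"
    and u_per: "periodic_fun_simple u L" and u_pos: "\<And>x. u x > 0"
    and du: "\<And>x. (u has_real_derivative u' x) (at x)" and u'_cont: "continuous_on UNIV u'"
    and f_per: "\<And>t. t \<ge> 0 \<Longrightarrow> periodic_fun_simple (f t) L"
    and f_cont: "continuous_on ({0..} \<times> UNIV) (\<lambda>(t, x). f t x)"
    and ft_cont: "continuous_on ({0<..} \<times> UNIV) (\<lambda>(t, x). ft t x)"
    and fxx_cont: "continuous_on ({0<..} \<times> UNIV) (\<lambda>(t, x). fxx t x)"
    and dt: "\<And>t x. t > 0 \<Longrightarrow> ((\<lambda>s. f s x) has_real_derivative ft t x) (at t)"
    and dx: "\<And>t x. t > 0 \<Longrightarrow> (f t has_real_derivative fx t x) (at x)"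
    and dxx: "\<And>t x. t > 0 \<Longrightarrow> (fx t has_real_derivative fxx t x) (at x)"
    and pde: "\<And>t x. t > 0 \<Longrightarrow> q x * ft t x = (u' x * fx t x + u x * fxx t x) / 2 - J * fx t x"
    and d0: "\<And>x. (f 0 has_real_derivative f0' x) (at x)" and f0'_cont: "continuous_on UNIV f0'"
begin

lemma q_cont: "continuous_on UNIV q" and q'_cont: "continuous_on UNIV q'" and u_cont: "continuous_on UNIV u"
  using dq dq' du by (auto intro: continuous_of_derivative)

lemma slice:
  assumes "continuous_on ({0<..} \<times> UNIV) (\<lambda>(t, x). g t x)" "t > 0"
  shows "continuous_on UNIV (g t)"
proof -
  have "continuous_on UNIV (\<lambda>x. (\<lambda>(t, x). g t x) (t, x))"
    by (rule continuous_on_compose2[OF assms(1)]) (use assms(2) in \<open>auto intro!: continuous_intros\<close>)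
  then show ?thesis by simp
qed

lemma x_cont: assumes "t > 0" shows "continuous_on UNIV (f t)" "continuous_on UNIV (fx t)" "continuous_on UNIV (fxx t)"
  "continuous_on UNIV (ft t)"
  by (rule continuous_of_derivative[OF dx[OF assms]] continuous_of_derivative[OF dxx[OF assms]]
      slice[OF fxx_cont assms] slice[OF ft_cont assms])+

lemma f_cont': "continuous_on ({0<..} \<times> UNIV) (\<lambda>(t, x). f t x)"
  by (rule continuous_on_subset[OF f_cont]) auto

lemma fx_per: "t > 0 \<Longrightarrow> periodic_fun_simple (fx t) L"
  using periodic_derivative[OF f_per dx] by simp

lemma shift_cont: "continuous_on UNIV h \<Longrightarrow> continuous_on UNIV (\<lambda>x. h (x + k))" for h :: "real \<Rightarrow> real" and k :: real
  by (rule continuous_on_compose2[of UNIV h]) (auto intro!: continuous_intros)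

lemma shift_cont2:
  fixes h :: "real \<Rightarrow> real \<Rightarrow> real" and k :: real
  assumes "continuous_on (T \<times> UNIV) (\<lambda>(t, x). h t x)"
  shows "continuous_on (T \<times> UNIV) (\<lambda>(t, x). h t (x + k))"
proof -
  have "continuous_on (T \<times> UNIV) (\<lambda>p. (\<lambda>(t, x). h t x) (fst p, snd p + k))"
    by (rule continuous_on_compose2[OF assms]) (auto intro!: continuous_intros)
  then show ?thesis by (simp add: case_prod_unfold)
qed

definition energy :: "real \<Rightarrow> real" where "energy t = integral {0..L} (\<lambda>x. q x * (f t x)\<^sup>2)"

definition shift_energy :: "real \<Rightarrow> real \<Rightarrow> real" where "shift_energy k t = integral {0..L} (\<lambda>x. q x * (f t (x + k) - f t x)\<^sup>2)"

lemma q_cont2: "continuous_on (T \<times> UNIV) (\<lambda>(t, x). q x)" for T :: "real set"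
proof -
  have "continuous_on (T \<times> UNIV) (\<lambda>p. q (snd p))"
    by (rule continuous_on_compose2[OF q_cont]) (auto intro!: continuous_intros)
  then show ?thesis by (simp add: case_prod_unfold)
qed

lemma energy_cont: "continuous_on {0..} energy"
  unfolding energy_def
  by (rule integral_time_continuous)
    (use f_cont q_cont2 in \<open>auto simp: case_prod_unfold intro!: continuous_intros\<close>)

lemma shift_energy_cont: "continuous_on {0..} (shift_energy k)"
  unfolding shift_energy_def
  by (rule integral_time_continuous)
    (use f_cont q_cont2 shift_cont2[OF f_cont] in \<open>auto simp: case_prod_unfold intro!: continuous_intros\<close>)

text \<open>The transport term contributes the derivative of J f^2, which integrates to zero over a
  period; integration by parts of the rest leaves the dissipation.\<close>

lemma energy_deriv:
  assumes t: "t > 0"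
  shows "(energy has_real_derivative - integral {0..L} (\<lambda>x. u x * (fx t x)\<^sup>2)) (at t)"
proof -
  have "(energy has_real_derivative integral {0..L} (\<lambda>x. 2 * q x * f t x * ft t x)) (at t)"
    unfolding energy_def
  proof (rule integral_time_derivative[OF _ _ _ t])
    show "((\<lambda>s. q x * (f s x)\<^sup>2) has_real_derivative 2 * q x * f t x * ft t x) (at t)" if "t > 0" for t x
      by (auto intro!: derivative_eq_intros dt that)
    show "continuous_on UNIV (\<lambda>x. q x * (f t x)\<^sup>2)" if "t > 0" for t
      by (intro continuous_intros q_cont x_cont that)
    show "continuous_on ({0<..} \<times> UNIV) (\<lambda>(t, x). 2 * q x * f t x * ft t x)"
      using f_cont' ft_cont q_cont2 by (auto simp: case_prod_unfold intro!: continuous_intros)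
  qed
  also have "integral {0..L} (\<lambda>x. 2 * q x * f t x * ft t x) = - integral {0..L} (\<lambda>x. u x * (fx t x)\<^sup>2)"
  proof -
    define a where "a x = u x * f t x * fx t x - J * (f t x)\<^sup>2" for x
    define a' where "a' x = u' x * f t x * fx t x + u x * (fx t x)\<^sup>2 + u x * f t x * fxx t x - 2 * J * f t x * fx t x" for x
    have da: "(a has_real_derivative a' x) (at x)" for x
      unfolding a_def[abs_def] a'_def using t
      by (auto intro!: derivative_eq_intros du dx dxx simp: power2_eq_square algebra_simps)
    have a'_cont: "continuous_on UNIV a'" unfolding a'_def[abs_def]
      by (intro continuous_intros u_cont u'_cont x_cont t)
    have "periodic_fun_simple a L"
      using f_per[of t] fx_per[of t] u_per t by (simp add: a_def[abs_def] periodic_fun_simple_def)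
    from periodic_integral_derivative[OF this L da] have a0: "integral {0..L} a' = 0" .
    have "2 * q x * f t x * ft t x = a' x - u x * (fx t x)\<^sup>2" for x
    proof -
      have "2 * q x * f t x * ft t x = 2 * f t x * (q x * ft t x)" by simp
      also have "\<dots> = a' x - u x * (fx t x)\<^sup>2" unfolding pde[OF t] a'_def by (simp add: field_simps)
      finally show ?thesis .
    qed
    then have "integral {0..L} (\<lambda>x. 2 * q x * f t x * ft t x) = integral {0..L} (\<lambda>x. a' x - u x * (fx t x)\<^sup>2)" by simp
    also have "\<dots> = integral {0..L} a' - integral {0..L} (\<lambda>x. u x * (fx t x)\<^sup>2)"
      by (intro integral_diff integrable_cont a'_cont continuous_intros u_cont x_cont t)
    finally show ?thesis using a0 by simp
  qed
  finally show ?thesis .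
qed

text \<open>The infimum serves as a canonical ellipticity constant that later statements can
  mention.\<close>

lemma u_min: "(INF x. u x) > 0" "(INF x. u x) \<le> u x"
proof -
  obtain u0 where u0: "u0 > 0" "\<And>x. u0 \<le> u x" using periodic_bounded_below[OF u_per L u_cont u_pos] by metis
  have "u0 \<le> (INF x. u x)" by (rule cINF_greatest) (use u0 in auto)
  then show "(INF x. u x) > 0" using u0 by simp
  show "(INF x. u x) \<le> u x" by (rule cINF_lower) (use u0 in \<open>auto intro!: bdd_belowI\<close>)
qed

text \<open>The energy argument for the difference w of f (. + k) and f. Since \<open>q\<close> and
  \<open>u\<close> vary with x, commutators appear, but each carries a coefficient of size k and a
  factor fx (x + k), times w or its derivative. Young's inequality absorbs the derivative of w in
  the dissipation, and the square of w integrates to at most k^2 times that of fx.\<close>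

lemma shift_energy_deriv:
  obtains C where "C > 0"
    "\<And>k t. 0 < k \<Longrightarrow> t > 0 \<Longrightarrow> \<exists>D. (shift_energy k has_real_derivative D) (at t) \<and>
      D \<le> - (INF x. u x) / 2 * integral {0..L} (\<lambda>x. (fx t (x + k) - fx t x)\<^sup>2)
        + C * k\<^sup>2 * integral {0..L} (\<lambda>x. (fx t x)\<^sup>2)"
proof -
  define m where "m = (INF x. u x)"
  note m = u_min[folded m_def]
  obtain q0 where q0: "q0 > 0" "\<And>x. q0 \<le> q x" using periodic_bounded_below[OF q_per L q_cont q_pos] by metis
  have q'_per: "periodic_fun_simple q' L" by (rule periodic_derivative[OF q_per dq])
  obtain K1 where K1: "K1 > 0" "\<And>x. \<bar>u x\<bar> \<le> K1" using periodic_bounded[OF u_per L u_cont] by metis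
  obtain K2 where K2: "K2 > 0" "\<And>x. \<bar>u' x\<bar> \<le> K2"
    using periodic_bounded[OF periodic_derivative[OF u_per du] L u'_cont] by metis
  obtain K3 where K3: "K3 > 0" "\<And>x. \<bar>q' x\<bar> \<le> K3" using periodic_bounded[OF q'_per L q'_cont] by metis
  obtain K4 where K4: "K4 > 0" "\<And>x. \<bar>q'' x\<bar> \<le> K4"
    using periodic_bounded[OF periodic_derivative[OF q'_per dq'] L q''_cont] by metis
  have lip: "\<bar>h (x + k) - h x\<bar> \<le> K * k" if "\<And>x. (h has_real_derivative h' x) (at x)" "\<And>x. \<bar>h' x\<bar> \<le> K" "k > 0"
    for h h' :: "real \<Rightarrow> real" and K k x
    using field_differentiable_bound[of UNIV h h' K "x + k" x] that by auto
  define R where "R = K3 / q0"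
  define R' where "R' = K4 / q0 + K3 * K3 / q0\<^sup>2"
  define C1 where "C1 = K2 / 2 + R * K1 / 2"
  define C2 where "C2 = R * \<bar>J\<bar> + R' * K1 / 2"
  have pos: "R \<ge> 0" "R' \<ge> 0" "C1 \<ge> 0" "C2 \<ge> 0" using K1 K2 K3 K4 q0 by (auto simp: R_def R'_def C1_def C2_def)
  define C where "C = 2 * (C1\<^sup>2 / m + C2) + 1"
  show ?thesis
  proof (rule that[of C])
    show "C > 0" using pos m by (auto simp: C_def intro!: add_nonneg_pos)
    fix k t :: real assume k: "0 < k" and t: "t > 0"
    define w where "w s x = f s (x + k) - f s x" for s x
    define wx where "wx x = fx t (x + k) - fx t x" for x
    define P where "P = integral {0..L} (\<lambda>x. (fx t x)\<^sup>2)"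
    have w_cont: "continuous_on UNIV (w t)" unfolding w_def[abs_def] by (intro continuous_intros shift_cont x_cont t)
    have wx_cont: "continuous_on UNIV wx" unfolding wx_def[abs_def] by (intro continuous_intros shift_cont x_cont t)
    have sh: "((\<lambda>x. h (x + k)) has_real_derivative h' (x + k)) (at x)"
      if "\<And>x. (h has_real_derivative h' x) (at x)" for h h' :: "real \<Rightarrow> real" and x
      using DERIV_shift[of h "h' (x + k)" x k] that[of "x + k"] by simp
    have dw: "(w t has_real_derivative wx x) (at x)" for x
      unfolding w_def[abs_def] wx_def by (intro derivative_intros sh dx t)
    have Q': "(shift_energy k has_real_derivative integral {0..L} (\<lambda>x. 2 * q x * w t x * (ft t (x + k) - ft t x))) (at t)"
      unfolding shift_energy_def w_def[symmetric]
    proof (rule integral_time_derivative[OF _ _ _ t])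
      show "((\<lambda>s. q x * (w s x)\<^sup>2) has_real_derivative 2 * q x * w t x * (ft t (x + k) - ft t x)) (at t)" if "t > 0" for t x
        unfolding w_def by (auto intro!: derivative_eq_intros dt that)
      show "continuous_on UNIV (\<lambda>x. q x * (w t x)\<^sup>2)" if "t > 0" for t
        unfolding w_def by (intro continuous_intros q_cont shift_cont x_cont that)
      show "continuous_on ({0<..} \<times> UNIV) (\<lambda>(t, x). 2 * q x * w t x * (ft t (x + k) - ft t x))"
        using f_cont' ft_cont q_cont2 shift_cont2[OF f_cont'] shift_cont2[OF ft_cont]
        by (auto simp: case_prod_unfold w_def intro!: continuous_intros)
    qed
    \<comment> \<open>The equation at \<open>x + k\<close> carries the weight
      \<open>q (x + k)\<close>, the energy the weight \<open>q x\<close>; \<open>r\<close> is their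
      relative defect. Both \<open>r\<close> and its derivative are of order k.\<close>
    define r where "r x = 1 - q x / q (x + k)" for x
    define r' where "r' x = - (q' x * q (x + k) - q x * q' (x + k)) / (q (x + k))\<^sup>2" for x
    have dr: "(r has_real_derivative r' x) (at x)" for x
      unfolding r_def[abs_def] r'_def using q_pos[of "x + k"]
      by (auto intro!: derivative_eq_intros dq sh simp: field_simps power2_eq_square)
    have r_bd: "\<bar>r x\<bar> \<le> R * k" for x
    proof -
      have "r x = (q (x + k) - q x) / q (x + k)" using q_pos[of "x + k"] by (simp add: r_def diff_divide_distrib)
      then have "\<bar>r x\<bar> = \<bar>q (x + k) - q x\<bar> / q (x + k)" using q_pos[of "x + k"] by simp
      also have "\<dots> \<le> K3 * k / q0"
        using lip[OF dq K3(2) k, of x] q0 q0(2)[of "x + k"] by (intro frac_le) auto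
      finally show ?thesis by (simp add: R_def)
    qed
    have r'_bd: "\<bar>r' x\<bar> \<le> R' * k" for x
    proof -
      define qk where "qk = q (x + k)"
      have qk: "qk \<ge> q0" "qk > 0" using q0 q_pos by (auto simp: qk_def)
      have "r' x = (q' (x + k) - q' x) / qk - q' (x + k) * (qk - q x) / qk\<^sup>2"
        unfolding r'_def qk_def[symmetric] using qk by (simp add: field_simps power2_eq_square)
      then have "\<bar>r' x\<bar> \<le> \<bar>q' (x + k) - q' x\<bar> / qk + \<bar>q' (x + k)\<bar> * \<bar>qk - q x\<bar> / qk\<^sup>2"
        using qk abs_triangle_ineq4[of "(q' (x + k) - q' x) / qk" "q' (x + k) * (qk - q x) / qk\<^sup>2"]
        by (simp add: abs_mult)
      also have "\<dots> \<le> K4 * k / q0 + K3 * (K3 * k) / q0\<^sup>2"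
        using lip[OF dq' K4(2) k, of x] lip[OF dq K3(2) k, of x] K3(2)[of "x + k"] qk q0 K3(1)
        by (intro add_mono frac_le mult_mono power_mono) (auto simp: qk_def)
      finally show ?thesis by (simp add: R'_def algebra_simps)
    qed
    define H where "H x = (u (x + k) * fx t (x + k) - u x * fx t x) / 2" for x
    define H' where "H' x = (u' (x + k) * fx t (x + k) + u (x + k) * fxx t (x + k) - u' x * fx t x - u x * fxx t x) / 2" for x
    have dH: "(H has_real_derivative H' x) (at x)" for x
      unfolding H_def[abs_def] H'_def using t
      by (auto intro!: derivative_eq_intros du dxx sh simp: field_simps)
    \<comment> \<open>\<open>a\<close> collects the boundary terms of all integrations by parts.
      What remains of the integrand is \<open>g\<close>, which contains no second derivative of
      \<open>f\<close>.\<close>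
    define a where "a x = - J * (w t x)\<^sup>2 / 2 + w t x * H x - w t x * r x * (u (x + k) * fx t (x + k)) / 2" for x
    define g where "g x = - wx x * H x + J * w t x * r x * fx t (x + k)
        + (wx x * r x + w t x * r' x) * (u (x + k) * fx t (x + k)) / 2" for x
    have da: "(a has_real_derivative q x * w t x * (ft t (x + k) - ft t x) - g x) (at x)" for x
    proof -
      have uf: "((\<lambda>x. u (x + k) * fx t (x + k)) has_real_derivative u' (x + k) * fx t (x + k) + u (x + k) * fxx t (x + k)) (at x)" for x
        by (rule DERIV_cong[OF DERIV_mult[OF sh[OF du] sh[OF dxx[OF t]]]]) simp
      have "(a has_real_derivative - J * w t x * wx x + (wx x * H x + w t x * H' x)
         - ((wx x * r x + w t x * r' x) * (u (x + k) * fx t (x + k)) + w t x * r x * (u' (x + k) * fx t (x + k) + u (x + k) * fxx t (x + k))) / 2) (at x)"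
      proof -
        define V where "V x = u (x + k) * fx t (x + k)" for x
        define V' where "V' x = u' (x + k) * fx t (x + k) + u (x + k) * fxx t (x + k)" for x
        have dV: "(V has_real_derivative V' x) (at x)" for x using uf[of x] by (simp add: V_def[abs_def] V'_def)
        have "a = (\<lambda>x. - J * (w t x)\<^sup>2 / 2 + w t x * H x - w t x * r x * V x / 2)"
          by (simp add: a_def[abs_def] V_def)
        then show ?thesis
          unfolding V_def[of x, symmetric] V'_def[of x, symmetric]
          by (auto intro!: derivative_eq_intros dw dH dr dV simp: algebra_simps add_divide_distrib)
      qed
      also have "- J * w t x * wx x + (wx x * H x + w t x * H' x)
         - ((wx x * r x + w t x * r' x) * (u (x + k) * fx t (x + k)) + w t x * r x * (u' (x + k) * fx t (x + k) + u (x + k) * fxx t (x + k))) / 2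
         = q x * w t x * (ft t (x + k) - ft t x) - g x"
      proof -
        define F where "F = q (x + k) * ft t (x + k)"
        have F: "F = (u' (x + k) * fx t (x + k) + u (x + k) * fxx t (x + k)) / 2 - J * fx t (x + k)"
          unfolding F_def by (rule pde[OF t])
        have "q x * ft t (x + k) = (1 - r x) * F" using q_pos[of "x + k"] by (simp add: r_def F_def)
        then have "q x * w t x * (ft t (x + k) - ft t x) = w t x * ((1 - r x) * F - q x * ft t x)"
          by (metis (no_types, lifting) mult.assoc mult.commute right_diff_distrib)
        also have "\<dots> = w t x * ((1 - r x) * F - ((u' x * fx t x + u x * fxx t x) / 2 - J * fx t x))"
          unfolding pde[OF t] ..
        finally show ?thesis unfolding F g_def wx_def H'_def by (simp add: field_simps)
      qed
      finally show ?thesis .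
    qed
    have a_per: "periodic_fun_simple a L"
    proof
      fix x
      interpret f: periodic_fun_simple "f t" L using f_per t by simp
      interpret fx: periodic_fun_simple "fx t" L using fx_per t by simp
      interpret u: periodic_fun_simple u L by (rule u_per)
      interpret q: periodic_fun_simple q L by (rule q_per)
      have e: "x + L + k = (x + k) + L" by simp
      show "a (x + L) = a x" unfolding a_def w_def H_def r_def e f.plus_period fx.plus_period u.plus_period q.plus_period ..
    qed
    have g_cont: "continuous_on UNIV g"
    proof -
      have "continuous_on UNIV r'" unfolding r'_def[abs_def]
        by (intro continuous_intros shift_cont q_cont q'_cont) (use q_pos in \<open>auto simp: less_le\<close>)
      moreover have "continuous_on UNIV r" using dr by (rule continuous_of_derivative)
      moreover have "continuous_on UNIV H" using dH by (rule continuous_of_derivative)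
      ultimately show ?thesis unfolding g_def[abs_def]
        by (intro continuous_intros wx_cont w_cont shift_cont u_cont x_cont t) auto
    qed
    have q_w_cont: "continuous_on UNIV (\<lambda>x. q x * w t x * (ft t (x + k) - ft t x))"
      by (intro continuous_intros q_cont w_cont shift_cont x_cont t)
    have "integral {0..L} (\<lambda>x. q x * w t x * (ft t (x + k) - ft t x) - g x) = 0"
      by (rule periodic_integral_derivative[OF a_per L da])
    then have Qg: "integral {0..L} (\<lambda>x. q x * w t x * (ft t (x + k) - ft t x)) = integral {0..L} g"
      using integral_diff[OF integrable_cont[OF q_w_cont] integrable_cont[OF g_cont], of 0 L] by simp
    have g_le: "g x \<le> - m / 4 * (wx x)\<^sup>2 + (C1\<^sup>2 / m + C2 / 2) * (k\<^sup>2 * (fx t (x + k))\<^sup>2) + C2 / 2 * (w t x)\<^sup>2" for x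
    proof -
      define z where "z = k * \<bar>fx t (x + k)\<bar>"
      have H: "H x = u x * wx x / 2 + (u (x + k) - u x) * fx t (x + k) / 2"
        by (simp add: H_def wx_def field_simps)
      have "- wx x * H x = - (u x * (wx x)\<^sup>2 / 2) - wx x * ((u (x + k) - u x) * fx t (x + k)) / 2"
        unfolding H by (simp add: field_simps power2_eq_square)
      also have "\<dots> \<le> - (m * (wx x)\<^sup>2 / 2) + \<bar>wx x\<bar> * (K2 * z) / 2"
      proof -
        have "m * (wx x)\<^sup>2 \<le> u x * (wx x)\<^sup>2" by (intro mult_right_mono m) simp
        moreover have "\<bar>wx x * ((u (x + k) - u x) * fx t (x + k))\<bar> \<le> \<bar>wx x\<bar> * (K2 * z)"
        proof -
          have "\<bar>u (x + k) - u x\<bar> * \<bar>fx t (x + k)\<bar> \<le> K2 * k * \<bar>fx t (x + k)\<bar>"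
            by (intro mult_right_mono lip[OF du K2(2) k]) simp
          then show ?thesis unfolding abs_mult by (intro mult_left_mono) (auto simp: z_def mult.assoc)
        qed
        ultimately show ?thesis by linarith
      qed
      finally have 1: "- wx x * H x \<le> - (m * (wx x)\<^sup>2 / 2) + \<bar>wx x\<bar> * (K2 * z) / 2" .
      have 2: "J * w t x * r x * fx t (x + k) \<le> \<bar>w t x\<bar> * (R * \<bar>J\<bar> * z)"
      proof -
        have "J * w t x * r x * fx t (x + k) \<le> \<bar>J * w t x * r x * fx t (x + k)\<bar>" by simp
        also have "\<dots> = \<bar>r x\<bar> * (\<bar>J\<bar> * \<bar>w t x\<bar> * \<bar>fx t (x + k)\<bar>)" by (simp add: abs_mult)
        also have "\<dots> \<le> R * k * (\<bar>J\<bar> * \<bar>w t x\<bar> * \<bar>fx t (x + k)\<bar>)" by (intro mult_right_mono r_bd) simp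
        finally show ?thesis by (simp add: z_def mult_ac)
      qed
      have 3: "(wx x * r x + w t x * r' x) * (u (x + k) * fx t (x + k)) / 2
         \<le> \<bar>wx x\<bar> * (R * K1 / 2 * z) + \<bar>w t x\<bar> * (R' * K1 / 2 * z)"
      proof -
        have "(wx x * r x + w t x * r' x) * (u (x + k) * fx t (x + k)) \<le> \<bar>(wx x * r x + w t x * r' x) * (u (x + k) * fx t (x + k))\<bar>" by simp
        also have "\<dots> = \<bar>wx x * r x + w t x * r' x\<bar> * (\<bar>u (x + k)\<bar> * \<bar>fx t (x + k)\<bar>)" by (simp add: abs_mult)
        also have "\<dots> \<le> (\<bar>wx x\<bar> * (R * k) + \<bar>w t x\<bar> * (R' * k)) * (K1 * \<bar>fx t (x + k)\<bar>)"
        proof (intro mult_mono)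
          have "\<bar>wx x * r x + w t x * r' x\<bar> \<le> \<bar>wx x\<bar> * \<bar>r x\<bar> + \<bar>w t x\<bar> * \<bar>r' x\<bar>"
            using abs_triangle_ineq[of "wx x * r x" "w t x * r' x"] by (simp add: abs_mult)
          also have "\<dots> \<le> \<bar>wx x\<bar> * (R * k) + \<bar>w t x\<bar> * (R' * k)"
            by (intro add_mono mult_left_mono r_bd r'_bd) auto
          finally show "\<bar>wx x * r x + w t x * r' x\<bar> \<le> \<bar>wx x\<bar> * (R * k) + \<bar>w t x\<bar> * (R' * k)" .
        qed (use K1 k pos in auto)
        finally show ?thesis by (simp add: z_def algebra_simps)
      qed
      have "g x \<le> - (m * (wx x)\<^sup>2 / 2) + C1 * (\<bar>wx x\<bar> * z) + C2 * (\<bar>w t x\<bar> * z)"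
      proof -
        have "g x \<le> (- (m * (wx x)\<^sup>2 / 2) + \<bar>wx x\<bar> * (K2 * z) / 2) + \<bar>w t x\<bar> * (R * \<bar>J\<bar> * z)
            + (\<bar>wx x\<bar> * (R * K1 / 2 * z) + \<bar>w t x\<bar> * (R' * K1 / 2 * z))"
          unfolding g_def by (intro add_mono 1 2 3)
        also have "\<dots> = - (m * (wx x)\<^sup>2 / 2) + C1 * (\<bar>wx x\<bar> * z) + C2 * (\<bar>w t x\<bar> * z)"
          by (simp add: C1_def C2_def field_simps)
        finally show ?thesis .
      qed
      \<comment> \<open>The weights spend exactly half of the available dissipation m/2.\<close>
      moreover have "C1 * (\<bar>wx x\<bar> * z) \<le> m / 4 * (wx x)\<^sup>2 + C1\<^sup>2 / m * z\<^sup>2"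
      proof -
        have "0 \<le> (m / 2 * \<bar>wx x\<bar> - C1 * z)\<^sup>2 / m" using m by simp
        also have "\<dots> = m / 4 * (wx x)\<^sup>2 + C1\<^sup>2 / m * z\<^sup>2 - C1 * (\<bar>wx x\<bar> * z)"
          using m(1) by (simp add: power2_diff power_mult_distrib field_simps power2_eq_square)
        finally show ?thesis by simp
      qed
      moreover have "C2 * (\<bar>w t x\<bar> * z) \<le> C2 / 2 * (w t x)\<^sup>2 + C2 / 2 * z\<^sup>2"
      proof -
        have "0 \<le> C2 / 2 * (\<bar>w t x\<bar> - z)\<^sup>2" using pos by simp
        also have "\<dots> = C2 / 2 * (w t x)\<^sup>2 + C2 / 2 * z\<^sup>2 - C2 * (\<bar>w t x\<bar> * z)"
          by (simp add: power2_diff field_simps)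
        finally show ?thesis by simp
      qed
      moreover have "z\<^sup>2 = k\<^sup>2 * (fx t (x + k))\<^sup>2" by (simp add: z_def power_mult_distrib)
      ultimately show ?thesis by (simp add: algebra_simps)
    qed
    have c3: "continuous_on UNIV (\<lambda>x. (wx x)\<^sup>2)" "continuous_on UNIV (\<lambda>x. (fx t (x + k))\<^sup>2)" "continuous_on UNIV (\<lambda>x. (w t x)\<^sup>2)"
      by (intro continuous_intros wx_cont w_cont shift_cont x_cont t)+
    have fx2: "periodic_fun_simple (\<lambda>x. (fx t x)\<^sup>2) L" "continuous_on UNIV (\<lambda>x. (fx t x)\<^sup>2)"
      using fx_per[OF t] x_cont[OF t] by (auto simp: periodic_fun_simple_def intro!: continuous_intros)
    have "integral {0..L} g \<le> integral {0..L} (\<lambda>x. - m / 4 * (wx x)\<^sup>2 + (C1\<^sup>2 / m + C2 / 2) * (k\<^sup>2 * (fx t (x + k))\<^sup>2) + C2 / 2 * (w t x)\<^sup>2)"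
      by (rule integral_mono_cont[OF g_cont _ g_le]) (intro continuous_intros c3)
    also have "\<dots> = - m / 4 * integral {0..L} (\<lambda>x. (wx x)\<^sup>2) + (C1\<^sup>2 / m + C2 / 2) * (k\<^sup>2 * integral {0..L} (\<lambda>x. (fx t (x + k))\<^sup>2))
       + C2 / 2 * integral {0..L} (\<lambda>x. (w t x)\<^sup>2)"
      using integral_linear3[OF c3, of 0 L "- m / 4" "(C1\<^sup>2 / m + C2 / 2) * k\<^sup>2" "C2 / 2"]
      by (simp only: mult.assoc)
    also have "\<dots> \<le> - m / 4 * integral {0..L} (\<lambda>x. (wx x)\<^sup>2) + (C1\<^sup>2 / m + C2 / 2) * (k\<^sup>2 * P) + C2 / 2 * (k\<^sup>2 * P)"
    proof -
      have "integral {0..L} (\<lambda>x. (fx t (x + k))\<^sup>2) = P"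
        unfolding P_def by (rule periodic_integral_translate[OF fx2(1) L fx2(2)])
      moreover have "integral {0..L} (\<lambda>x. (w t x)\<^sup>2) \<le> k\<^sup>2 * P"
        unfolding P_def w_def using k
        by (intro periodic_difference_L2[OF L fx_per[OF t] dx[OF t] x_cont(2)[OF t]]) simp
      moreover from this have "C2 / 2 * integral {0..L} (\<lambda>x. (w t x)\<^sup>2) \<le> C2 / 2 * (k\<^sup>2 * P)"
        using pos by (intro mult_left_mono) auto
      ultimately show ?thesis by simp
    qed
    finally have "integral {0..L} g \<le> - m / 4 * integral {0..L} (\<lambda>x. (wx x)\<^sup>2)
        + (C1\<^sup>2 / m + C2 / 2) * (k\<^sup>2 * P) + C2 / 2 * (k\<^sup>2 * P)" .
    moreover have "2 * (- m / 4 * W + (c + C2 / 2) * Y + C2 / 2 * Y) = - m / 2 * W + 2 * (c + C2) * Y" for W c Y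
      by (simp add: algebra_simps)
    ultimately have "2 * integral {0..L} g \<le> - m / 2 * integral {0..L} (\<lambda>x. (wx x)\<^sup>2) + 2 * (C1\<^sup>2 / m + C2) * (k\<^sup>2 * P)"
      by (metis mult_le_cancel_left_pos zero_less_numeral)
    also have "2 * (C1\<^sup>2 / m + C2) * (k\<^sup>2 * P) \<le> C * (k\<^sup>2 * P)"
    proof (rule mult_right_mono)
      have "0 \<le> P" unfolding P_def by (intro integral_nonneg integrable_cont fx2) auto
      then show "0 \<le> k\<^sup>2 * P" by simp
    qed (simp add: C_def)
    finally have "2 * integral {0..L} g \<le> - m / 2 * integral {0..L} (\<lambda>x. (wx x)\<^sup>2) + C * k\<^sup>2 * P" by simp
    moreover have "integral {0..L} (\<lambda>x. 2 * q x * w t x * (ft t (x + k) - ft t x)) = 2 * integral {0..L} g"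
      unfolding Qg[symmetric] by (subst integral_mult_right[symmetric]) (simp add: mult.assoc)
    ultimately have "integral {0..L} (\<lambda>x. 2 * q x * w t x * (ft t (x + k) - ft t x))
      \<le> - m / 2 * integral {0..L} (\<lambda>x. (wx x)\<^sup>2) + C * k\<^sup>2 * P" by simp
    then show "\<exists>D. (shift_energy k has_real_derivative D) (at t) \<and>
      D \<le> - (INF x. u x) / 2 * integral {0..L} (\<lambda>x. (fx t (x + k) - fx t x)\<^sup>2)
        + C * k\<^sup>2 * integral {0..L} (\<lambda>x. (fx t x)\<^sup>2)"
      unfolding m_def[symmetric] wx_def[symmetric] P_def[symmetric] using Q' by blast
  qed
qed

end

text \<open>The tolerance 1 replaces the limit k to 0: a single step, adapted to the modulus of
  continuity of the derivative, controls its square up to an additive constant. No limit under an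
  integral is then required.\<close>

lemma difference_quotient_approx:
  fixes g g' :: "real \<Rightarrow> real"
  assumes k: "k > 0" and d: "\<And>x. (g has_real_derivative g' x) (at x)"
    and c: "\<And>y. x \<le> y \<Longrightarrow> y \<le> x + k \<Longrightarrow> \<bar>g' y - g' x\<bar> \<le> 1"
  shows "(g' x)\<^sup>2 \<le> 2 * ((g (x + k) - g x)\<^sup>2 / k\<^sup>2) + 2"
proof -
  obtain z where z: "x < z" "z < x + k" "g (x + k) - g x = (x + k - x) * g' z"
    using MVT2[of x "x + k" g g'] k d by auto
  then have e: "(g (x + k) - g x)\<^sup>2 / k\<^sup>2 = (g' z)\<^sup>2" using k by (simp add: power_mult_distrib)
  have "\<bar>g' x - g' z\<bar> \<le> 1" using c[of z] z by (simp add: abs_minus_commute)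
  then have "(g' x - g' z)\<^sup>2 \<le> 1" by (metis abs_ge_zero one_power2 power2_abs power_mono)
  moreover have "(g' x)\<^sup>2 \<le> 2 * (g' z)\<^sup>2 + 2 * (g' x - g' z)\<^sup>2"
    using zero_le_power2[of "g' x - 2 * g' z"] by (simp add: power2_eq_square algebra_simps)
  ultimately show ?thesis unfolding e by linarith
qed

context ratio_equation begin

text \<open>No integral over time is needed to control \<open>fxx\<close>: up to an additive constant its \<open>L\<^sup>2\<close> norm is
  dominated by the decay rate of a bounded functional. The functional depends on the time interval
  through the step \<open>k\<close> of the difference quotients, its bound does not.\<close>

lemma uniform_bounds:
  obtains K where "K > 0" "\<And>t x. t > 0 \<Longrightarrow> \<bar>f t x\<bar> \<le> K"
    "\<And>t. t > 0 \<Longrightarrow> integral {0..L} (\<lambda>x. (fx t x)\<^sup>2) \<le> K"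
    "\<And>s t. 0 < s \<Longrightarrow> s < t \<Longrightarrow> \<exists>V D. \<forall>\<tau>\<in>{s..t}. (V has_real_derivative D \<tau>) (at \<tau>) \<and> 0 \<le> V \<tau> \<and> V \<tau> \<le> K \<and>
        integral {0..L} (\<lambda>x. (fxx \<tau> x)\<^sup>2) \<le> K - D \<tau>"
proof -
  define m where "m = (INF x. u x)"
  note m = u_min[folded m_def]
  obtain q0 where q0: "q0 > 0" "\<And>x. q0 \<le> q x" using periodic_bounded_below[OF q_per L q_cont q_pos] by metis
  have f0_per: "periodic_fun_simple f0' L" by (rule periodic_derivative[OF f_per d0]) simp
  obtain K0 where K0: "K0 > 0" "\<And>x. \<bar>f0' x\<bar> \<le> K0" using periodic_bounded[OF f0_per L f0'_cont] by metis
  obtain C where C: "C > 0"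
    "\<And>k t. 0 < k \<Longrightarrow> t > 0 \<Longrightarrow> \<exists>D. (shift_energy k has_real_derivative D) (at t) \<and>
      D \<le> - m / 2 * integral {0..L} (\<lambda>x. (fx t (x + k) - fx t x)\<^sup>2)
        + C * k\<^sup>2 * integral {0..L} (\<lambda>x. (fx t x)\<^sup>2)"
    by (rule shift_energy_deriv[folded m_def], rule that, assumption, blast)
  \<comment> \<open>The weight C/m on \<open>energy\<close> makes its dissipation cancel the term C
    k^2 from \<open>shift_energy_deriv\<close>; the factor 4/m normalises what is left to -2
    \<open>R k t\<close>.\<close>
  define V where "V k t = 4 / m * (shift_energy k t / k\<^sup>2 + C / m * energy t)" for k t
  have energy_nonneg: "0 \<le> energy t" if "t \<ge> 0" for t
  proof -
    have "continuous_on UNIV (f t)"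
    proof -
      have "continuous_on UNIV (\<lambda>x. (\<lambda>(t, x). f t x) (t, x))"
        by (rule continuous_on_compose2[OF f_cont]) (use that in \<open>auto intro!: continuous_intros\<close>)
      then show ?thesis by simp
    qed
    then show ?thesis unfolding energy_def
      by (intro integral_nonneg integrable_cont continuous_intros q_cont) (use q_pos in \<open>auto simp: less_imp_le\<close>)
  qed
  have shift_energy_nonneg: "0 \<le> shift_energy k t" if "t > 0" for k t
    unfolding shift_energy_def
    by (intro integral_nonneg integrable_cont continuous_intros q_cont shift_cont x_cont that)
      (use q_pos in \<open>auto simp: less_imp_le\<close>)
  have V_nonneg: "0 \<le> V k t" if "t > 0" for k t
    unfolding V_def using shift_energy_nonneg[OF that, of k] energy_nonneg[of t] that C(1) m(1) by simp
  define R where "R k t = integral {0..L} (\<lambda>x. (fx t (x + k) - fx t x)\<^sup>2 / k\<^sup>2)" for k t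
  have wx_cont: "continuous_on UNIV (\<lambda>x. (fx t (x + k) - fx t x)\<^sup>2)" "continuous_on UNIV (\<lambda>x. (f t (x + k) - f t x)\<^sup>2)"
    if "t > 0" for t k
    by (intro continuous_intros shift_cont x_cont that)+
  have R: "R k t = integral {0..L} (\<lambda>x. (fx t (x + k) - fx t x)\<^sup>2) / k\<^sup>2" for k t
    by (simp add: R_def)
  have V_deriv: "\<exists>D. (V k has_real_derivative D) (at t) \<and> D \<le> - 2 * R k t" if k: "k > 0" and t: "t > 0" for k t
  proof -
    define P where "P = integral {0..L} (\<lambda>x. (fx t x)\<^sup>2)"
    define U where "U = integral {0..L} (\<lambda>x. u x * (fx t x)\<^sup>2)"
    obtain D where D: "(shift_energy k has_real_derivative D) (at t)"
      "D \<le> - m / 2 * integral {0..L} (\<lambda>x. (fx t (x + k) - fx t x)\<^sup>2) + C * k\<^sup>2 * P"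
      using C(2)[OF k t] unfolding P_def by blast
    have "integral {0..L} (\<lambda>x. m * (fx t x)\<^sup>2) \<le> U"
      unfolding U_def by (intro integral_mono_cont continuous_intros u_cont x_cont t mult_right_mono m) auto
    then have U: "m * P \<le> U" by (simp add: P_def)
    have "(V k has_real_derivative 4 / m * (D / k\<^sup>2 + C / m * (- U))) (at t)"
      unfolding V_def[abs_def] U_def using D(1) energy_deriv[OF t]
      by (intro DERIV_cmult DERIV_add DERIV_cdivide) auto
    moreover have "4 / m * (D / k\<^sup>2 + C / m * (- U)) \<le> - 2 * R k t"
    proof -
      have "D / k\<^sup>2 \<le> (- m / 2 * integral {0..L} (\<lambda>x. (fx t (x + k) - fx t x)\<^sup>2) + C * k\<^sup>2 * P) / k\<^sup>2"
        using D(2) by (intro divide_right_mono) auto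
      also have "\<dots> = - m / 2 * R k t + C * P" using k by (simp add: R add_divide_distrib diff_divide_distrib)
      finally have "D / k\<^sup>2 \<le> - m / 2 * R k t + C * P" .
      moreover have "C / m * (m * P) \<le> C / m * U" using U C(1) m(1) by (intro mult_left_mono) auto
      ultimately have "D / k\<^sup>2 + C / m * (- U) \<le> - m / 2 * R k t" using m(1) by simp
      then have "4 / m * (D / k\<^sup>2 + C / m * (- U)) \<le> 4 / m * (- m / 2 * R k t)"
        using m(1) by (intro mult_left_mono) auto
      then show ?thesis using m(1) by simp
    qed
    ultimately show ?thesis by blast
  qed
  \<comment> \<open>This bounds \<open>V k 0\<close> for all k: the initial difference quotients are
    at most the Lipschitz constant \<open>K0\<close> of \<open>f 0\<close>, and \<open>q\<close> has
    mass 1.\<close>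
  define V0 where "V0 = 4 / m * (K0\<^sup>2 + C / m * energy 0)"
  have V0: "V0 \<ge> 0" using energy_nonneg[of 0] C m by (simp add: V0_def)
  have R_nonneg: "0 \<le> R k t" if "t > 0" for k t
    unfolding R by (intro divide_nonneg_nonneg integral_nonneg integrable_cont wx_cont that) auto
  have V_le: "V k t \<le> V0" if k: "k > 0" and t: "t > 0" for k t
  proof -
    have "\<forall>t\<in>{0<..}. \<exists>D. (V k has_real_derivative D) (at t) \<and> D \<le> - 2 * R k t" using V_deriv[OF k] by auto
    from bchoice[OF this] obtain D where "\<forall>t\<in>{0<..}. (V k has_real_derivative D t) (at t) \<and> D t \<le> - 2 * R k t" ..
    then have D: "\<And>t. t > 0 \<Longrightarrow> (V k has_real_derivative D t) (at t)" "\<And>t. t > 0 \<Longrightarrow> D t \<le> - 2 * R k t"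
      by auto
    have "V k t \<le> V k 0"
    proof (rule nonincreasing_from_0[OF D(1) _ _ t])
      show "D t \<le> 0" if "t > 0" for t using D(2)[OF that] R_nonneg[OF that, of k] by linarith
      show "continuous_on {0..} (V k)" unfolding V_def[abs_def]
        by (intro continuous_intros shift_energy_cont energy_cont) (use k in auto)
    qed
    also have "\<dots> \<le> V0"
    proof -
      have f0c: "continuous_on UNIV (f 0)" using d0 by (rule continuous_of_derivative)
      have "shift_energy k 0 \<le> integral {0..L} (\<lambda>x. q x * (K0\<^sup>2 * k\<^sup>2))"
        unfolding shift_energy_def
      proof (rule integral_mono_cont)
        fix x
        have "\<bar>f 0 (x + k) - f 0 x\<bar> \<le> K0 * k"
          using field_differentiable_bound[of UNIV "f 0" f0' K0 "x + k" x] d0 K0 k by auto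
        then have "(f 0 (x + k) - f 0 x)\<^sup>2 \<le> (K0 * k)\<^sup>2" by (metis abs_ge_zero power2_abs power_mono)
        then show "q x * (f 0 (x + k) - f 0 x)\<^sup>2 \<le> q x * (K0\<^sup>2 * k\<^sup>2)"
          using q_pos[of x] by (intro mult_left_mono) (auto simp: power_mult_distrib)
      qed (intro continuous_intros q_cont shift_cont f0c)+
      also have "\<dots> = K0\<^sup>2 * k\<^sup>2" by (simp add: q_int)
      finally have "shift_energy k 0 / k\<^sup>2 \<le> K0\<^sup>2" using k by (simp add: field_simps)
      then show ?thesis unfolding V_def V0_def using m(1) by (intro mult_left_mono add_right_mono) auto
    qed
    finally show ?thesis .
  qed
  define K1 where "K1 = (m / 2 * V0 + 2) / q0"
  have K1_pos: "K1 > 0" using m V0 q0 by (auto simp: K1_def intro!: divide_pos_pos add_nonneg_pos)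
  have fx_bd: "integral {0..L} (\<lambda>x. (fx t x)\<^sup>2) \<le> K1" if t: "t > 0" for t
  proof -
    have "uniformly_continuous_on UNIV (fx t)"
      by (rule periodic_uniformly_continuous[OF fx_per[OF t] L x_cont(2)[OF t]])
    then obtain \<delta> where \<delta>: "\<delta> > 0" "\<And>x y. dist y x < \<delta> \<Longrightarrow> dist (fx t y) (fx t x) < 1"
      unfolding uniformly_continuous_on_def by (metis UNIV_I zero_less_one)
    \<comment> \<open>The step may depend on \<open>t\<close>, since the bound on
      \<open>V k t\<close> is the same for every positive step.\<close>
    define k where "k = \<delta> / 2"
    have k: "k > 0" using \<delta>(1) by (simp add: k_def)
    have pw: "(fx t x)\<^sup>2 \<le> 2 * ((f t (x + k) - f t x)\<^sup>2 / k\<^sup>2) + 2" for x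
    proof (rule difference_quotient_approx[OF k dx[OF t]])
      fix y assume "x \<le> y" "y \<le> x + k"
      then have "dist y x < \<delta>" using \<delta>(1) by (auto simp: dist_real_def k_def)
      from \<delta>(2)[OF this] show "\<bar>fx t y - fx t x\<bar> \<le> 1" by (simp add: dist_real_def)
    qed
    have "q0 * integral {0..L} (\<lambda>x. (fx t x)\<^sup>2) = integral {0..L} (\<lambda>x. q0 * (fx t x)\<^sup>2)" by simp
    also have "\<dots> \<le> integral {0..L} (\<lambda>x. 2 / k\<^sup>2 * (q x * (f t (x + k) - f t x)\<^sup>2) + 2 * q x + 0 * q x)"
    proof (rule integral_mono_cont)
      fix x
      have "q0 * (fx t x)\<^sup>2 \<le> q x * (fx t x)\<^sup>2" by (intro mult_right_mono q0) auto
      also have "\<dots> \<le> q x * (2 * ((f t (x + k) - f t x)\<^sup>2 / k\<^sup>2) + 2)"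
        using q_pos[of x] by (intro mult_left_mono pw) auto
      finally show "q0 * (fx t x)\<^sup>2 \<le> 2 / k\<^sup>2 * (q x * (f t (x + k) - f t x)\<^sup>2) + 2 * q x + 0 * q x"
        by (simp add: algebra_simps)
    qed (intro continuous_intros q_cont wx_cont x_cont t)+
    also have "\<dots> = 2 / k\<^sup>2 * shift_energy k t + 2 * integral {0..L} q + 0 * integral {0..L} q"
      unfolding shift_energy_def by (rule integral_linear3) (intro continuous_intros q_cont wx_cont t)+
    also have "\<dots> = 2 * (shift_energy k t / k\<^sup>2) + 2" by (simp add: q_int)
    also have "shift_energy k t / k\<^sup>2 \<le> m / 4 * V0"
    proof -
      have "shift_energy k t / k\<^sup>2 \<le> shift_energy k t / k\<^sup>2 + C / m * energy t" using C m energy_nonneg[of t] t by simp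
      also have "\<dots> = m / 4 * V k t" using m(1) by (simp add: V_def field_simps)
      also have "\<dots> \<le> m / 4 * V0" using m(1) V_le[OF k t] by (intro mult_left_mono) auto
      finally show ?thesis .
    qed
    finally show ?thesis using q0(1) by (simp add: K1_def field_simps)
  qed
  define K2 where "K2 = sqrt (energy 0) + sqrt (L * K1)"
  have f_bd: "\<bar>f t x\<bar> \<le> K2" if t: "t > 0" for t x
  proof -
    have fc: "continuous_on UNIV (f t)" "continuous_on UNIV (fx t)" "continuous_on UNIV (\<lambda>x. \<bar>fx t x\<bar>)"
      using x_cont[OF t] by (auto intro!: continuous_intros)
    have "energy t \<le> energy 0"
    proof (rule nonincreasing_from_0[OF energy_deriv _ energy_cont t])
      show "- integral {0..L} (\<lambda>x. u x * (fx t x)\<^sup>2) \<le> 0" if "t > 0" for t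
        using u_pos x_cont[OF that] by (auto simp: less_imp_le intro!: integral_nonneg integrable_cont continuous_intros u_cont)
    qed
    \<comment> \<open>\<open>energy t\<close> is the average of f^2 against the probability density
      \<open>q\<close>, so f^2 cannot exceed it everywhere. From such a point the L^2 bound on fx
      controls the oscillation, which gives the uniform bound on \<open>f\<close>.\<close>
    have "\<exists>y\<in>{0..L}. (f t y)\<^sup>2 \<le> energy 0"
    proof (rule ccontr)
      assume "\<not> ?thesis"
      then have gt: "\<And>y. 0 \<le> y \<Longrightarrow> y \<le> L \<Longrightarrow> energy 0 < (f t y)\<^sup>2" by (auto simp: not_le)
      define h where "h x = q x * ((f t x)\<^sup>2 - energy 0)" for x
      have hc: "continuous_on UNIV h" unfolding h_def[abs_def] by (intro continuous_intros q_cont fc)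
      have hpos: "h x > 0" if "x \<in> {0..L}" for x using gt q_pos that by (auto simp: h_def)
      have "integral {0..L} h = energy t - energy 0"
      proof -
        have "h = (\<lambda>x. 1 * (q x * (f t x)\<^sup>2) + (- energy 0) * q x + 0 * q x)" by (simp add: h_def[abs_def] algebra_simps)
        then have "integral {0..L} h = 1 * integral {0..L} (\<lambda>x. q x * (f t x)\<^sup>2) + (- energy 0) * integral {0..L} q + 0 * integral {0..L} q"
          by (simp only:) (rule integral_linear3; intro continuous_intros q_cont fc)
        then show ?thesis by (simp add: energy_def[of t] q_int)
      qed
      then have "integral {0..L} h \<le> 0" using \<open>energy t \<le> energy 0\<close> by simp
      moreover have "integral {0..L} h \<ge> 0"
        using hpos by (intro integral_nonneg integrable_cont hc) (auto simp: less_imp_le)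
      ultimately have "integral {0..L} h = 0" by simp
      then have "\<forall>x\<in>{0..L}. h x = 0"
        using integral_eq_0_iff[of 0 L h] L hpos continuous_on_subset[OF hc] by (auto simp: less_imp_le)
      then show False using hpos[of 0] L by auto
    qed
    then obtain y where y: "y \<in> {0..L}" "(f t y)\<^sup>2 \<le> energy 0" by blast
    have fy: "\<bar>f t y\<bar> \<le> sqrt (energy 0)" using y(2) real_sqrt_le_mono[OF y(2)] by simp
    define I where "I = integral {0..L} (\<lambda>x. \<bar>fx t x\<bar>)"
    have osc: "\<bar>f t z - f t y\<bar> \<le> I" if z: "z \<in> {0..L}" for z
    proof -
      have *: "\<bar>f t d - f t c\<bar> \<le> I" if "0 \<le> c" "c \<le> d" "d \<le> L" for c d
      proof -
        have "\<bar>f t d - f t c\<bar> = \<bar>integral {c..d} (fx t)\<bar>" using integral_derivative[OF that(2) dx[OF t]] by simp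
        also have "\<dots> \<le> integral {c..d} (\<lambda>x. \<bar>fx t x\<bar>)"
          using integral_norm_bound_integral[OF integrable_cont[OF fc(2)] integrable_cont[OF fc(3)], of c d] by simp
        also have "\<dots> \<le> I" unfolding I_def
          by (rule integral_subset_le) (use that integrable_cont[OF fc(3)] in auto)
        finally show ?thesis .
      qed
      show ?thesis using *[of y z] *[of z y] y(1) z by (cases "y \<le> z") (auto simp: abs_minus_commute)
    qed
    have "I\<^sup>2 \<le> L * K1"
      using integral_abs_Cauchy_Schwarz[OF fc(2), of 0 L] L fx_bd[OF t]
      by (simp add: I_def) (meson mult_left_mono less_imp_le order_trans)
    then have "I \<le> sqrt (L * K1)" by (rule real_le_rsqrt)
    have "f t x = f t (x rmod L)" using periodic_reduce[of "f t" L x] f_per[of t] t L by simp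
    moreover have "\<bar>f t (x rmod L) - f t y\<bar> \<le> I" using rmod_range[OF L, of x] by (intro osc) auto
    ultimately show ?thesis using fy \<open>I \<le> sqrt (L * K1)\<close> unfolding K2_def by linarith
  qed
  define K where "K = max (max K1 K2) (max V0 (2 * L))"
  have last: "\<exists>V D. \<forall>\<tau>\<in>{s..t}. (V has_real_derivative D \<tau>) (at \<tau>) \<and> 0 \<le> V \<tau> \<and> V \<tau> \<le> V0 \<and>
        integral {0..L} (\<lambda>x. (fxx \<tau> x)\<^sup>2) \<le> 2 * L - D \<tau>" if st: "0 < s" "s < t" for s t
  proof -
    \<comment> \<open>Compactness in time gives one step, hence one functional \<open>V k\<close>,
      for the whole interval. The strip reaches to L + 1 because the step is chosen at most
      1.\<close>
    have "uniformly_continuous_on ({s..t} \<times> {0..L + 1}) (\<lambda>(t, x). fxx t x)"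
      by (intro compact_uniformly_continuous compact_Times compact_Icc continuous_on_subset[OF fxx_cont])
        (use st in auto)
    then obtain \<delta> where \<delta>: "\<delta> > 0" "\<And>p p'. p \<in> {s..t} \<times> {0..L + 1} \<Longrightarrow> p' \<in> {s..t} \<times> {0..L + 1} \<Longrightarrow> dist p' p < \<delta> \<Longrightarrow>
        dist ((\<lambda>(t, x). fxx t x) p') ((\<lambda>(t, x). fxx t x) p) < 1"
      unfolding uniformly_continuous_on_def by (metis zero_less_one)
    define k where "k = min (\<delta> / 2) 1"
    have k: "k > 0" using \<delta>(1) by (simp add: k_def)
    have "\<forall>t\<in>{0<..}. \<exists>D. (V k has_real_derivative D) (at t) \<and> D \<le> - 2 * R k t" using V_deriv[OF k] by auto
    from bchoice[OF this] obtain D where "\<forall>t\<in>{0<..}. (V k has_real_derivative D t) (at t) \<and> D t \<le> - 2 * R k t" ..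
    then have D: "\<And>t. t > 0 \<Longrightarrow> (V k has_real_derivative D t) (at t)" "\<And>t. t > 0 \<Longrightarrow> D t \<le> - 2 * R k t"
      by auto
    have "integral {0..L} (\<lambda>x. (fxx \<tau> x)\<^sup>2) \<le> 2 * L - D \<tau>" if \<tau>: "\<tau> \<in> {s..t}" for \<tau>
    proof -
      have \<tau>0: "\<tau> > 0" using \<tau> st by auto
      have "integral {0..L} (\<lambda>x. (fxx \<tau> x)\<^sup>2) \<le> integral {0..L} (\<lambda>x. 2 / k\<^sup>2 * (fx \<tau> (x + k) - fx \<tau> x)\<^sup>2 + 2 * 1 + 0 * 1)"
      proof (rule integral_mono_cont)
        fix x assume x: "0 \<le> x" "x \<le> L"
        have "(fxx \<tau> x)\<^sup>2 \<le> 2 * ((fx \<tau> (x + k) - fx \<tau> x)\<^sup>2 / k\<^sup>2) + 2"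
        proof (rule difference_quotient_approx[OF k dxx[OF \<tau>0]])
          fix y assume y: "x \<le> y" "y \<le> x + k"
          have "dist ((\<lambda>(t, x). fxx t x) (\<tau>, y)) ((\<lambda>(t, x). fxx t x) (\<tau>, x)) < 1"
            by (rule \<delta>(2)) (use x y \<tau> \<delta>(1) in \<open>auto simp: k_def dist_Pair_Pair dist_real_def\<close>)
          then show "\<bar>fxx \<tau> y - fxx \<tau> x\<bar> \<le> 1" by (simp add: dist_real_def)
        qed
        then show "(fxx \<tau> x)\<^sup>2 \<le> 2 / k\<^sup>2 * (fx \<tau> (x + k) - fx \<tau> x)\<^sup>2 + 2 * 1 + 0 * 1" by simp
      qed (intro continuous_intros wx_cont x_cont \<tau>0)+
      also have "\<dots> = 2 / k\<^sup>2 * integral {0..L} (\<lambda>x. (fx \<tau> (x + k) - fx \<tau> x)\<^sup>2) + 2 * integral {0..L} (\<lambda>x. 1) + 0 * integral {0..L} (\<lambda>x. 1)"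
        by (rule integral_linear3) (intro continuous_intros wx_cont \<tau>0)+
      also have "\<dots> = 2 * R k \<tau> + 2 * L" using L by (simp add: R)
      finally show ?thesis using D(2)[OF \<tau>0] by linarith
    qed
    then show ?thesis
      using D(1) V_nonneg[of _ k] V_le[OF k] st by (intro exI[of _ "V k"] exI[of _ D]) auto
  qed
  show ?thesis
  proof (rule that[of K])
    show "K > 0" using K1_pos by (simp add: K_def)
    show "\<bar>f t x\<bar> \<le> K" if "t > 0" for t x using f_bd[OF that, of x] by (simp add: K_def)
    show "integral {0..L} (\<lambda>x. (fx t x)\<^sup>2) \<le> K" if "t > 0" for t using fx_bd[OF that] by (simp add: K_def)
    show "\<exists>V D. \<forall>\<tau>\<in>{s..t}. (V has_real_derivative D \<tau>) (at \<tau>) \<and> 0 \<le> V \<tau> \<and> V \<tau> \<le> K \<and>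
        integral {0..L} (\<lambda>x. (fxx \<tau> x)\<^sup>2) \<le> K - D \<tau>" if "0 < s" "s < t" for s t
    proof -
      obtain V D where VD: "\<forall>\<tau>\<in>{s..t}. (V has_real_derivative D \<tau>) (at \<tau>) \<and> 0 \<le> V \<tau> \<and> V \<tau> \<le> V0 \<and>
        integral {0..L} (\<lambda>x. (fxx \<tau> x)\<^sup>2) \<le> 2 * L - D \<tau>" using last[OF \<open>0 < s\<close> \<open>s < t\<close>] by blast
      have "V0 \<le> K" "2 * L \<le> K" by (auto simp: K_def)
      then show ?thesis using VD by (intro exI[of _ V] exI[of _ D]) force
    qed
  qed
qed

end

subsection \<open>Consistency of the upwind scheme\<close>

lemma average_bound:
  fixes g :: "real \<Rightarrow> real"
  assumes "c < d" "continuous_on UNIV g" "\<And>x. c \<le> x \<Longrightarrow> x \<le> d \<Longrightarrow> \<bar>g x - v\<bar> \<le> I"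
  shows "\<bar>integral {c..d} g / (d - c) - v\<bar> \<le> I"
proof -
  have "norm (integral {c..d} (\<lambda>x. g x - v)) \<le> I * (d - c)"
    by (rule integral_bound) (use assms in \<open>auto intro!: continuous_intros continuous_on_subset[OF assms(2)]\<close>)
  moreover have "integral {c..d} (\<lambda>x. g x - v) = integral {c..d} g - v * (d - c)"
    using integral_diff[OF integrable_cont[OF assms(2)] integrable_const_ivl[of v c d]] assms(1) by simp
  moreover have "integral {c..d} g / (d - c) - v = (integral {c..d} g - v * (d - c)) / (d - c)"
    using assms(1) by (simp add: field_simps)
  ultimately show ?thesis using assms(1) by (simp add: divide_le_eq)
qed

lemma variation_bound:
  fixes r r' :: "real \<Rightarrow> real"
  assumes d: "\<And>x. (r has_real_derivative r' x) (at x)" and c: "continuous_on UNIV r'"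
    and "a \<le> x" "x \<le> b" "a \<le> y" "y \<le> b"
  shows "\<bar>r x - r y\<bar> \<le> integral {a..b} (\<lambda>x. \<bar>r' x\<bar>)"
proof -
  have c2: "continuous_on UNIV (\<lambda>x. \<bar>r' x\<bar>)" using c by (intro continuous_intros)
  have *: "\<bar>r z - r w\<bar> \<le> integral {a..b} (\<lambda>x. \<bar>r' x\<bar>)" if "a \<le> w" "w \<le> z" "z \<le> b" for w z
  proof -
    have "\<bar>r z - r w\<bar> = \<bar>integral {w..z} r'\<bar>" using integral_derivative[OF that(2) d] by simp
    also have "\<dots> \<le> integral {w..z} (\<lambda>x. \<bar>r' x\<bar>)"
      using integral_norm_bound_integral[OF integrable_cont[OF c] integrable_cont[OF c2], of w z] by simp
    also have "\<dots> \<le> integral {a..b} (\<lambda>x. \<bar>r' x\<bar>)"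
      by (rule integral_subset_le) (use that integrable_cont[OF c2] in auto)
    finally show ?thesis .
  qed
  show ?thesis using *[of x y] *[of y x] assms(3-) by (cases "x \<le> y") (auto simp: abs_minus_commute)
qed

locale upwind_scheme = stationary_data L b b' \<sigma> \<sigma>' \<sigma>''
  for L :: real and b b' \<sigma> \<sigma>' \<sigma>'' :: "real \<Rightarrow> real" +
  fixes q q' q'' :: "real \<Rightarrow> real" and J S :: real
  assumes q_per: "periodic_fun_simple q L" and q_pos: "\<And>x. q x > 0" and q_int: "integral {0..L} q = 1"
    and dq: "\<And>x. (q has_real_derivative q' x) (at x)" and dq': "\<And>x. (q' has_real_derivative q'' x) (at x)"
    and q''_cont: "continuous_on UNIV q''"
    and flux: "\<And>x. b x * q x - (\<sigma> x * \<sigma>' x * q x + (\<sigma> x)\<^sup>2 * q' x / 2) = J"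
    and S: "S > 0" "\<And>x. S \<le> (\<sigma> x)\<^sup>2"
begin

definition s :: "real \<Rightarrow> real" where "s x = b x - \<sigma> x * \<sigma>' x"

definition s' :: "real \<Rightarrow> real" where "s' x = b' x - (\<sigma>' x * \<sigma>' x + \<sigma> x * \<sigma>'' x)"

lemma s_eq: "upwind_velocity b \<sigma> x = s x"
  using DERIV_imp_deriv[OF d\<sigma>] by (simp add: upwind_velocity_def s_def)

lemma ds: "(s has_real_derivative s' x) (at x)"
  unfolding s_def[abs_def] s'_def by (auto intro!: derivative_eq_intros db d\<sigma> d\<sigma>')

lemma s_per: "periodic_fun_simple s L"
  using b_per \<sigma>_per periodic_derivative[OF \<sigma>_per d\<sigma>] by (simp add: s_def periodic_fun_simple_def)

lemma s'_cont: "continuous_on UNIV s'"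
  unfolding s'_def[abs_def] by (intro continuous_intros b'_cont \<sigma>'_cont \<sigma>_cont \<sigma>''_cont)

lemma q_cont: "continuous_on UNIV q" and q'_cont: "continuous_on UNIV q'" and s_cont: "continuous_on UNIV s"
  using dq dq' ds by (auto intro: continuous_of_derivative)

abbreviation h :: "nat \<Rightarrow> real" where "h N \<equiv> mesh L N"

lemma h_pos: "N > 0 \<Longrightarrow> h N > 0" and h_N: "N > 0 \<Longrightarrow> real N * h N = L"
  using L by (auto simp: mesh_def)

lemma up_rate_ge: "N > 0 \<Longrightarrow> S / (2 * (h N)\<^sup>2) \<le> up_rate L b \<sigma> N j"
  and down_rate_ge: "N > 0 \<Longrightarrow> S / (2 * (h N)\<^sup>2) \<le> down_rate L b \<sigma> N j"
  using h_pos[of N] S(2)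
  by (auto simp: up_rate_def down_rate_def intro!: add_increasing divide_right_mono)

lemma chain:
  assumes "N > 0"
  shows "cycle_chain N (up_rate L b \<sigma> N) (down_rate L b \<sigma> N)"
proof
  have "0 \<le> S / (2 * (h N)\<^sup>2)" using S(1) by simp
  then show "0 \<le> up_rate L b \<sigma> N j" "0 \<le> down_rate L b \<sigma> N j" for j
    using up_rate_ge[OF assms, of j] down_rate_ge[OF assms, of j] by linarith+
qed (rule assms)

abbreviation next_index :: "nat \<Rightarrow> nat \<Rightarrow> nat" where "next_index N j \<equiv> (j + 1) mod N"

text \<open>At the last index the successor is node 0 while \<open>node + h\<close> equals
  \<open>L\<close>; periodicity identifies the two. The offset \<open>y\<close> serves the half
  steps to cell interfaces.\<close>

lemma node_next:
  assumes "periodic_fun_simple g L" "j < N"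
  shows "g (node L N (next_index N j) + y) = g (node L N j + h N + y)"
proof -
  interpret periodic_fun_simple g L by fact
  show ?thesis
  proof (cases "j + 1 = N")
    case True
    then have "real j + 1 = real N" by (metis of_nat_1 of_nat_add)
    have "node L N j + h N = (real j + 1) * h N" by (simp add: node_def distrib_right)
    also have "\<dots> = L" unfolding \<open>real j + 1 = real N\<close> using h_N assms(2) by simp
    finally have "node L N j + h N = L" .
    then have "g (node L N j + h N + y) = g (y + L)" by (simp add: add.commute)
    then show ?thesis using True by (simp add: node_def plus_period)
  next
    case False
    then show ?thesis using assms(2) by (simp add: node_def algebra_simps)
  qed
qed

text \<open>The offset \<open>y\<close> covers cells starting at the nodes as well as cells centred
  at them.\<close>

lemma sum_cells:
  fixes g :: "real \<Rightarrow> real"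
  assumes g: "periodic_fun_simple g L" "continuous_on UNIV g" and N: "N > 0"
  shows "(\<Sum>j<N. integral {node L N j + y..node L N j + y + h N} g) = integral {0..L} g"
proof -
  obtain G where G: "\<And>x. (G has_real_derivative g x) (at x)" using antiderivative[OF g(2)] by metis
  have "(\<Sum>j<N. integral {node L N j + y..node L N j + y + h N} g) = (\<Sum>j<N. G (node L N (Suc j) + y) - G (node L N j + y))"
    using h_pos[OF N] by (intro sum.cong refl) (simp add: integral_derivative[OF _ G] node_def algebra_simps)
  also have "\<dots> = G (L + y) - G y"
    by (subst sum_lessThan_telescope) (simp add: node_def h_N[OF N])
  also have "\<dots> = integral {y..y + L} g" using integral_derivative[OF _ G, of y "y + L"] L by (simp add: add.commute)
  finally show ?thesis by (simp add: periodic_integral_shift[OF g(1) L g(2)])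
qed

section \<open>The numerical flux and its consistency\<close>

definition num_flux :: "nat \<Rightarrow> (nat \<Rightarrow> real) \<Rightarrow> nat \<Rightarrow> real" where
  "num_flux N u j = up_rate L b \<sigma> N j * u j - down_rate L b \<sigma> N (next_index N j) * u (next_index N j)"

definition midpoint :: "nat \<Rightarrow> nat \<Rightarrow> real" where "midpoint N j = node L N j + h N / 2"

text \<open>Both rates belonging to an edge contain \<sigma> at the same midpoint, so the diffusive
  part is exactly \<sigma>^2/2 times a difference quotient. Upwinding takes the positive and
  negative parts of \<open>s\<close> at the two ends of the edge instead of the midpoint, which
  costs h |r|. The reference values r and r' are left free so that the estimate serves samples of
  \<open>q\<close> and cell averages of \<rho> alike.\<close>

lemma flux_consistency:
  obtains K where "K > 0" "\<And>N j u r r'. N > 0 \<Longrightarrow> j < N \<Longrightarrow>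
    \<bar>h N * num_flux N u j - (s (midpoint N j) * r - (\<sigma> (midpoint N j))\<^sup>2 / 2 * r')\<bar>
      \<le> K * (\<bar>u j - r\<bar> + \<bar>u (next_index N j) - r\<bar> + h N * \<bar>r\<bar> + \<bar>(u (next_index N j) - u j) / h N - r'\<bar>)"
proof -
  obtain K1 where K1: "K1 > 0" "\<And>x. \<bar>s x\<bar> \<le> K1" using periodic_bounded[OF s_per L s_cont] by metis
  obtain K2 where K2: "K2 > 0" "\<And>x. \<bar>s' x\<bar> \<le> K2" using periodic_bounded[OF periodic_derivative[OF s_per ds] L s'_cont] by metis
  have "periodic_fun_simple (\<lambda>x. (\<sigma> x)\<^sup>2) L" using \<sigma>_per by (simp add: periodic_fun_simple_def)
  moreover have "continuous_on UNIV (\<lambda>x. (\<sigma> x)\<^sup>2)" by (intro continuous_intros \<sigma>_cont)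
  ultimately obtain K3 where K3: "K3 > 0" "\<And>x. \<bar>(\<sigma> x)\<^sup>2\<bar> \<le> K3" using periodic_bounded L by metis
  define K where "K = max K1 (max K2 K3)"
  have lip: "\<bar>s x - s y\<bar> \<le> K2 * \<bar>x - y\<bar>" for x y
    using field_differentiable_bound[of UNIV s s' K2 x y] ds K2 by auto
  show ?thesis
  proof (rule that[of K])
    show "K > 0" using K1 by (simp add: K_def)
    fix N j :: nat and u :: "nat \<Rightarrow> real" and r r' :: real
    assume N: "N > 0" and j: "j < N"
    define x m k where "x = node L N j" and "m = midpoint N j" and "k = h N"
    have k: "k > 0" using h_pos[OF N] by (simp add: k_def)
    have m: "m = x + k / 2" by (simp add: m_def x_def k_def midpoint_def)
    define a c where "a = u j" and "c = u (next_index N j)"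
    have up: "up_rate L b \<sigma> N j = max (s x) 0 / k + (\<sigma> m)\<^sup>2 / (2 * k\<^sup>2)"
      by (simp add: up_rate_def s_eq x_def k_def m)
    have down: "down_rate L b \<sigma> N (next_index N j) = max (- s (x + k)) 0 / k + (\<sigma> m)\<^sup>2 / (2 * k\<^sup>2)"
    proof -
      have 1: "s (node L N (next_index N j)) = s (x + k)"
        using node_next[OF s_per j, of 0] by (simp add: x_def k_def)
      have "x + k + - (k / 2) = m" by (simp add: m)
      then have 2: "\<sigma> (node L N (next_index N j) - k / 2) = \<sigma> m"
        using node_next[OF \<sigma>_per j, of "- (k / 2)"] unfolding x_def[symmetric] k_def[symmetric] by simp
      show ?thesis unfolding down_rate_def s_eq k_def[symmetric] 1 2 ..
    qed
    have tri: "\<bar>(a1 + a2) - (b1 + b2) - c1\<bar> \<le> (\<bar>a1\<bar> + \<bar>a2\<bar>) + (\<bar>b1\<bar> + \<bar>b2\<bar>) + \<bar>c1\<bar>" for a1 a2 b1 b2 c1 :: real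
      by linarith
    have "k * num_flux N u j = max (s x) 0 * a - max (- s (x + k)) 0 * c - (\<sigma> m)\<^sup>2 / 2 * ((c - a) / k)"
    proof -
      have "k * ((A / k + B / (2 * k\<^sup>2)) * a - (C / k + B / (2 * k\<^sup>2)) * c) = A * a - C * c - B / 2 * ((c - a) / k)" for A B C
        using k by (simp add: field_simps power2_eq_square)
      then show ?thesis unfolding num_flux_def up down a_def[symmetric] c_def[symmetric] .
    qed
    moreover have "s m * r = max (s m) 0 * r - max (- s m) 0 * r" by (simp add: max_def)
    moreover have "P * a - Q * c - B * D - ((P' * r - Q' * r) - B * r')
      = (P * (a - r) + (P - P') * r) - (Q * (c - r) + (Q - Q') * r) - B * (D - r')" for P P' Q Q' B D
      by (simp add: algebra_simps)
    ultimately have E: "k * num_flux N u j - (s m * r - (\<sigma> m)\<^sup>2 / 2 * r')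
       = (max (s x) 0 * (a - r) + (max (s x) 0 - max (s m) 0) * r)
         - (max (- s (x + k)) 0 * (c - r) + (max (- s (x + k)) 0 - max (- s m) 0) * r)
         - (\<sigma> m)\<^sup>2 / 2 * ((c - a) / k - r')"
      by (simp only:)
    have "\<bar>k * num_flux N u j - (s m * r - (\<sigma> m)\<^sup>2 / 2 * r')\<bar> \<le> (\<bar>max (s x) 0 * (a - r)\<bar> + \<bar>(max (s x) 0 - max (s m) 0) * r\<bar>)
       + (\<bar>max (- s (x + k)) 0 * (c - r)\<bar> + \<bar>(max (- s (x + k)) 0 - max (- s m) 0) * r\<bar>)
       + \<bar>(\<sigma> m)\<^sup>2 / 2 * ((c - a) / k - r')\<bar>" unfolding E by (rule tri)
    also have "\<dots> \<le> (K * \<bar>a - r\<bar> + K * k / 2 * \<bar>r\<bar>) + (K * \<bar>c - r\<bar> + K * k / 2 * \<bar>r\<bar>) + K * \<bar>(c - a) / k - r'\<bar>"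
    proof -
      have 1: "\<bar>max (s x) 0\<bar> \<le> K" "\<bar>max (- s (x + k)) 0\<bar> \<le> K"
        using K1(2)[of x] K1(2)[of "x + k"] K1(1) by (auto simp: K_def)
      have 2: "\<bar>max (s x) 0 - max (s m) 0\<bar> \<le> K * k / 2" "\<bar>max (- s (x + k)) 0 - max (- s m) 0\<bar> \<le> K * k / 2"
      proof -
        have "\<bar>s x - s m\<bar> \<le> K2 * (k / 2)" using lip[of x m] k by (simp add: m)
        moreover have "\<bar>s (x + k) - s m\<bar> \<le> K2 * (k / 2)" using lip[of "x + k" m] k by (simp add: m)
        moreover have "K2 * (k / 2) \<le> K * (k / 2)" using k by (intro mult_right_mono) (auto simp: K_def)
        moreover have mx: "\<bar>max a 0 - max b 0\<bar> \<le> \<bar>a - b\<bar>" for a b :: real by (simp add: max_def)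
        have "\<bar>max (s x) 0 - max (s m) 0\<bar> \<le> \<bar>s x - s m\<bar>"
          "\<bar>max (- s (x + k)) 0 - max (- s m) 0\<bar> \<le> \<bar>s (x + k) - s m\<bar>"
          using mx[of "s x" "s m"] mx[of "- s (x + k)" "- s m"] by (simp_all add: abs_minus_commute)
        ultimately show "\<bar>max (s x) 0 - max (s m) 0\<bar> \<le> K * k / 2" "\<bar>max (- s (x + k)) 0 - max (- s m) 0\<bar> \<le> K * k / 2"
          by simp_all
      qed
      have 3: "\<bar>(\<sigma> m)\<^sup>2 / 2\<bar> \<le> K" using K3(2)[of m] K3(1) by (auto simp: K_def)
      show ?thesis unfolding abs_mult by (intro add_mono mult_right_mono 1 2 3) auto
    qed
    also have "\<dots> = K * (\<bar>a - r\<bar> + \<bar>c - r\<bar> + k * \<bar>r\<bar> + \<bar>(c - a) / k - r'\<bar>)" by (simp add: algebra_simps)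
    finally show "\<bar>h N * num_flux N u j - (s (midpoint N j) * r - (\<sigma> (midpoint N j))\<^sup>2 / 2 * r')\<bar>
      \<le> K * (\<bar>u j - r\<bar> + \<bar>u (next_index N j) - r\<bar> + h N * \<bar>r\<bar> + \<bar>(u (next_index N j) - u j) / h N - r'\<bar>)"
      by (simp add: m_def a_def c_def k_def)
  qed
qed

lemma exact_flux: "s x * q x - (\<sigma> x)\<^sup>2 / 2 * q' x = J"
  using flux[of x] by (simp add: s_def algebra_simps)

text \<open>The weights h q (x_j) have mass 1 + O(h), flux J + O(h) and conductances of order 1/h,
  so \<open>stationary_ratio_near_1\<close> applies with \<eta> of order h. The lower bound on
  \<open>p\<close> in the conclusion is what the energy estimate for the evolution needs.\<close>

lemma discrete_stationary_estimate:
  obtains C h0 where "C > 0" "h0 > 0" "\<And>N p j. N > 0 \<Longrightarrow> h N < h0 \<Longrightarrow> upwind_stationary L b \<sigma> N p \<Longrightarrow> j < N \<Longrightarrow>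
    \<bar>p j / h N - q (node L N j)\<bar> \<le> C * h N \<and> h N * q (node L N j) / 2 \<le> p j"
proof -
  obtain K where K: "K > 0" "\<And>N j u r r'. N > 0 \<Longrightarrow> j < N \<Longrightarrow>
    \<bar>h N * num_flux N u j - (s (midpoint N j) * r - (\<sigma> (midpoint N j))\<^sup>2 / 2 * r')\<bar>
      \<le> K * (\<bar>u j - r\<bar> + \<bar>u (next_index N j) - r\<bar> + h N * \<bar>r\<bar> + \<bar>(u (next_index N j) - u j) / h N - r'\<bar>)"
    by (rule flux_consistency, rule that, assumption, blast)
  obtain K1 where K1: "K1 > 0" "\<And>x. \<bar>q x\<bar> \<le> K1" using periodic_bounded[OF q_per L q_cont] by metis
  have q'_per: "periodic_fun_simple q' L" by (rule periodic_derivative[OF q_per dq])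
  obtain K2 where K2: "K2 > 0" "\<And>x. \<bar>q' x\<bar> \<le> K2" using periodic_bounded[OF q'_per L q'_cont] by metis
  obtain K3 where K3: "K3 > 0" "\<And>x. \<bar>q'' x\<bar> \<le> K3"
    using periodic_bounded[OF periodic_derivative[OF q'_per dq'] L q''_cont] by metis
  obtain q0 where q0: "q0 > 0" "\<And>x. q0 \<le> q x" using periodic_bounded_below[OF q_per L q_cont q_pos] by metis
  have lip: "\<bar>q x - q y\<bar> \<le> K2 * \<bar>x - y\<bar>" "\<bar>q' x - q' y\<bar> \<le> K3 * \<bar>x - y\<bar>" for x y
    using field_differentiable_bound[of UNIV q q' K2 x y] field_differentiable_bound[of UNIV q' q'' K3 x y]
      dq dq' K2 K3 by auto
  define c where "c = K * (2 * K2 + K1 + K3)"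
  have c: "c > 0" using K K1 K2 K3 by (simp add: c_def)
  \<comment> \<open>The two entries cover the two contributions to \<eta>: the oscillation of the
    ratio and the quadrature error in the mass of \<open>qh\<close>.\<close>
  define c' where "c' = max (2 * c * L / (S * q0)) (L * K2)"
  have c': "c' > 0" using c L S q0 by (simp add: c'_def less_max_iff_disj)
  show ?thesis
  \<comment> \<open>This threshold gives \<eta> <= 1/8, so the ratio differs from 1 by at most 1/2
    and the lower bound on \<open>p\<close> follows.\<close>
  proof (rule that[of "4 * c' * K1" "1 / (8 * c')"])
    show "4 * c' * K1 > 0" "1 / (8 * c') > 0" using c' K1 by auto
    fix N j :: nat and p :: "nat \<Rightarrow> real"
    assume N: "N > 0" and small: "h N < 1 / (8 * c')" and p: "upwind_stationary L b \<sigma> N p" and j: "j < N"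
    define k where "k = h N"
    have k: "k > 0" using h_pos[OF N] by (simp add: k_def)
    define x where "x i = node L N i" for i
    define qh where "qh i = k * q (x i)" for i
    interpret cycle_chain N "up_rate L b \<sigma> N" "down_rate L b \<sigma> N" by (rule chain[OF N])
    have nxt: "nxt i = next_index N i" for i by (simp add: nxt_def)
    have flx: "flux qh i = k * num_flux N (\<lambda>i. q (x i)) i" for i
      by (simp add: flux_def num_flux_def nxt qh_def algebra_simps)
    have qn: "q (x (next_index N i)) = q (x i + k)" if "i < N" for i
      using node_next[OF q_per that, of 0] by (simp add: x_def k_def)
    have fe: "\<bar>flux qh i - J\<bar> \<le> c * k" if i: "i < N" for i
    proof -
      define m where "m = midpoint N i"
      have m: "m = x i + k / 2" by (simp add: m_def midpoint_def x_def k_def)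
      have "\<bar>flux qh i - J\<bar> \<le> K * (\<bar>q (x i) - q m\<bar> + \<bar>q (x i + k) - q m\<bar> + k * \<bar>q m\<bar> + \<bar>(q (x i + k) - q (x i)) / k - q' m\<bar>)"
        using K(2)[OF N i, of "\<lambda>i. q (x i)" "q m" "q' m", folded m_def, unfolded exact_flux] qn[OF i] by (simp add: flx k_def[symmetric] m_def[symmetric])
      also have "\<dots> \<le> K * (K2 * k + K2 * k + k * K1 + K3 * k)"
      proof (intro mult_left_mono add_mono)
        show "\<bar>q (x i) - q m\<bar> \<le> K2 * k"
          using order_trans[OF lip(1)[of "x i" m], of "K2 * k"] k K2(1) by (simp add: m)
        show "\<bar>q (x i + k) - q m\<bar> \<le> K2 * k"
          using order_trans[OF lip(1)[of "x i + k" m], of "K2 * k"] k K2(1) by (simp add: m)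
        obtain z where z: "x i < z" "z < x i + k" "q (x i + k) - q (x i) = (x i + k - x i) * q' z"
          using MVT2[of "x i" "x i + k" q q'] k dq by auto
        have "\<bar>q' z - q' m\<bar> \<le> K3 * \<bar>z - m\<bar>" by (rule lip)
        also have "\<dots> \<le> K3 * k" using z K3(1) by (intro mult_left_mono) (auto simp: m abs_le_iff)
        finally show "\<bar>(q (x i + k) - q (x i)) / k - q' m\<bar> \<le> K3 * k" using z k by simp
      qed (use K K1 k in auto)
      also have "\<dots> = c * k" by (simp add: c_def algebra_simps)
      finally show ?thesis .
    qed
    define A where "A = S * q0 / (2 * k)"
    have A: "A > 0" using S q0 k by (simp add: A_def)
    have rate: "A \<le> (up_rate L b \<sigma> N i * qh i + down_rate L b \<sigma> N (nxt i) * qh (nxt i)) / 2" for i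
    proof -
      have SA: "S / (2 * k\<^sup>2) * (k * q0) = A" using k by (simp add: A_def power2_eq_square)
      have g: "A \<le> r * qh i" if "S / (2 * k\<^sup>2) \<le> r" for r i
      proof -
        have "0 \<le> S / (2 * k\<^sup>2)" using S by simp
        then have "0 \<le> r" using that by linarith
        moreover have "k * q0 \<le> qh i" unfolding qh_def using k by (intro mult_left_mono q0) auto
        ultimately show ?thesis unfolding SA[symmetric] using k q0 S that by (intro mult_mono) auto
      qed
      show ?thesis
        using g[OF up_rate_ge[OF N, of i, folded k_def], of i] g[OF down_rate_ge[OF N, of "nxt i", folded k_def], of "nxt i"]
        by simp
    qed
    have ps: "gen p i = 0" "0 \<le> p i" if "i < N" for i
      using p that by (auto simp: upwind_stationary_def upwind_op_def gen_def nxt_def prv_def)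
    have p1: "(\<Sum>i<N. p i) = 1" using p by (simp add: upwind_stationary_def)
    have \<eta>1: "real N * (c * k) / A \<le> c' * k"
    proof -
      have "real N * (c * k) / A = (2 * c * (real N * k) / (S * q0)) * k" using k S q0 by (simp add: A_def field_simps)
      also have "\<dots> = (2 * c * L / (S * q0)) * k" using h_N[OF N] by (simp add: k_def)
      also have "\<dots> \<le> c' * k" using k by (intro mult_right_mono) (auto simp: c'_def)
      finally show ?thesis .
    qed
    have \<eta>2: "\<bar>(\<Sum>i<N. qh i) - 1\<bar> \<le> c' * k"
    proof -
      have "1 = (\<Sum>i<N. integral {x i..x i + k} q)"
        using sum_cells[OF q_per q_cont N, of 0] by (simp add: q_int x_def k_def)
      then have "\<bar>(\<Sum>i<N. qh i) - 1\<bar> = \<bar>\<Sum>i<N. qh i - integral {x i..x i + k} q\<bar>" by (simp add: sum_subtractf)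
      also have "\<dots> \<le> (\<Sum>i<N. \<bar>qh i - integral {x i..x i + k} q\<bar>)" by (rule sum_abs)
      also have "\<dots> \<le> (\<Sum>i<N. K2 * k * k)"
      proof (rule sum_mono)
        fix i
        have "\<bar>integral {x i..x i + k} q / (x i + k - x i) - q (x i)\<bar> \<le> K2 * k"
        proof (rule average_bound)
          fix y assume "x i \<le> y" "y \<le> x i + k"
          then show "\<bar>q y - q (x i)\<bar> \<le> K2 * k"
            using order_trans[OF lip(1)[of y "x i"], of "K2 * k"] K2(1) by simp
        qed (use k q_cont in auto)
        then show "\<bar>qh i - integral {x i..x i + k} q\<bar> \<le> K2 * k * k"
          using k by (simp add: qh_def abs_le_iff field_simps)
      qed
      also have "\<dots> = (L * K2) * k" using h_N[OF N] by (simp add: k_def mult_ac)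
      also have "\<dots> \<le> c' * k" using k by (intro mult_right_mono) (auto simp: c'_def)
      finally show ?thesis .
    qed
    have \<eta>3: "c' * k \<le> 1 / 8" using small c' k by (simp add: k_def field_simps)
    have qh_pos: "qh i > 0" for i using k q_pos by (simp add: qh_def)
    have main: "\<bar>p j / qh j - 1\<bar> \<le> 4 * (c' * k)"
      by (rule stationary_ratio_near_1[OF ps p1 qh_pos A rate fe \<eta>1 \<eta>2 _ j]) (use \<eta>3 in auto)
    have "\<bar>p j / k - q (x j)\<bar> = \<bar>p j / qh j - 1\<bar> * q (x j)"
    proof -
      have "p j / k - q (x j) = (p j / qh j - 1) * q (x j)" using k q_pos[of "x j"] by (simp add: qh_def field_simps)
      then show ?thesis using q_pos[of "x j"] by (simp add: abs_mult)
    qed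
    also have "\<dots> \<le> 4 * (c' * k) * K1" using K1(2)[of "x j"] K1(1) c' k q_pos[of "x j"] by (intro mult_mono main) auto
    finally have "\<bar>p j / k - q (x j)\<bar> \<le> 4 * c' * K1 * k" by (simp add: mult_ac)
    moreover have "k * q (x j) / 2 \<le> p j"
    proof -
      have "1 / 2 \<le> p j / qh j" using main \<eta>3 by linarith
      then show ?thesis using qh_pos[of j] by (simp add: le_divide_eq qh_def)
    qed
    ultimately show "\<bar>p j / h N - q (node L N j)\<bar> \<le> 4 * c' * K1 * h N \<and> h N * q (node L N j) / 2 \<le> p j"
      by (simp add: k_def x_def)
  qed
qed

text \<open>The scheme is compared with cell averages of the exact solution: they solve a difference equation
  in flux form exactly, so that only second derivatives of the solution enter the consistency error.\<close>

definition cell_avg :: "nat \<Rightarrow> (real \<Rightarrow> real) \<Rightarrow> nat \<Rightarrow> real" where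
  "cell_avg N r j = integral {- (h N / 2)..h N / 2} (\<lambda>y. r (node L N j + y)) / h N"

lemma translate_cont:
  "continuous_on UNIV r \<Longrightarrow> continuous_on UNIV (\<lambda>y. r (c + y))" for r :: "real \<Rightarrow> real"
  by (rule continuous_on_compose2[of UNIV r]) (auto intro!: continuous_intros)

lemma cell_avg_bound:
  assumes "N > 0" "continuous_on UNIV r" "\<And>y. \<bar>y\<bar> \<le> h N / 2 \<Longrightarrow> \<bar>r (node L N j + y) - v\<bar> \<le> I"
  shows "\<bar>cell_avg N r j - v\<bar> \<le> I"
proof -
  have "\<bar>integral {- (h N / 2)..h N / 2} (\<lambda>y. r (node L N j + y)) / (h N / 2 - - (h N / 2)) - v\<bar> \<le> I"
    by (rule average_bound[OF _ translate_cont[OF assms(2)]]) (use h_pos[OF assms(1)] assms(3) in auto)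
  then show ?thesis by (simp add: cell_avg_def)
qed

lemma cell_avg_next:
  assumes "periodic_fun_simple r L" "j < N"
  shows "cell_avg N r (next_index N j) = integral {- (h N / 2)..h N / 2} (\<lambda>y. r (node L N j + h N + y)) / h N"
  by (simp only: cell_avg_def node_next[OF assms])

text \<open>On a cell the function deviates from its value at the node by at most the integral of
  |r'| over that cell. The cells tile the circle, and Cauchy-Schwarz reduces the total to the L^2
  norm of one derivative.\<close>

lemma cell_avg_node_dist:
  assumes N: "N > 0" and per: "periodic_fun_simple r L" and d: "\<And>x. (r has_real_derivative r' x) (at x)"
    and c: "continuous_on UNIV r'"
  shows "(\<Sum>j<N. h N * \<bar>r (node L N j) - cell_avg N r j\<bar>) \<le> h N * sqrt (L * integral {0..L} (\<lambda>x. (r' x)\<^sup>2))"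
proof -
  define k where "k = h N"
  have k: "k > 0" using h_pos[OF N] by (simp add: k_def)
  have rc: "continuous_on UNIV r" using d by (rule continuous_of_derivative)
  have ac: "continuous_on UNIV (\<lambda>x. \<bar>r' x\<bar>)" using c by (intro continuous_intros)
  have ap: "periodic_fun_simple (\<lambda>x. \<bar>r' x\<bar>) L"
    using periodic_derivative[OF per d] by (simp add: periodic_fun_simple_def)
  have "\<bar>r (node L N j) - cell_avg N r j\<bar> \<le> integral {node L N j + (- (k / 2))..node L N j + (- (k / 2)) + k} (\<lambda>x. \<bar>r' x\<bar>)" for j
  proof -
    have "\<bar>cell_avg N r j - r (node L N j)\<bar> \<le> integral {node L N j + (- (k / 2))..node L N j + (- (k / 2)) + k} (\<lambda>x. \<bar>r' x\<bar>)"
    proof (rule cell_avg_bound[OF N rc])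
      fix y assume "\<bar>y\<bar> \<le> h N / 2"
      then show "\<bar>r (node L N j + y) - r (node L N j)\<bar> \<le> integral {node L N j + (- (k / 2))..node L N j + (- (k / 2)) + k} (\<lambda>x. \<bar>r' x\<bar>)"
        using k by (intro variation_bound[OF d c]) (auto simp: k_def[symmetric] abs_le_iff)
    qed
    then show ?thesis by (simp add: abs_minus_commute)
  qed
  then have "(\<Sum>j<N. k * \<bar>r (node L N j) - cell_avg N r j\<bar>)
     \<le> (\<Sum>j<N. k * integral {node L N j + (- (k / 2))..node L N j + (- (k / 2)) + k} (\<lambda>x. \<bar>r' x\<bar>))"
    using k by (intro sum_mono mult_left_mono) auto
  also have "\<dots> = k * integral {0..L} (\<lambda>x. \<bar>r' x\<bar>)"
    unfolding sum_distrib_left[symmetric] k_def by (simp only: sum_cells[OF ap ac N])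
  also have "\<dots> \<le> k * sqrt (L * integral {0..L} (\<lambda>x. (r' x)\<^sup>2))"
    using integral_abs_Cauchy_Schwarz[OF c, of 0 L] L k by (intro mult_left_mono real_le_rsqrt) auto
  finally show ?thesis by (simp add: k_def)
qed

text \<open>The flux between two cells sees only their union, a window of length 2h, and each
  deviation is at most the integral of |r'| or |r''| over this window. Cauchy-Schwarz turns the
  square into 2h times an integral of squares, and the windows cover the circle twice. The powers of
  h then cancel the factor 1/h in the flux, with only L^2 control of the second derivative.\<close>

lemma averaged_flux_error:
  obtains C where "C > 0" "\<And>N r r' r'' R. N > 0 \<Longrightarrow> periodic_fun_simple r L \<Longrightarrow>
    (\<And>x. (r has_real_derivative r' x) (at x)) \<Longrightarrow> (\<And>x. (r' has_real_derivative r'' x) (at x)) \<Longrightarrow>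
    continuous_on UNIV r'' \<Longrightarrow> (\<And>x. \<bar>r x\<bar> \<le> R) \<Longrightarrow>
    h N * (\<Sum>j<N. (num_flux N (cell_avg N r) j
       - (s (midpoint N j) * r (midpoint N j) - (\<sigma> (midpoint N j))\<^sup>2 / 2 * r' (midpoint N j)) / h N)\<^sup>2)
    \<le> C * (R\<^sup>2 + integral {0..L} (\<lambda>x. (r' x)\<^sup>2) + integral {0..L} (\<lambda>x. (r'' x)\<^sup>2))"
proof -
  obtain K where K: "K > 0" "\<And>N j u r r'. N > 0 \<Longrightarrow> j < N \<Longrightarrow>
    \<bar>h N * num_flux N u j - (s (midpoint N j) * r - (\<sigma> (midpoint N j))\<^sup>2 / 2 * r')\<bar>
      \<le> K * (\<bar>u j - r\<bar> + \<bar>u (next_index N j) - r\<bar> + h N * \<bar>r\<bar> + \<bar>(u (next_index N j) - u j) / h N - r'\<bar>)"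
    by (rule flux_consistency, rule that, assumption, blast)
  show ?thesis
  proof (rule that[of "3 * K\<^sup>2 * (16 + L)"])
    show "3 * K\<^sup>2 * (16 + L) > 0" using K L by simp
    fix N :: nat and r r' r'' :: "real \<Rightarrow> real" and R :: real
    assume N: "N > 0" and per: "periodic_fun_simple r L"
      and d: "\<And>x. (r has_real_derivative r' x) (at x)" and d': "\<And>x. (r' has_real_derivative r'' x) (at x)"
      and c'': "continuous_on UNIV r''" and R: "\<And>x. \<bar>r x\<bar> \<le> R"
    define k where "k = h N"
    have k: "k > 0" using h_pos[OF N] by (simp add: k_def)
    have kN: "real N * k = L" using h_N[OF N] by (simp add: k_def)
    have rc: "continuous_on UNIV r" and c': "continuous_on UNIV r'" using d d' by (auto intro: continuous_of_derivative)
    have per': "periodic_fun_simple r' L" by (rule periodic_derivative[OF per d])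
    have per'': "periodic_fun_simple r'' L" by (rule periodic_derivative[OF per' d'])
    define x where "x j = node L N j" for j
    define a where "a j = x j - k / 2" for j
    define W where "W g j = integral {a j..a j + 2 * k} (\<lambda>x. \<bar>g x\<bar>)" for g :: "real \<Rightarrow> real" and j
    define V where "V g j = integral {a j..a j + 2 * k} (\<lambda>x. (g x)\<^sup>2)" for g :: "real \<Rightarrow> real" and j
    define e where "e j = num_flux N (cell_avg N r) j
       - (s (midpoint N j) * r (midpoint N j) - (\<sigma> (midpoint N j))\<^sup>2 / 2 * r' (midpoint N j)) / k" for j
    have W2: "(W g j)\<^sup>2 \<le> 2 * k * V g j" if "continuous_on UNIV g" for g j
      using integral_abs_Cauchy_Schwarz[OF that, of "a j" "a j + 2 * k"] k by (simp add: W_def V_def)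
    have V_sum: "(\<Sum>j<N. V g j) = 2 * integral {0..L} (\<lambda>x. (g x)\<^sup>2)"
      if "periodic_fun_simple g L" "continuous_on UNIV g" for g
    proof -
      have g2: "periodic_fun_simple (\<lambda>x. (g x)\<^sup>2) L" "continuous_on UNIV (\<lambda>x. (g x)\<^sup>2)"
        using that by (auto simp: periodic_fun_simple_def intro!: continuous_intros)
      have "V g j = integral {x j + (- (k / 2))..x j + (- (k / 2)) + k} (\<lambda>x. (g x)\<^sup>2)
         + integral {x j + k / 2..x j + k / 2 + k} (\<lambda>x. (g x)\<^sup>2)" for j
      proof -
        have e1: "a j = x j + (- (k / 2))" by (simp add: a_def)
        have e2: "x j + k / 2 = x j + (- (k / 2)) + k" by simp
        have e3: "x j + k / 2 + k = a j + 2 * k" by (simp add: a_def)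
        show ?thesis
          unfolding V_def e3 unfolding e2 unfolding e1
          by (rule Henstock_Kurzweil_Integration.integral_combine[symmetric]) (use k integrable_cont[OF g2(2)] in auto)
      qed
      then have "(\<Sum>j<N. V g j) = (\<Sum>j<N. integral {x j + (- (k / 2))..x j + (- (k / 2)) + k} (\<lambda>x. (g x)\<^sup>2))
         + (\<Sum>j<N. integral {x j + k / 2..x j + k / 2 + k} (\<lambda>x. (g x)\<^sup>2))"
        by (simp add: sum.distrib)
      then show ?thesis unfolding x_def k_def by (simp only: sum_cells[OF g2 N])
    qed
    have R0: "0 \<le> R" using R[of 0] by linarith
    have ke: "(k * e j)\<^sup>2 \<le> 3 * K\<^sup>2 * (8 * k * V r' j + k\<^sup>2 * R\<^sup>2 + 2 * k * V r'' j)" if j: "j < N" for j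
    proof -
      define m where "m = midpoint N j"
      have m: "m = x j + k / 2" by (simp add: m_def midpoint_def x_def k_def)
      have in_win: "a j \<le> x j + y" "x j + y \<le> a j + 2 * k" "a j \<le> x j + k + y" "x j + k + y \<le> a j + 2 * k"
        if "\<bar>y\<bar> \<le> k / 2" for y using that k by (auto simp: a_def abs_le_iff)
      have m_win: "a j \<le> m" "m \<le> a j + 2 * k" using k by (auto simp: a_def m)
      have 1: "\<bar>cell_avg N r j - r m\<bar> \<le> W r' j"
        unfolding W_def
        by (rule cell_avg_bound[OF N rc], rule variation_bound[OF d c'])
          (use in_win m_win in \<open>auto simp: x_def[symmetric] k_def[symmetric]\<close>)
      have 2: "\<bar>cell_avg N r (next_index N j) - r m\<bar> \<le> W r' j"
      proof -
        have "\<bar>integral {- (k / 2)..k / 2} (\<lambda>y. r (x j + k + y)) / (k / 2 - - (k / 2)) - r m\<bar> \<le> W r' j"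
          unfolding W_def
          by (rule average_bound[OF _ translate_cont[OF rc]], use k in simp, rule variation_bound[OF d c'])
            (use in_win m_win in \<open>auto simp: abs_le_iff\<close>)
        then show ?thesis unfolding cell_avg_next[OF per j] by (simp add: x_def k_def)
      qed
      have 3: "\<bar>(cell_avg N r (next_index N j) - cell_avg N r j) / k - r' m\<bar> \<le> W r'' j"
      proof -
        define g where "g y = (r (x j + k + y) - r (x j + y)) / k" for y
        have gc: "continuous_on UNIV g" unfolding g_def[abs_def]
          by (intro continuous_intros translate_cont rc) (use k in auto)
        have "\<bar>integral {- (k / 2)..k / 2} g / (k / 2 - - (k / 2)) - r' m\<bar> \<le> W r'' j"
        proof (rule average_bound[OF _ gc])
          fix y assume y: "- (k / 2) \<le> y" "y \<le> k / 2"
          obtain z where z: "x j + y < z" "z < x j + y + k" "r (x j + y + k) - r (x j + y) = (x j + y + k - (x j + y)) * r' z"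
            using MVT2[of "x j + y" "x j + y + k" r r'] k d by auto
          have "g y = r' z" using z(3) k by (simp add: g_def add_ac)
          moreover have "\<bar>r' z - r' m\<bar> \<le> W r'' j"
            unfolding W_def by (rule variation_bound[OF d' c'']) (use z y m_win k in \<open>auto simp: a_def\<close>)
          ultimately show "\<bar>g y - r' m\<bar> \<le> W r'' j" by simp
        qed (use k in simp)
        moreover have "integral {- (k / 2)..k / 2} g = cell_avg N r (next_index N j) - cell_avg N r j"
        proof -
          have "integral {- (k / 2)..k / 2} g = integral {- (k / 2)..k / 2} (\<lambda>y. r (x j + k + y) - r (x j + y)) / k"
            unfolding g_def[abs_def] by (rule integral_divide)
          also have "integral {- (k / 2)..k / 2} (\<lambda>y. r (x j + k + y) - r (x j + y))
            = integral {- (k / 2)..k / 2} (\<lambda>y. r (x j + k + y)) - integral {- (k / 2)..k / 2} (\<lambda>y. r (x j + y))"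
            by (intro integral_diff integrable_cont translate_cont rc)
          finally show ?thesis unfolding cell_avg_next[OF per j] unfolding cell_avg_def
            by (simp add: x_def k_def diff_divide_distrib)
        qed
        ultimately show ?thesis by simp
      qed
      have "k * e j = k * num_flux N (cell_avg N r) j - (s m * r m - (\<sigma> m)\<^sup>2 / 2 * r' m)"
      proof -
        have "k * (A - B / k) = k * A - B" for A B using k by (simp add: field_simps)
        then show ?thesis unfolding e_def m_def[symmetric] .
      qed
      then have "\<bar>k * e j\<bar> \<le> K * (\<bar>cell_avg N r j - r m\<bar> + \<bar>cell_avg N r (next_index N j) - r m\<bar> + k * \<bar>r m\<bar>
          + \<bar>(cell_avg N r (next_index N j) - cell_avg N r j) / k - r' m\<bar>)"
        using K(2)[OF N j, of "cell_avg N r" "r m" "r' m"] by (simp add: m_def k_def)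
      also have "\<dots> \<le> K * (W r' j + W r' j + k * R + W r'' j)"
        using K k by (intro mult_left_mono add_mono 1 2 3 R) auto
      finally have "(k * e j)\<^sup>2 \<le> (K * (2 * W r' j + k * R + W r'' j))\<^sup>2"
        by (intro abs_le_square_iff[THEN iffD1]) simp
      also have "\<dots> \<le> K\<^sup>2 * (3 * (4 * (W r' j)\<^sup>2 + k\<^sup>2 * R\<^sup>2 + (W r'' j)\<^sup>2))"
      proof -
        have "(p1 + p2 + p3)\<^sup>2 \<le> 3 * (p1\<^sup>2 + p2\<^sup>2 + p3\<^sup>2)" for p1 p2 p3 :: real
          using zero_le_power2[of "p1 - p2"] zero_le_power2[of "p1 - p3"] zero_le_power2[of "p2 - p3"]
          by (simp add: power2_eq_square algebra_simps)
        from this[of "2 * W r' j" "k * R" "W r'' j"]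
        show ?thesis unfolding power_mult_distrib by (intro mult_left_mono) (auto simp: power_mult_distrib)
      qed
      also have "\<dots> \<le> K\<^sup>2 * (3 * (4 * (2 * k * V r' j) + k\<^sup>2 * R\<^sup>2 + 2 * k * V r'' j))"
        by (intro mult_left_mono add_mono W2 c' c'') auto
      also have "\<dots> = 3 * K\<^sup>2 * (8 * k * V r' j + k\<^sup>2 * R\<^sup>2 + 2 * k * V r'' j)" by simp
      finally show ?thesis .
    qed
    have "k * (k * (\<Sum>j<N. (e j)\<^sup>2)) = (\<Sum>j<N. (k * e j)\<^sup>2)"
      by (simp add: sum_distrib_left power2_eq_square mult_ac)
    also have "\<dots> \<le> (\<Sum>j<N. 3 * K\<^sup>2 * (8 * k * V r' j + k\<^sup>2 * R\<^sup>2 + 2 * k * V r'' j))"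
      by (intro sum_mono ke) simp
    also have "\<dots> = 3 * K\<^sup>2 * (8 * k * (\<Sum>j<N. V r' j) + real N * (k\<^sup>2 * R\<^sup>2) + 2 * k * (\<Sum>j<N. V r'' j))"
      by (simp add: sum_distrib_left[symmetric] sum.distrib)
    also have "\<dots> = k * (3 * K\<^sup>2 * (16 * integral {0..L} (\<lambda>x. (r' x)\<^sup>2) + L * R\<^sup>2 + 4 * integral {0..L} (\<lambda>x. (r'' x)\<^sup>2)))"
      unfolding V_sum[OF per' c'] V_sum[OF per'' c''] kN[symmetric] by (simp add: power2_eq_square algebra_simps)
    finally have "k * (\<Sum>j<N. (e j)\<^sup>2) \<le> 3 * K\<^sup>2 * (16 * integral {0..L} (\<lambda>x. (r' x)\<^sup>2) + L * R\<^sup>2 + 4 * integral {0..L} (\<lambda>x. (r'' x)\<^sup>2))"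
      using k by (simp add: mult_le_cancel_left_pos)
    also have "\<dots> \<le> 3 * K\<^sup>2 * ((16 + L) * (R\<^sup>2 + integral {0..L} (\<lambda>x. (r' x)\<^sup>2) + integral {0..L} (\<lambda>x. (r'' x)\<^sup>2)))"
    proof (rule mult_left_mono)
      have "0 \<le> integral {0..L} (\<lambda>x. (r' x)\<^sup>2)" "0 \<le> integral {0..L} (\<lambda>x. (r'' x)\<^sup>2)"
        by (intro integral_nonneg integrable_cont continuous_intros c' c''; simp)+
      then have "16 * integral {0..L} (\<lambda>x. (r' x)\<^sup>2) \<le> (16 + L) * integral {0..L} (\<lambda>x. (r' x)\<^sup>2)"
        "4 * integral {0..L} (\<lambda>x. (r'' x)\<^sup>2) \<le> (16 + L) * integral {0..L} (\<lambda>x. (r'' x)\<^sup>2)"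
        "L * R\<^sup>2 \<le> (16 + L) * R\<^sup>2"
        using L by (auto intro!: mult_right_mono)
      then show "16 * integral {0..L} (\<lambda>x. (r' x)\<^sup>2) + L * R\<^sup>2 + 4 * integral {0..L} (\<lambda>x. (r'' x)\<^sup>2)
        \<le> (16 + L) * (R\<^sup>2 + integral {0..L} (\<lambda>x. (r' x)\<^sup>2) + integral {0..L} (\<lambda>x. (r'' x)\<^sup>2))"
        unfolding distrib_left by linarith
    qed (use K in simp)
    finally show "h N * (\<Sum>j<N. (num_flux N (cell_avg N r) j
       - (s (midpoint N j) * r (midpoint N j) - (\<sigma> (midpoint N j))\<^sup>2 / 2 * r' (midpoint N j)) / h N)\<^sup>2)
    \<le> 3 * K\<^sup>2 * (16 + L) * (R\<^sup>2 + integral {0..L} (\<lambda>x. (r' x)\<^sup>2) + integral {0..L} (\<lambda>x. (r'' x)\<^sup>2))"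
      by (simp add: e_def k_def mult.assoc)
  qed
qed

end

subsection \<open>The uniform-in-time error estimate\<close>

text \<open>The source need not be bounded in time, but its unbounded part -D is minus the
  derivative of the bounded \<open>V\<close>. Adding c V to \<Phi> removes it and leaves a linear
  differential inequality with constant source, whose equilibrium level is \<open>B\<close>. The
  resulting bound does not depend on the length of the interval.\<close>

lemma lyapunov_bound:
  fixes \<Phi> \<Phi>' V D :: "real \<Rightarrow> real"
  assumes st: "s < t" and d\<Phi>: "\<And>\<tau>. s \<le> \<tau> \<Longrightarrow> \<tau> \<le> t \<Longrightarrow> (\<Phi> has_real_derivative \<Phi>' \<tau>) (at \<tau>)"
    and dV: "\<And>\<tau>. s \<le> \<tau> \<Longrightarrow> \<tau> \<le> t \<Longrightarrow> (V has_real_derivative D \<tau>) (at \<tau>)"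
    and V: "\<And>\<tau>. s \<le> \<tau> \<Longrightarrow> \<tau> \<le> t \<Longrightarrow> 0 \<le> V \<tau> \<and> V \<tau> \<le> K"
    and ineq: "\<And>\<tau>. s \<le> \<tau> \<Longrightarrow> \<tau> \<le> t \<Longrightarrow> \<Phi>' \<tau> \<le> - l * \<Phi> \<tau> + c * (1 + K - D \<tau>)"
    and l: "l > 0" and c: "c \<ge> 0" and \<Phi>0: "\<Phi> s \<ge> 0"
  shows "\<Phi> t \<le> \<Phi> s + (2 * c * K + c * (1 + K) / l)"
proof -
  have K: "0 \<le> K" using V[of s] st by force
  define B where "B = c * K + c * (1 + K) / l"
  have B: "0 \<le> B" "l * B = l * c * K + c * (1 + K)" using c K l by (auto simp: B_def field_simps)
  define g where "g \<tau> = exp (l * \<tau>) * (\<Phi> \<tau> + c * V \<tau> - B)" for \<tau>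
  have gts: "g t \<le> g s"
  proof (rule DERIV_nonpos_imp_nonincreasing[of s t g])
    fix \<tau> assume \<tau>: "s \<le> \<tau>" "\<tau> \<le> t"
    have "(g has_real_derivative exp (l * \<tau>) * (l * (\<Phi> \<tau> + c * V \<tau> - B) + \<Phi>' \<tau> + c * D \<tau>)) (at \<tau>)"
      unfolding g_def[abs_def] by (auto intro!: derivative_eq_intros d\<Phi>[OF \<tau>] dV[OF \<tau>] simp: algebra_simps)
    moreover have "l * (\<Phi> \<tau> + c * V \<tau> - B) + \<Phi>' \<tau> + c * D \<tau> \<le> 0"
    proof -
      have "l * (c * V \<tau>) \<le> l * (c * K)" using V[OF \<tau>] l c by (intro mult_left_mono) auto
      then show ?thesis using ineq[OF \<tau>] B(2) by (simp add: algebra_simps)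
    qed
    ultimately show "\<exists>y. (g has_real_derivative y) (at \<tau>) \<and> y \<le> 0"
      by (meson exp_ge_zero mult_nonneg_nonpos)
  qed (use st in simp)
  have "c * V s \<le> c * K" using V[of s] st c by (intro mult_left_mono) auto
  then have "g s \<le> exp (l * s) * (\<Phi> s + c * K)"
    unfolding g_def using B(1) by (intro mult_left_mono) auto
  with gts have "g t \<le> exp (l * s) * (\<Phi> s + c * K)" by linarith
  then have "exp (l * t) * (\<Phi> t + c * V t - B) \<le> exp (l * s) * (\<Phi> s + c * K)" by (simp add: g_def)
  also have "\<dots> \<le> exp (l * t) * (\<Phi> s + c * K)"
    using st l \<Phi>0 c K by (intro mult_right_mono) auto
  finally have "\<Phi> t + c * V t - B \<le> \<Phi> s + c * K" by (simp add: mult_le_cancel_left_pos)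
  moreover have "0 \<le> c * V t" using V[of t] st c by auto
  ultimately show ?thesis unfolding B_def by linarith
qed

lemma continuous_on_swap:
  assumes "continuous_on (UNIV \<times> T) (\<lambda>(x, t). g x t)"
  shows "continuous_on (T \<times> UNIV) (\<lambda>(t, x). g x t)"
proof -
  have "continuous_on (T \<times> UNIV) (\<lambda>p. (\<lambda>(x, t). g x t) (snd p, fst p))"
    by (rule continuous_on_compose2[OF assms]) (auto intro!: continuous_intros)
  then show ?thesis by (simp add: case_prod_unfold)
qed

section \<open>From the Fokker-Planck equation to the error of the scheme\<close>

context upwind_scheme begin

definition u :: "real \<Rightarrow> real" where "u x = (\<sigma> x)\<^sup>2 * q x"

definition u' :: "real \<Rightarrow> real" where "u' x = 2 * \<sigma> x * \<sigma>' x * q x + (\<sigma> x)\<^sup>2 * q' x"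

lemma du: "(u has_real_derivative u' x) (at x)"
  unfolding u_def[abs_def] u'_def by (auto intro!: derivative_eq_intros d\<sigma> dq)

lemma u'_flux: "u' x = 2 * (b x * q x - J)"
  using flux[of x] by (simp add: u'_def field_simps)

lemma fun2_cont: "continuous_on UNIV g \<Longrightarrow> continuous_on (T \<times> UNIV) (\<lambda>p. g (snd p))" for T :: "real set" and g :: "real \<Rightarrow> real"
  by (rule continuous_on_compose2[of UNIV g]) (auto intro!: continuous_intros)

text \<open>Division by \<open>q\<close> eliminates the zero order term: its coefficient is the
  stationary operator applied to \<open>q\<close>, and this is the derivative of the constant flux
  (\<open>dflux\<close>). The first order term takes its final form by u' = 2 (b q - J).\<close>

lemma fokker_planck_ratio:
  assumes fp: "fokker_planck_solution L b \<sigma> \<rho>0 \<rho>"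
    and d\<rho>0: "\<And>x. (\<rho>0 has_real_derivative \<rho>0' x) (at x)" and \<rho>0'_cont: "continuous_on UNIV \<rho>0'"
  obtains f ft fx fxx f0' where "ratio_equation L J q q' q'' u u' f ft fx fxx f0'"
    "\<And>t x. \<rho> x t = q x * f t x"
proof -
  define rx rxx rt where "rx t x = deriv (\<lambda>y. \<rho> y t) x" and "rxx t x = deriv (deriv (\<lambda>y. \<rho> y t)) x"
    and "rt t x = deriv (\<lambda>\<tau>. \<rho> x \<tau>) t" for t x
  have dd: "(\<lambda>\<tau>. \<rho> x \<tau>) differentiable (at t) \<and> (\<lambda>y. \<rho> y t) differentiable (at x) \<and>
        deriv (\<lambda>y. \<rho> y t) differentiable (at x)" if "t > 0" for t x
    using fp that unfolding fokker_planck_solution_def by blast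
  have drx: "((\<lambda>y. \<rho> y t) has_real_derivative rx t x) (at x)"
    and drxx: "(rx t has_real_derivative rxx t x) (at x)"
    and drt: "((\<lambda>\<tau>. \<rho> x \<tau>) has_real_derivative rt t x) (at t)" if "t > 0" for t x
    using dd[OF that, of x] unfolding rx_def[abs_def] rxx_def rt_def
    by (simp_all add: DERIV_deriv_iff_real_differentiable)
  have c: "continuous_on ({0..} \<times> UNIV) (\<lambda>(t, x). \<rho> x t)"
    "continuous_on ({0<..} \<times> UNIV) (\<lambda>(t, x). rt t x)"
    "continuous_on ({0<..} \<times> UNIV) (\<lambda>(t, x). rx t x)"
    "continuous_on ({0<..} \<times> UNIV) (\<lambda>(t, x). rxx t x)"
    using fp unfolding fokker_planck_solution_def rx_def rxx_def rt_def
    by (intro continuous_on_swap; blast)+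
  have pde: "rt t x = - (b' x * \<rho> x t + b x * rx t x)
      + ((2 * (\<sigma>' x)\<^sup>2 + 2 * \<sigma> x * \<sigma>'' x) * \<rho> x t + 4 * \<sigma> x * \<sigma>' x * rx t x + (\<sigma> x)\<^sup>2 * rxx t x) / 2" if t: "t > 0" for t x
  proof -
    have 1: "deriv (\<lambda>y. b y * \<rho> y t) x = b' x * \<rho> x t + b x * rx t x"
      by (rule DERIV_imp_deriv) (auto intro!: derivative_eq_intros db drx t)
    have 2: "deriv (\<lambda>y. (\<sigma> y)\<^sup>2 * \<rho> y t) = (\<lambda>x. 2 * \<sigma> x * \<sigma>' x * \<rho> x t + (\<sigma> x)\<^sup>2 * rx t x)"
      by (rule ext, rule DERIV_imp_deriv) (auto intro!: derivative_eq_intros d\<sigma> drx t)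
    have 3: "deriv (\<lambda>x. 2 * \<sigma> x * \<sigma>' x * \<rho> x t + (\<sigma> x)\<^sup>2 * rx t x) x
       = (2 * (\<sigma>' x)\<^sup>2 + 2 * \<sigma> x * \<sigma>'' x) * \<rho> x t + 4 * \<sigma> x * \<sigma>' x * rx t x + (\<sigma> x)\<^sup>2 * rxx t x"
      by (rule DERIV_imp_deriv)
        (auto intro!: derivative_eq_intros d\<sigma> d\<sigma>' drx drxx t simp: algebra_simps power2_eq_square)
    have "rt t x = - deriv (\<lambda>y. b y * \<rho> y t) x + 1/2 * deriv (deriv (\<lambda>y. (\<sigma> y)\<^sup>2 * \<rho> y t)) x"
      using fp t unfolding fokker_planck_solution_def rt_def by blast
    then show ?thesis unfolding 1 2 3 by simp
  qed
  have dflux: "b' x * q x + b x * q' x = (2 * (\<sigma>' x)\<^sup>2 + 2 * \<sigma> x * \<sigma>'' x) * q x / 2 + 2 * \<sigma> x * \<sigma>' x * q' x + (\<sigma> x)\<^sup>2 * q'' x / 2" for x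
  proof -
    have "((\<lambda>x. b x * q x - (\<sigma> x * \<sigma>' x * q x + (\<sigma> x)\<^sup>2 * q' x / 2)) has_real_derivative
      b' x * q x + b x * q' x - ((2 * (\<sigma>' x)\<^sup>2 + 2 * \<sigma> x * \<sigma>'' x) * q x / 2 + 2 * \<sigma> x * \<sigma>' x * q' x + (\<sigma> x)\<^sup>2 * q'' x / 2)) (at x)"
      by (auto intro!: derivative_eq_intros db dq d\<sigma> d\<sigma>' dq' simp: field_simps power2_eq_square)
    then have "((\<lambda>x. J) has_real_derivative
      b' x * q x + b x * q' x - ((2 * (\<sigma>' x)\<^sup>2 + 2 * \<sigma> x * \<sigma>'' x) * q x / 2 + 2 * \<sigma> x * \<sigma>' x * q' x + (\<sigma> x)\<^sup>2 * q'' x / 2)) (at x)"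
      unfolding flux .
    from DERIV_unique[OF this DERIV_const] show ?thesis by simp
  qed
  define f ft fx fxx where "f t x = \<rho> x t / q x" and "ft t x = rt t x / q x"
    and "fx t x = (rx t x - q' x * (\<rho> x t / q x)) / q x"
    and "fxx t x = (rxx t x - q'' x * (\<rho> x t / q x) - 2 * q' x * ((rx t x - q' x * (\<rho> x t / q x)) / q x)) / q x" for t x
  define f0' where "f0' x = (\<rho>0' x * q x - \<rho>0 x * q' x) / (q x * q x)" for x
  have qnz: "q x \<noteq> 0" for x using q_pos[of x] by simp
  have \<rho>f: "\<rho> x t = q x * f t x" for t x using qnz by (simp add: f_def)
  have rxf: "rx t x = q' x * f t x + q x * fx t x" for t x using qnz by (simp add: f_def fx_def)
  have rxxf: "rxx t x = q'' x * f t x + 2 * q' x * fx t x + q x * fxx t x" for t x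
    using qnz by (simp add: f_def fx_def fxx_def)
  have rtf: "rt t x = q x * ft t x" for t x using qnz by (simp add: ft_def)
  show ?thesis
  proof (rule that[of f ft fx fxx f0'])
    show "\<rho> x t = q x * f t x" for x t by (rule \<rho>f)
    show "ratio_equation L J q q' q'' u u' f ft fx fxx f0'"
    proof (rule ratio_equation.intro)
      show "periodic_fun_simple u L" using \<sigma>_per q_per by (simp add: u_def periodic_fun_simple_def)
      show "u x > 0" for x using q_pos \<sigma>_nz by (simp add: u_def)
      show "(u has_real_derivative u' x) (at x)" for x by (rule du)
      show "continuous_on UNIV u'" unfolding u'_def[abs_def]
        by (intro continuous_intros \<sigma>_cont \<sigma>'_cont q_cont q'_cont)
      show "periodic_fun_simple (f t) L" if "t \<ge> 0" for t
        using fp that q_per by (simp add: fokker_planck_solution_def f_def periodic_fun_simple_def)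
      show "continuous_on ({0..} \<times> UNIV) (\<lambda>(t, x). f t x)"
        using c(1) qnz by (auto simp: f_def case_prod_unfold intro!: continuous_intros fun2_cont q_cont)
      have c0: "continuous_on ({0<..} \<times> UNIV) (\<lambda>(t, x). \<rho> x t)"
        by (rule continuous_on_subset[OF c(1)]) auto
      show "continuous_on ({0<..} \<times> UNIV) (\<lambda>(t, x). ft t x)"
        using c(2) qnz by (auto simp: ft_def case_prod_unfold intro!: continuous_intros fun2_cont q_cont)
      show "continuous_on ({0<..} \<times> UNIV) (\<lambda>(t, x). fxx t x)"
        using c0 c(3,4) qnz
        by (auto simp: fxx_def case_prod_unfold intro!: continuous_intros fun2_cont q_cont q'_cont q''_cont)
      show "((\<lambda>s. f s x) has_real_derivative ft t x) (at t)" if "t > 0" for t x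
        unfolding f_def ft_def by (rule DERIV_cdivide[OF drt[OF that]])
      show dfx: "(f t has_real_derivative fx t x) (at x)" if "t > 0" for t x
        unfolding f_def[abs_def] fx_def using qnz
        by (auto intro!: derivative_eq_intros drx[OF that] dq simp: field_simps)
      show "(fx t has_real_derivative fxx t x) (at x)" if "t > 0" for t x
      proof -
        have "fx t = (\<lambda>x. (rx t x - q' x * f t x) / q x)" by (simp add: fx_def[abs_def] f_def)
        moreover have "((\<lambda>x. (rx t x - q' x * f t x) / q x) has_real_derivative
          ((rxx t x - (q'' x * f t x + q' x * fx t x)) * q x - (rx t x - q' x * f t x) * q' x) / (q x * q x)) (at x)"
          using qnz by (auto intro!: derivative_eq_intros drxx[OF that] dfx[OF that] dq dq' simp: algebra_simps)
        moreover have "((rxx t x - (q'' x * f t x + q' x * fx t x)) * q x - (rx t x - q' x * f t x) * q' x) / (q x * q x) = fxx t x"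
          unfolding rxxf rxf using qnz[of x] by (simp add: field_simps)
        ultimately show ?thesis by simp
      qed
      show "q x * ft t x = (u' x * fx t x + u x * fxx t x) / 2 - J * fx t x" if "t > 0" for t x
      proof -
        have "q x * ft t x = - (b' x * q x + b x * q' x) * f t x - b x * q x * fx t x
          + ((2 * (\<sigma>' x)\<^sup>2 + 2 * \<sigma> x * \<sigma>'' x) * q x * f t x + 4 * \<sigma> x * \<sigma>' x * (q' x * f t x + q x * fx t x)
             + (\<sigma> x)\<^sup>2 * (q'' x * f t x + 2 * q' x * fx t x + q x * fxx t x)) / 2"
          unfolding rtf[symmetric] pde[OF that] \<rho>f rxf rxxf by (simp add: algebra_simps)
        also have "\<dots> = (2 * u' x * fx t x + u x * fxx t x) / 2 - b x * q x * fx t x"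
          unfolding dflux u'_def u_def by (simp add: field_simps)
        also have "\<dots> = (u' x * fx t x + u x * fxx t x) / 2 - J * fx t x"
          unfolding u'_flux by (simp add: field_simps)
        finally show ?thesis .
      qed
      show "(f 0 has_real_derivative f0' x) (at x)" for x
      proof -
        have "f 0 = (\<lambda>x. \<rho>0 x / q x)" using fp by (simp add: f_def[abs_def] fokker_planck_solution_def)
        then show ?thesis unfolding f0'_def using qnz
          by (auto intro!: derivative_eq_intros d\<rho>0 dq)
      qed
      have "continuous_on UNIV \<rho>0" using d\<rho>0 by (rule continuous_of_derivative)
      then show "continuous_on UNIV f0'"
        unfolding f0'_def[abs_def] using qnz by (intro continuous_intros \<rho>0'_cont q_cont q'_cont) auto
    qed (rule L q_per q_pos q_int dq dq' q''_cont)+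
  qed
qed

text \<open>The initial error is small in \<open>\<ell>\<^sup>1\<close> only; it is transported by the contraction semigroup \<open>Y\<close>. The rest
  \<open>Z\<close> of the error vanishes initially and has mean zero, and is estimated in the \<open>\<ell>\<^sup>2\<close> norm weighted by
  the inverse of the discrete stationary distribution.\<close>

lemma scheme_error:
  assumes fp: "fokker_planck_solution L b \<sigma> \<rho>0 \<rho>" and \<rho>0_per: "periodic_fun_simple \<rho>0 L"
    and d\<rho>0: "\<And>x. (\<rho>0 has_real_derivative \<rho>0' x) (at x)" and \<rho>0'_cont: "continuous_on UNIV \<rho>0'"
    and h0: "h0 > 0" "\<And>N j. N > 0 \<Longrightarrow> h N < h0 \<Longrightarrow> j < N \<Longrightarrow> h N * q (node L N j) / 2 \<le> ph N j"
    and ph: "\<And>N. N > 0 \<Longrightarrow> upwind_stationary L b \<sigma> N (ph N)"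
    and rh: "\<And>N. N > 0 \<Longrightarrow> upwind_solution L b \<sigma> N (rh N)"
    and init: "\<And>N. N > 0 \<Longrightarrow> initial_data_approx L \<rho>0 C' N (\<lambda>j. rh N j 0)"
  obtains C where "C > 0" "\<And>N t. N > 0 \<Longrightarrow> h N < h0 \<Longrightarrow> t \<ge> 0 \<Longrightarrow>
    (\<Sum>j<N. h N * \<bar>\<rho> (node L N j) t - rh N j t\<bar>) \<le> C * h N"
proof -
  obtain f ft fx fxx f0' where rat: "ratio_equation L J q q' q'' u u' f ft fx fxx f0'"
    and \<rho>f: "\<And>t x. \<rho> x t = q x * f t x"
    by (rule fokker_planck_ratio[OF fp d\<rho>0 \<rho>0'_cont]) blast
  interpret R: ratio_equation L J q q' q'' u u' f ft fx fxx f0' by (rule rat)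
  obtain K where K: "K > 0" "\<And>t x. t > 0 \<Longrightarrow> \<bar>f t x\<bar> \<le> K"
    "\<And>t. t > 0 \<Longrightarrow> integral {0..L} (\<lambda>x. (fx t x)\<^sup>2) \<le> K"
    "\<And>s t. 0 < s \<Longrightarrow> s < t \<Longrightarrow> \<exists>V D. \<forall>\<tau>\<in>{s..t}. (V has_real_derivative D \<tau>) (at \<tau>) \<and> 0 \<le> V \<tau> \<and> V \<tau> \<le> K \<and>
        integral {0..L} (\<lambda>x. (fxx \<tau> x)\<^sup>2) \<le> K - D \<tau>"
    by (rule R.uniform_bounds) blast
  obtain C1 where C1: "C1 > 0" "\<And>N r r' r'' R. N > 0 \<Longrightarrow> periodic_fun_simple r L \<Longrightarrow>
    (\<And>x. (r has_real_derivative r' x) (at x)) \<Longrightarrow> (\<And>x. (r' has_real_derivative r'' x) (at x)) \<Longrightarrow>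
    continuous_on UNIV r'' \<Longrightarrow> (\<And>x. \<bar>r x\<bar> \<le> R) \<Longrightarrow>
    h N * (\<Sum>j<N. (num_flux N (cell_avg N r) j
       - (s (midpoint N j) * r (midpoint N j) - (\<sigma> (midpoint N j))\<^sup>2 / 2 * r' (midpoint N j)) / h N)\<^sup>2)
    \<le> C1 * (R\<^sup>2 + integral {0..L} (\<lambda>x. (r' x)\<^sup>2) + integral {0..L} (\<lambda>x. (r'' x)\<^sup>2))"
    by (rule averaged_flux_error) blast
  obtain q0 where q0: "q0 > 0" "\<And>x. q0 \<le> q x" using periodic_bounded_below[OF q_per L q_cont q_pos] by metis
  have q'_per: "periodic_fun_simple q' L" by (rule periodic_derivative[OF q_per dq])
  obtain Q0 where Q0: "Q0 > 0" "\<And>x. \<bar>q x\<bar> \<le> Q0" using periodic_bounded[OF q_per L q_cont] by metis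
  obtain Q1 where Q1: "Q1 > 0" "\<And>x. \<bar>q' x\<bar> \<le> Q1" using periodic_bounded[OF q'_per L q'_cont] by metis
  obtain Q2 where Q2: "Q2 > 0" "\<And>x. \<bar>q'' x\<bar> \<le> Q2"
    using periodic_bounded[OF periodic_derivative[OF q'_per dq'] L q''_cont] by metis
  define rx where "rx t x = q' x * f t x + q x * fx t x" for t x
  define rxx where "rxx t x = q'' x * f t x + 2 * q' x * fx t x + q x * fxx t x" for t x
  define rt where "rt t x = q x * ft t x" for t x
  have drx: "((\<lambda>y. \<rho> y t) has_real_derivative rx t x) (at x)" if "t > 0" for t x
    unfolding \<rho>f rx_def by (auto intro!: derivative_eq_intros dq R.dx[OF that])
  have drxx: "(rx t has_real_derivative rxx t x) (at x)" if "t > 0" for t x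
    unfolding rx_def[abs_def] rxx_def
    by (auto intro!: derivative_eq_intros dq dq' R.dx[OF that] R.dxx[OF that] simp: algebra_simps)
  have drt: "((\<lambda>\<tau>. \<rho> x \<tau>) has_real_derivative rt t x) (at t)" if "t > 0" for t x
    unfolding \<rho>f rt_def by (auto intro!: derivative_eq_intros R.dt[OF that])
  have \<rho>_per: "periodic_fun_simple (\<lambda>x. \<rho> x t) L" if "t \<ge> 0" for t
    using fp that by (simp add: fokker_planck_solution_def)
  have rxx_cont: "continuous_on UNIV (rxx t)" and rx_cont: "continuous_on UNIV (rx t)" if "t > 0" for t
    unfolding rx_def[abs_def] rxx_def[abs_def]
    by (intro continuous_intros q_cont q'_cont q''_cont R.x_cont that)+
  have \<rho>_cont: "continuous_on UNIV (\<lambda>x. \<rho> x t)" if "t > 0" for t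
    using drx[OF that] by (rule continuous_of_derivative)
  have \<rho>_cont2: "continuous_on ({0..} \<times> UNIV) (\<lambda>(t, x). \<rho> x t)"
    using fp by (intro continuous_on_swap) (simp add: fokker_planck_solution_def)
  have rt_cont2: "continuous_on ({0<..} \<times> UNIV) (\<lambda>(t, x). rt t x)"
    using R.ft_cont by (auto simp: rt_def case_prod_unfold intro!: continuous_intros fun2_cont q_cont)
  define Fl where "Fl t x = s x * \<rho> x t - (\<sigma> x)\<^sup>2 / 2 * rx t x" for t x
  have Fl_eq: "Fl t x = J * f t x - u x / 2 * fx t x" for t x
  proof -
    have "Fl t x = (s x * q x - (\<sigma> x)\<^sup>2 / 2 * q' x) * f t x - (\<sigma> x)\<^sup>2 / 2 * q x * fx t x"
      by (simp add: Fl_def rx_def \<rho>f algebra_simps)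
    then show ?thesis unfolding exact_flux by (simp add: u_def)
  qed
  have dFl: "(Fl t has_real_derivative - rt t x) (at x)" if "t > 0" for t x
  proof -
    have "((\<lambda>x. J * f t x - u x / 2 * fx t x) has_real_derivative J * fx t x - (u' x * fx t x + u x * fxx t x) / 2) (at x)"
      by (auto intro!: derivative_eq_intros du R.dx[OF that] R.dxx[OF that] simp: algebra_simps add_divide_distrib)
    then show ?thesis using R.pde[OF that, of x] by (simp add: Fl_eq[abs_def] rt_def)
  qed
  have Fl_per: "periodic_fun_simple (Fl t) L" if "t > 0" for t
    using R.f_per[of t] R.fx_per[OF that] R.u_per that by (simp add: Fl_eq[abs_def] periodic_fun_simple_def)
  define K1 where "K1 = 2 * Q1\<^sup>2 * K\<^sup>2 * L + 2 * Q0\<^sup>2 * K"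
  \<comment> \<open>\<open>K2\<close> dominates both the terms without \<open>fxx\<close> and the
    coefficient 3 Q0^2 of its square.\<close>
  define K2 where "K2 = (Q0 * K)\<^sup>2 + K1 + 3 * Q2\<^sup>2 * K\<^sup>2 * L + 12 * Q1\<^sup>2 * K + 3 * Q0\<^sup>2"
  have sqb: "(p * v)\<^sup>2 \<le> P\<^sup>2 * v\<^sup>2" if "\<bar>p\<bar> \<le> P" for p P v :: real
    unfolding power_mult_distrib using that by (intro mult_right_mono) (auto simp: abs_le_square_iff[symmetric])
  have K1_nonneg: "K1 \<ge> 0" using K L by (simp add: K1_def)
  have f2: "(f t x)\<^sup>2 \<le> K\<^sup>2" if "t > 0" for t x
    using K(2)[OF that, of x] by (metis abs_ge_zero power2_abs power_mono)
  have rx_bd: "integral {0..L} (\<lambda>x. (rx t x)\<^sup>2) \<le> K1" if t: "t > 0" for t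
  proof -
    have "integral {0..L} (\<lambda>x. (rx t x)\<^sup>2) \<le> integral {0..L} (\<lambda>x. 2 * Q1\<^sup>2 * K\<^sup>2 * 1 + 2 * Q0\<^sup>2 * (fx t x)\<^sup>2 + 0 * 1)"
    proof (rule integral_mono_cont)
      fix x
      have "(rx t x)\<^sup>2 \<le> 2 * (q' x * f t x)\<^sup>2 + 2 * (q x * fx t x)\<^sup>2"
        unfolding rx_def using zero_le_power2[of "q' x * f t x - q x * fx t x"]
        by (simp add: power2_eq_square algebra_simps)
      also have "\<dots> \<le> 2 * (Q1\<^sup>2 * (f t x)\<^sup>2) + 2 * (Q0\<^sup>2 * (fx t x)\<^sup>2)"
        by (intro add_mono mult_left_mono sqb Q1 Q0) auto
      also have "\<dots> \<le> 2 * (Q1\<^sup>2 * K\<^sup>2) + 2 * (Q0\<^sup>2 * (fx t x)\<^sup>2)"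
        by (intro add_right_mono mult_left_mono f2[OF t]) auto
      finally show "(rx t x)\<^sup>2 \<le> 2 * Q1\<^sup>2 * K\<^sup>2 * 1 + 2 * Q0\<^sup>2 * (fx t x)\<^sup>2 + 0 * 1" by simp
    qed (intro continuous_intros rx_cont R.x_cont t)+
    also have "\<dots> = 2 * Q1\<^sup>2 * K\<^sup>2 * integral {0..L} (\<lambda>x. 1) + 2 * Q0\<^sup>2 * integral {0..L} (\<lambda>x. (fx t x)\<^sup>2) + 0 * integral {0..L} (\<lambda>x. 1)"
      by (rule integral_linear3) (intro continuous_intros R.x_cont t)+
    also have "\<dots> = 2 * Q1\<^sup>2 * K\<^sup>2 * L + 2 * Q0\<^sup>2 * integral {0..L} (\<lambda>x. (fx t x)\<^sup>2)" using L by simp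
    also have "\<dots> \<le> K1" unfolding K1_def by (intro add_left_mono mult_left_mono K(3) t) auto
    finally show ?thesis .
  qed
  have rxx_bd: "(Q0 * K)\<^sup>2 + integral {0..L} (\<lambda>x. (rx t x)\<^sup>2) + integral {0..L} (\<lambda>x. (rxx t x)\<^sup>2)
      \<le> K2 * (1 + integral {0..L} (\<lambda>x. (fxx t x)\<^sup>2))" if t: "t > 0" for t
  proof -
    define X where "X = integral {0..L} (\<lambda>x. (fxx t x)\<^sup>2)"
    have X: "0 \<le> X" unfolding X_def by (intro integral_nonneg integrable_cont continuous_intros R.x_cont t) auto
    have "integral {0..L} (\<lambda>x. (rxx t x)\<^sup>2) \<le> integral {0..L} (\<lambda>x. 3 * Q2\<^sup>2 * K\<^sup>2 * 1 + 12 * Q1\<^sup>2 * (fx t x)\<^sup>2 + 3 * Q0\<^sup>2 * (fxx t x)\<^sup>2)"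
    proof (rule integral_mono_cont)
      fix x
      have "(rxx t x)\<^sup>2 \<le> 3 * ((q'' x * f t x)\<^sup>2 + (2 * (q' x * fx t x))\<^sup>2 + (q x * fxx t x)\<^sup>2)"
        unfolding rxx_def using zero_le_power2[of "q'' x * f t x - 2 * q' x * fx t x"]
          zero_le_power2[of "q'' x * f t x - q x * fxx t x"] zero_le_power2[of "2 * q' x * fx t x - q x * fxx t x"]
        by (simp add: power2_eq_square algebra_simps)
      also have "\<dots> = 3 * ((q'' x * f t x)\<^sup>2 + 4 * (q' x * fx t x)\<^sup>2 + (q x * fxx t x)\<^sup>2)"
        by (simp add: power_mult_distrib)
      also have "\<dots> \<le> 3 * (Q2\<^sup>2 * (f t x)\<^sup>2 + 4 * (Q1\<^sup>2 * (fx t x)\<^sup>2) + Q0\<^sup>2 * (fxx t x)\<^sup>2)"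
        by (intro add_mono mult_left_mono sqb Q2 Q1 Q0) auto
      also have "\<dots> \<le> 3 * (Q2\<^sup>2 * K\<^sup>2 + 4 * (Q1\<^sup>2 * (fx t x)\<^sup>2) + Q0\<^sup>2 * (fxx t x)\<^sup>2)"
        by (intro mult_left_mono add_right_mono f2[OF t]) auto
      finally show "(rxx t x)\<^sup>2 \<le> 3 * Q2\<^sup>2 * K\<^sup>2 * 1 + 12 * Q1\<^sup>2 * (fx t x)\<^sup>2 + 3 * Q0\<^sup>2 * (fxx t x)\<^sup>2" by simp
    qed (intro continuous_intros rxx_cont R.x_cont t)+
    also have "\<dots> = 3 * Q2\<^sup>2 * K\<^sup>2 * integral {0..L} (\<lambda>x. 1) + 12 * Q1\<^sup>2 * integral {0..L} (\<lambda>x. (fx t x)\<^sup>2) + 3 * Q0\<^sup>2 * X"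
      unfolding X_def by (rule integral_linear3) (intro continuous_intros R.x_cont t)+
    also have "\<dots> = 3 * Q2\<^sup>2 * K\<^sup>2 * L + 12 * Q1\<^sup>2 * integral {0..L} (\<lambda>x. (fx t x)\<^sup>2) + 3 * Q0\<^sup>2 * X" using L by simp
    also have "\<dots> \<le> 3 * Q2\<^sup>2 * K\<^sup>2 * L + 12 * Q1\<^sup>2 * K + 3 * Q0\<^sup>2 * X"
      by (intro add_left_mono add_right_mono mult_left_mono K(3) t) auto
    finally have 1: "integral {0..L} (\<lambda>x. (rxx t x)\<^sup>2) \<le> 3 * Q2\<^sup>2 * K\<^sup>2 * L + 12 * Q1\<^sup>2 * K + 3 * Q0\<^sup>2 * X" .
    have "3 * Q0\<^sup>2 * X \<le> K2 * X"
    proof (rule mult_right_mono)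
      show "3 * Q0\<^sup>2 \<le> K2" unfolding K2_def using K1_nonneg K L by simp
    qed (rule X)
    moreover have "(Q0 * K)\<^sup>2 + K1 + 3 * Q2\<^sup>2 * K\<^sup>2 * L + 12 * Q1\<^sup>2 * K \<le> K2" unfolding K2_def by simp
    ultimately show ?thesis using 1 rx_bd[OF t] unfolding X_def[symmetric] distrib_left by linarith
  qed
  have K2_nonneg: "K2 \<ge> 0" using K1_nonneg K L by (simp add: K2_def)
  have \<rho>_bd: "\<bar>\<rho> x t\<bar> \<le> Q0 * K" if "t > 0" for x t
    unfolding \<rho>f abs_mult using Q0 K(2)[OF that] K(1) by (intro mult_mono) auto
  \<comment> \<open>\<open>l\<close> is the decay rate A/N for the conductance bound A = S q0 / (4
    h) below, free of h because N h = L. The factor 4 / (S q0) in \<open>c\<close> is 1 / (h A): it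
    converts the bound on h times the sum of e^2 into one on that sum divided by A.\<close>
  define l where "l = S * q0 / (4 * L)"
  define c where "c = 4 / (S * q0) * (C1 * K2)"
  have l: "l > 0" and c: "c \<ge> 0" using S q0 L C1 K2_nonneg by (auto simp: l_def c_def)
  define C3 where "C3 = 2 * c * K + c * (1 + K) / l"
  have C3: "C3 \<ge> 0" using c K l by (simp add: C3_def)
  define C4 where "C4 = sqrt (L * integral {0..L} (\<lambda>x. (\<rho>0' x)\<^sup>2))"
  have C4: "C4 \<ge> 0" unfolding C4_def
    using L by (intro real_sqrt_ge_zero mult_nonneg_nonneg integral_nonneg integrable_cont continuous_intros \<rho>0'_cont) auto
  define C where "C = sqrt (L * K1) + sqrt C3 + \<bar>C'\<bar> + C4 + 1"
  show ?thesis
  proof (rule that[of C])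
    show "C > 0" using K1_nonneg L C3 C4 unfolding C_def by (intro add_nonneg_pos add_nonneg_nonneg) auto
    fix N :: nat and t :: real assume N: "N > 0" and small: "h N < h0" and t: "t \<ge> 0"
    define k where "k = h N"
    have k: "k > 0" using h_pos[OF N] by (simp add: k_def)
    have kN: "real N * k = L" using h_N[OF N] by (simp add: k_def)
    define p r where "p = ph N" and "r = rh N"
    define x m where "x j = node L N j" and "m j = midpoint N j" for j
    interpret cycle_chain N "up_rate L b \<sigma> N" "down_rate L b \<sigma> N" by (rule chain[OF N])
    have nxt: "nxt j = next_index N j" for j by (simp add: nxt_def)
    have gen_op: "upwind_op L b \<sigma> N w j = gen w j" for w j
      by (simp add: upwind_op_def gen_def nxt_def prv_def)
    have flux_eq: "flux w j = num_flux N w j" for w j by (simp add: flux_def num_flux_def nxt)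
    have p: "gen p j = 0" if "j < N" for j
      using ph[OF N] that by (simp add: p_def upwind_stationary_def gen_op)
    have p1: "(\<Sum>j<N. p j) = 1" using ph[OF N] by (simp add: p_def upwind_stationary_def)
    have p_low: "k * q0 / 2 \<le> p j" if "j < N" for j
    proof -
      have "k * q0 \<le> k * q (x j)" using k by (intro mult_left_mono q0) auto
      then show ?thesis using h0(2)[OF N small that] by (simp add: p_def k_def x_def)
    qed
    have p_pos: "0 < p j" if "j < N" for j using p_low[OF that] k q0 by (intro less_le_trans[OF _ p_low[OF that]]) auto
    \<comment> \<open>Each rate is at least S / (2 h^2), and the stationary weights are known to be
      at least h q0 / 2.\<close>
    define A where "A = S * q0 / (4 * k)"
    have A: "A > 0" using S q0 k by (simp add: A_def)
    have rate: "A \<le> (up_rate L b \<sigma> N j * p j + down_rate L b \<sigma> N (nxt j) * p (nxt j)) / 2" if j: "j < N" for j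
    proof -
      have SA: "S / (2 * k\<^sup>2) * (k * q0 / 2) = A" using k by (simp add: A_def power2_eq_square)
      have g: "A \<le> a * p i" if "S / (2 * k\<^sup>2) \<le> a" "i < N" for a i
      proof -
        have "0 \<le> S / (2 * k\<^sup>2)" using S by simp
        then have "0 \<le> a" using that by linarith
        then show ?thesis unfolding SA[symmetric] using k q0 S that p_low by (intro mult_mono) auto
      qed
      show ?thesis
        using g[OF up_rate_ge[OF N, of j, folded k_def] j] g[OF down_rate_ge[OF N, of "nxt j", folded k_def] nxt_less[of j]]
        by simp
    qed
    define P where "P j t = cell_avg N (\<lambda>x. \<rho> x t) j" for j t
    have P0: "P j 0 = cell_avg N \<rho>0 j" for j
      using fp by (simp add: P_def fokker_planck_solution_def)
    have P_cont: "continuous_on {0..} (P j)" for j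
    proof -
      have "continuous_on ({0..} \<times> UNIV) (\<lambda>z. (\<lambda>(t, x). \<rho> x t) (fst z, x j + snd z))"
        by (rule continuous_on_compose2[OF \<rho>_cont2]) (auto intro!: continuous_intros)
      then have "continuous_on ({0..} \<times> UNIV) (\<lambda>(t, y). \<rho> (x j + y) t)" by (simp add: case_prod_unfold)
      from integral_time_continuous[OF this, of "- (k / 2)" "k / 2"] show ?thesis
        unfolding P_def[abs_def] cell_avg_def x_def k_def using h_pos[OF N] by (intro continuous_intros) auto
    qed
    have dP: "(P j has_real_derivative (Fl t (m (prv j)) - Fl t (m j)) / k) (at t)" if t: "t > 0" and j: "j < N" for j t
    proof -
      have "((\<lambda>t. integral {- (k / 2)..k / 2} (\<lambda>y. \<rho> (x j + y) t)) has_real_derivative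
         integral {- (k / 2)..k / 2} (\<lambda>y. rt t (x j + y))) (at t)"
      proof (rule integral_time_derivative[OF _ _ _ t])
        show "((\<lambda>s. \<rho> (x j + y) s) has_real_derivative rt t (x j + y)) (at t)" if "t > 0" for t y by (rule drt[OF that])
        show "continuous_on UNIV (\<lambda>y. \<rho> (x j + y) t)" if "t > 0" for t by (rule translate_cont[OF \<rho>_cont[OF that]])
        have "continuous_on ({0<..} \<times> UNIV) (\<lambda>z. (\<lambda>(t, x). rt t x) (fst z, x j + snd z))"
          by (rule continuous_on_compose2[OF rt_cont2]) (auto intro!: continuous_intros)
        then show "continuous_on ({0<..} \<times> UNIV) (\<lambda>(t, y). rt t (x j + y))" by (simp add: case_prod_unfold)
      qed
      moreover have "integral {- (k / 2)..k / 2} (\<lambda>y. rt t (x j + y)) = Fl t (m (prv j)) - Fl t (m j)"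
      proof -
        have "((\<lambda>y. - Fl t (x j + y)) has_real_derivative rt t (x j + y)) (at y)" for y
          using DERIV_shift[of "Fl t" "- rt t (x j + y)" y "x j"] dFl[OF t, of "x j + y"]
          by (auto intro!: derivative_eq_intros simp: add.commute)
        from integral_derivative[OF _ this, of "- (k / 2)" "k / 2"]
        have "integral {- (k / 2)..k / 2} (\<lambda>y. rt t (x j + y)) = Fl t (x j + - (k / 2)) - Fl t (x j + k / 2)" using k by simp
        also have "Fl t (x j + - (k / 2)) = Fl t (m (prv j))"
          using node_next[OF Fl_per[OF t] prv_less, of j "- (k / 2)"] nxt_prv[OF j]
          by (simp add: nxt x_def k_def m_def midpoint_def add.commute)
        finally show ?thesis by (simp add: m_def midpoint_def x_def k_def)
      qed
      ultimately have "((\<lambda>t. integral {- (k / 2)..k / 2} (\<lambda>y. \<rho> (x j + y) t)) has_real_derivative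
         Fl t (m (prv j)) - Fl t (m j)) (at t)" by simp
      from DERIV_cdivide[OF this, of k] show ?thesis
        unfolding P_def[abs_def] cell_avg_def x_def k_def .
    qed
    define y where "y j = r j 0 - P j 0" for j
    obtain Y :: "nat \<Rightarrow> real \<Rightarrow> real" where Y: "\<And>j. j < N \<Longrightarrow> Y j 0 = y j"
      "\<And>j t. j < N \<Longrightarrow> (Y j has_real_derivative gen (\<lambda>i. Y i t) j) (at t)"
      "\<And>t. t \<ge> 0 \<Longrightarrow> (\<Sum>j<N. \<bar>Y j t\<bar>) \<le> (\<Sum>j<N. \<bar>y j\<bar>)"
      by (rule contraction_semigroup[of y]) blast
    have dr: "(r j has_real_derivative gen (\<lambda>i. r i t) j) (at t within {0..})" if "j < N" "t \<ge> 0" for j t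
      using rh[OF N] that by (simp add: r_def upwind_solution_def gen_op)
    have r_cont: "continuous_on {0..} (r j)" if "j < N" for j
      by (rule DERIV_continuous_on) (use dr[OF that] in auto)
    have Y_cont: "continuous_on {0..} (Y j)" if "j < N" for j
      by (rule DERIV_continuous_on) (use Y(2)[OF that] in \<open>auto intro: has_field_derivative_at_within\<close>)
    have dr': "(r j has_real_derivative gen (\<lambda>i. r i t) j) (at t)" if "j < N" "t > 0" for j t
    proof -
      have "at t within {0..} = at t" using that by (intro at_within_interior) (simp add: interior_real_atLeast)
      then show ?thesis using dr[of j t] that by simp
    qed
    \<comment> \<open>The unknowns are densities, so the fluxes carry a factor 1/h and
      \<open>e\<close> is of order 1 in the mean. The factor h of the final estimate comes from the
      weight h in the norm.\<close>
    define e where "e t j = num_flux N (cell_avg N (\<lambda>x. \<rho> x t)) j - Fl t (m j) / k" for t j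
    have e_bd: "(\<Sum>j<N. (e t j)\<^sup>2) / A \<le> c * (1 + integral {0..L} (\<lambda>x. (fxx t x)\<^sup>2))" if t: "t > 0" for t
    proof -
      have "k * (\<Sum>j<N. (e t j)\<^sup>2) \<le> C1 * ((Q0 * K)\<^sup>2 + integral {0..L} (\<lambda>x. (rx t x)\<^sup>2) + integral {0..L} (\<lambda>x. (rxx t x)\<^sup>2))"
        using C1(2)[OF N \<rho>_per[OF less_imp_le[OF t]] drx[OF t] drxx[OF t] rxx_cont[OF t] \<rho>_bd[OF t]]
        by (simp add: e_def Fl_def m_def k_def)
      also have "\<dots> \<le> C1 * (K2 * (1 + integral {0..L} (\<lambda>x. (fxx t x)\<^sup>2)))"
        using C1(1) by (intro mult_left_mono rxx_bd[OF t]) auto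
      finally have "4 / (S * q0) * (k * (\<Sum>j<N. (e t j)\<^sup>2)) \<le> 4 / (S * q0) * (C1 * (K2 * (1 + integral {0..L} (\<lambda>x. (fxx t x)\<^sup>2))))"
        using S q0 by (intro mult_left_mono) auto
      then show ?thesis using k by (simp add: A_def c_def mult_ac)
    qed
    define Z where "Z j t = r j t - P j t - Y j t" for j t
    have dZ: "(Z j has_real_derivative gen (\<lambda>i. Z i t) j + (e t (prv j) - e t j)) (at t)" if t: "t > 0" and j: "j < N" for j t
    proof -
      have dZ0: "(Z j has_real_derivative gen (\<lambda>i. r i t) j - (Fl t (m (prv j)) - Fl t (m j)) / k - gen (\<lambda>i. Y i t) j) (at t)"
        unfolding Z_def[abs_def] by (intro DERIV_diff dr'[OF j t] dP[OF t j] Y(2)[OF j])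
      have "gen (\<lambda>i. Z i t) j = gen (\<lambda>i. r i t) j - gen (\<lambda>i. P i t) j - gen (\<lambda>i. Y i t) j"
        by (simp add: gen_def Z_def algebra_simps)
      moreover have "gen (\<lambda>i. P i t) j = (e t (prv j) - e t j) + (Fl t (m (prv j)) - Fl t (m j)) / k"
        using j by (simp add: gen_flux flux_eq e_def P_def diff_divide_distrib)
      ultimately have "gen (\<lambda>i. r i t) j - (Fl t (m (prv j)) - Fl t (m j)) / k - gen (\<lambda>i. Y i t) j
        = gen (\<lambda>i. Z i t) j + (e t (prv j) - e t j)" by linarith
      with dZ0 show ?thesis by simp
    qed
    have Z_cont: "continuous_on {0..} (Z j)" if "j < N" for j
      unfolding Z_def[abs_def] by (intro continuous_intros r_cont P_cont Y_cont that)
    have Z0: "Z j 0 = 0" if "j < N" for j using Y(1)[OF that] by (simp add: Z_def y_def)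
    \<comment> \<open>Mean zero is the condition for the Poincare inequality. Constancy of the sum
      on positive times is joined to its value at 0 by applying monotonicity to the sum and to its
      negative.\<close>
    have Z_sum: "(\<Sum>j<N. Z j t) = 0" if t: "t > 0" for t
    proof -
      have d: "((\<lambda>t. \<Sum>j<N. Z j t) has_real_derivative 0) (at t)" if "t > 0" for t
      proof -
        have "((\<lambda>t. \<Sum>j<N. Z j t) has_real_derivative (\<Sum>j<N. gen (\<lambda>i. Z i t) j + (e t (prv j) - e t j))) (at t)"
          by (intro DERIV_sum dZ that) simp
        moreover have "(\<Sum>j<N. gen (\<lambda>i. Z i t) j + (e t (prv j) - e t j)) = 0"
          using sum_gen[of "\<lambda>i. Z i t"] sum_prv[of "e t"] by (simp add: sum.distrib sum_subtractf)
        ultimately show ?thesis by simp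
      qed
      have c: "continuous_on {0..} (\<lambda>t. \<Sum>j<N. Z j t)" by (intro continuous_intros Z_cont) simp
      have 1: "(\<Sum>j<N. Z j t) \<le> (\<Sum>j<N. Z j 0)"
        by (rule nonincreasing_from_0[OF d _ c t]) auto
      have d': "((\<lambda>t. - (\<Sum>j<N. Z j t)) has_real_derivative 0) (at t)" if "t > 0" for t
        using DERIV_minus[OF d[OF that]] by simp
      have "- (\<Sum>j<N. Z j t) \<le> - (\<Sum>j<N. Z j 0)"
        by (rule nonincreasing_from_0[OF d' _ continuous_on_minus[OF c] t]) auto
      then show ?thesis using 1 by (simp add: Z0)
    qed
    define \<Phi> where "\<Phi> t = (\<Sum>j<N. (Z j t)\<^sup>2 / p j)" for t
    define \<Phi>' where "\<Phi>' t = (\<Sum>j<N. 2 * (Z j t / p j) * (gen (\<lambda>i. Z i t) j + (e t (prv j) - e t j)))" for t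
    have d\<Phi>: "(\<Phi> has_real_derivative \<Phi>' t) (at t)" if t: "t > 0" for t
      unfolding \<Phi>_def[abs_def] \<Phi>'_def
    proof (rule DERIV_sum)
      fix j assume "j \<in> {..<N}"
      then have j: "j < N" by simp
      show "((\<lambda>t. (Z j t)\<^sup>2 / p j) has_real_derivative 2 * (Z j t / p j) * (gen (\<lambda>i. Z i t) j + (e t (prv j) - e t j))) (at t)"
        by (rule DERIV_cong[OF DERIV_cdivide[OF DERIV_power[OF dZ[OF t j], of 2]]]) simp
    qed
    have \<Phi>_cont: "continuous_on {0..} \<Phi>" unfolding \<Phi>_def[abs_def]
      by (intro continuous_intros Z_cont) (use p_pos in \<open>auto simp: less_le\<close>)
    have \<Phi>_nonneg: "0 \<le> \<Phi> t" for t unfolding \<Phi>_def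
      by (intro sum_nonneg divide_nonneg_nonneg) (use p_pos in \<open>auto simp: less_imp_le\<close>)
    have lA: "A / real N = l" using kN k N by (simp add: A_def l_def flip: kN)
    have diss: "\<Phi>' t \<le> - l * \<Phi> t + (\<Sum>j<N. (e t j)\<^sup>2) / A" if t: "t > 0" for t
      using energy_dissipation[OF p p_pos p1 A rate Z_sum[OF t], of "e t"]
      unfolding lA \<Phi>_def \<Phi>'_def by simp
    have \<Phi>_bd: "\<Phi> t \<le> \<Phi> s + C3" if st: "0 < s" "s < t" for s t
    proof -
      obtain V D where VD: "\<forall>\<tau>\<in>{s..t}. (V has_real_derivative D \<tau>) (at \<tau>) \<and> 0 \<le> V \<tau> \<and> V \<tau> \<le> K \<and>
        integral {0..L} (\<lambda>x. (fxx \<tau> x)\<^sup>2) \<le> K - D \<tau>" using K(4)[OF st] by blast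
      show ?thesis unfolding C3_def
      proof (rule lyapunov_bound[OF st(2) d\<Phi> _ _ _ l c \<Phi>_nonneg])
        fix \<tau> assume \<tau>: "s \<le> \<tau>" "\<tau> \<le> t"
        show \<tau>0: "0 < \<tau>" using \<tau> st by simp
        show "(V has_real_derivative D \<tau>) (at \<tau>)" "0 \<le> V \<tau> \<and> V \<tau> \<le> K" using VD \<tau> by auto
        have "c * (1 + integral {0..L} (\<lambda>x. (fxx \<tau> x)\<^sup>2)) \<le> c * (1 + K - D \<tau>)"
          using VD \<tau> c by (intro mult_left_mono) auto
        then show "\<Phi>' \<tau> \<le> - l * \<Phi> \<tau> + c * (1 + K - D \<tau>)" using diss[OF \<tau>0] e_bd[OF \<tau>0] by linarith
      qed
    qed
    \<comment> \<open>The functional controlling \<open>fxx\<close> exists only on intervals away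
      from time 0, with a bound independent of the interval; so the estimate starts at s > 0 and s
      tends to 0, where \<Phi> vanishes.\<close>
    have \<Phi>_le: "\<Phi> t \<le> C3" if t: "t > 0" for t
    proof -
      have "(\<Phi> \<longlongrightarrow> \<Phi> 0) (at 0 within {0..})" using \<Phi>_cont by (simp add: continuous_on_def)
      then have "(\<Phi> \<longlongrightarrow> \<Phi> 0) (at_right 0)" by (rule tendsto_within_subset) auto
      then have "((\<lambda>s. \<Phi> s + C3) \<longlongrightarrow> \<Phi> 0 + C3) (at_right 0)" by (intro tendsto_intros)
      moreover have "\<forall>\<^sub>F s in at_right 0. \<Phi> t \<le> \<Phi> s + C3"
        by (rule eventually_at_rightI[of 0 t]) (use \<Phi>_bd t in auto)
      ultimately have "\<Phi> t \<le> \<Phi> 0 + C3" by (rule tendsto_lowerbound) simp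
      then show ?thesis by (simp add: \<Phi>_def Z0)
    qed
    have init1: "(\<Sum>j<N. k * \<bar>r j 0 - \<rho>0 (x j)\<bar>) \<le> C' * k"
      using init[OF N] by (simp add: initial_data_approx_def r_def x_def k_def)
    have init2: "(\<Sum>j<N. k * \<bar>\<rho>0 (x j) - P j 0\<bar>) \<le> C4 * k"
      using cell_avg_node_dist[OF N \<rho>0_per d\<rho>0 \<rho>0'_cont] by (simp add: P0 C4_def x_def k_def mult.commute)
    have y_bd: "k * (\<Sum>j<N. \<bar>y j\<bar>) \<le> (C' + C4) * k"
    proof -
      have "k * (\<Sum>j<N. \<bar>y j\<bar>) \<le> (\<Sum>j<N. k * \<bar>r j 0 - \<rho>0 (x j)\<bar> + k * \<bar>\<rho>0 (x j) - P j 0\<bar>)"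
        unfolding sum_distrib_left distrib_left[symmetric] y_def
        using k by (intro sum_mono mult_left_mono) auto
      then show ?thesis using init1 init2 by (simp add: sum.distrib distrib_right)
    qed
    have "(\<Sum>j<N. k * \<bar>\<rho> (x j) t - r j t\<bar>) \<le> C * k"
    \<comment> \<open>At time 0 the hypothesis on the data compares node values directly. The
      splitting through cell averages uses \<open>rx\<close>, which is controlled at positive
      times.\<close>
    proof (cases "t = 0")
      case True
      have "(\<Sum>j<N. k * \<bar>\<rho> (x j) t - r j t\<bar>) \<le> C' * k"
        using init1 fp True by (simp add: fokker_planck_solution_def abs_minus_commute)
      also have "\<dots> \<le> C * k"
      proof (rule mult_right_mono)
        have "0 \<le> sqrt (L * K1)" "0 \<le> sqrt C3" using L K1_nonneg C3 by auto
        then show "C' \<le> C" using C4 unfolding C_def by linarith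
      qed (use k in simp)
      finally show ?thesis .
    next
      case False
      then have t0: "t > 0" using t by simp
      have 1: "(\<Sum>j<N. k * \<bar>\<rho> (x j) t - P j t\<bar>) \<le> sqrt (L * K1) * k"
      proof -
        have "(\<Sum>j<N. k * \<bar>\<rho> (x j) t - P j t\<bar>) \<le> k * sqrt (L * integral {0..L} (\<lambda>x. (rx t x)\<^sup>2))"
          using cell_avg_node_dist[OF N \<rho>_per[OF t] drx[OF t0] rx_cont[OF t0]] by (simp add: P_def x_def k_def)
        also have "\<dots> \<le> k * sqrt (L * K1)"
          using k L rx_bd[OF t0] by (intro mult_left_mono real_sqrt_le_mono mult_left_mono) auto
        finally show ?thesis by (simp add: mult.commute)
      qed
      have 2: "(\<Sum>j<N. k * \<bar>Z j t\<bar>) \<le> sqrt C3 * k"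
      proof -
        \<comment> \<open>Cauchy-Schwarz with weights of total mass 1 passes from the weighted l^2
          norm to l^1 without a factor depending on \<open>N\<close>.\<close>
        have "(\<Sum>j<N. \<bar>Z j t\<bar>)\<^sup>2 = (\<Sum>j<N. sqrt (p j) * (\<bar>Z j t\<bar> / sqrt (p j)))\<^sup>2"
          using p_pos by (intro arg_cong[of _ _ "\<lambda>x. x\<^sup>2"] sum.cong refl) (auto simp: less_imp_neq[symmetric] less_imp_le)
        also have "\<dots> \<le> (\<Sum>j<N. (sqrt (p j))\<^sup>2) * (\<Sum>j<N. (\<bar>Z j t\<bar> / sqrt (p j))\<^sup>2)"
          by (rule Cauchy_Schwarz_ineq_sum)
        also have "(\<Sum>j<N. (sqrt (p j))\<^sup>2) = 1"
          using p1 p_pos by (simp add: less_imp_le)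
        also have "(\<Sum>j<N. (\<bar>Z j t\<bar> / sqrt (p j))\<^sup>2) = \<Phi> t"
          unfolding \<Phi>_def using p_pos by (intro sum.cong refl) (simp add: power_divide less_imp_le)
        finally have "(\<Sum>j<N. \<bar>Z j t\<bar>)\<^sup>2 \<le> C3" using \<Phi>_le[OF t0] by simp
        then have "(\<Sum>j<N. \<bar>Z j t\<bar>) \<le> sqrt C3" by (rule real_le_rsqrt)
        then have "k * (\<Sum>j<N. \<bar>Z j t\<bar>) \<le> k * sqrt C3" using k by (intro mult_left_mono) auto
        then show ?thesis by (simp add: sum_distrib_left mult.commute)
      qed
      have 3: "(\<Sum>j<N. k * \<bar>Y j t\<bar>) \<le> (C' + C4) * k"
      proof -
        have "k * (\<Sum>j<N. \<bar>Y j t\<bar>) \<le> k * (\<Sum>j<N. \<bar>y j\<bar>)" using k t by (intro mult_left_mono Y(3)) auto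
        then show ?thesis using y_bd by (simp add: sum_distrib_left)
      qed
      have "(\<Sum>j<N. k * \<bar>\<rho> (x j) t - r j t\<bar>) \<le> (\<Sum>j<N. k * \<bar>\<rho> (x j) t - P j t\<bar> + k * \<bar>Z j t\<bar> + k * \<bar>Y j t\<bar>)"
        unfolding distrib_left[symmetric] Z_def using k by (intro sum_mono mult_left_mono) auto
      also have "\<dots> \<le> sqrt (L * K1) * k + sqrt C3 * k + (C' + C4) * k"
        unfolding sum.distrib by (intro add_mono 1 2 3)
      also have "\<dots> = (sqrt (L * K1) + sqrt C3 + (C' + C4)) * k" by (simp add: distrib_right)
      also have "\<dots> \<le> C * k" using k by (intro mult_right_mono) (auto simp: C_def)
      finally show ?thesis .
    qed
    then show "(\<Sum>j<N. h N * \<bar>\<rho> (node L N j) t - rh N j t\<bar>) \<le> C * h N"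
      by (simp add: x_def r_def k_def)
  qed
qed

end

section \<open>Smooth coefficients and conclusion\<close>

lemma smooth_deriv: "smooth f \<Longrightarrow> smooth (deriv f)"
  unfolding smooth_def by (metis comp_apply funpow_Suc_right)

lemma smooth_has_derivative:
  assumes "smooth f"
  shows "(f has_real_derivative deriv f x) (at x)"
proof -
  have "f differentiable_on UNIV" using assms unfolding smooth_def by (metis funpow_0)
  then have "f differentiable (at x)" by (simp add: differentiable_on_def)
  then show ?thesis by (simp add: DERIV_deriv_iff_real_differentiable)
qed

lemma smooth_continuous: "smooth f \<Longrightarrow> continuous_on UNIV f"
  by (rule continuous_of_derivative) (rule smooth_has_derivative)

theorem theorem6p1:
  fixes L S1 C' :: real
    and b \<sigma> \<pi> \<rho>0 :: "real \<Rightarrow> real"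
    and \<rho> :: "real \<Rightarrow> real \<Rightarrow> real"
    and M :: "'w measure" and F :: "real \<Rightarrow> 'w measure"
    and W X :: "real \<Rightarrow> 'w \<Rightarrow> real"
    and \<rho>h :: "nat \<Rightarrow> nat \<Rightarrow> real \<Rightarrow> real"
    and \<pi>h :: "nat \<Rightarrow> nat \<Rightarrow> real"
  assumes "L > 0"
    and "periodic_fun_simple b L" "smooth b"
    and "periodic_fun_simple \<sigma> L" "smooth \<sigma>"
    and "S1 > 0" "\<And>x. (\<sigma> x)\<^sup>2 \<ge> S1"
    and "stationary_density L b \<sigma> M F W X \<pi>"
    and "periodic_fun_simple \<rho>0 L" "smooth \<rho>0"
    and "\<And>x. \<rho>0 x \<ge> 0" "\<exists>x. \<rho>0 x \<noteq> 0"
    and "fokker_planck_solution L b \<sigma> \<rho>0 \<rho>"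
    and "\<And>N. N > 0 \<Longrightarrow> upwind_stationary L b \<sigma> N (\<pi>h N)"
    and "\<And>N. N > 0 \<Longrightarrow> upwind_solution L b \<sigma> N (\<rho>h N)"
    and "\<And>N. N > 0 \<Longrightarrow> initial_data_approx L \<rho>0 C' N (\<lambda>j. \<rho>h N j 0)"
  shows "\<exists>C>0. \<exists>h0>0. \<forall>N>0. mesh L N < h0 \<longrightarrow>
           (MAX j\<in>{..<N}. \<bar>\<pi>h N j / mesh L N - \<pi> (node L N j)\<bar>) \<le> C * mesh L N \<and>
           (\<forall>t\<ge>0. (\<Sum>j<N. mesh L N * \<bar>\<rho> (node L N j) t - \<rho>h N j t\<bar>) \<le> C * mesh L N)"
proof -
  have nz: "\<sigma> x \<noteq> 0" for x using assms(6) assms(7)[of x] by auto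
  interpret stationary_data L b "deriv b" \<sigma> "deriv \<sigma>" "deriv (deriv \<sigma>)"
    by (rule stationary_data.intro)
      (use assms(1-5) nz in \<open>auto intro: smooth_has_derivative smooth_continuous smooth_deriv\<close>)
  obtain q q' q'' J where q: "periodic_fun_simple q L" "\<And>x. q x > 0" "integral {0..L} q = 1"
    "\<And>x. (q has_real_derivative q' x) (at x)" "\<And>x. (q' has_real_derivative q'' x) (at x)"
    "continuous_on UNIV q''" "\<And>x. b x * q x - (\<sigma> x * deriv \<sigma> x * q x + (\<sigma> x)\<^sup>2 * q' x / 2) = J"
    by (rule stationary_density_exists) blast
  interpret upwind_scheme L b "deriv b" \<sigma> "deriv \<sigma>" "deriv (deriv \<sigma>)" q q' q'' J S1
    by (intro upwind_scheme.intro upwind_scheme_axioms.intro stationary_data_axioms q assms)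
  have \<pi>: "\<pi> x = q x" for x
    by (rule stationary_density_eq[OF q(1-4) q(7) assms(8)])
  obtain C0 h0 where C0: "C0 > 0" "h0 > 0" "\<And>N p j. N > 0 \<Longrightarrow> mesh L N < h0 \<Longrightarrow> upwind_stationary L b \<sigma> N p \<Longrightarrow> j < N \<Longrightarrow>
    \<bar>p j / mesh L N - q (node L N j)\<bar> \<le> C0 * mesh L N \<and> mesh L N * q (node L N j) / 2 \<le> p j"
    by (rule discrete_stationary_estimate) blast
  \<comment> \<open>The threshold \<open>h0\<close> is inherited from the stationary estimate, whose
    lower bound on \<open>\<pi>h\<close> is the only place where small h enters the error
    estimate.\<close>
  obtain C1 where C1: "C1 > 0" "\<And>N t. N > 0 \<Longrightarrow> mesh L N < h0 \<Longrightarrow> t \<ge> 0 \<Longrightarrow>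
    (\<Sum>j<N. mesh L N * \<bar>\<rho> (node L N j) t - \<rho>h N j t\<bar>) \<le> C1 * mesh L N"
  proof (rule scheme_error[OF assms(13,9) smooth_has_derivative[OF assms(10)]
        smooth_continuous[OF smooth_deriv[OF assms(10)]] C0(2) _ assms(14-16)])
    show "mesh L N * q (node L N j) / 2 \<le> \<pi>h N j" if "N > 0" "mesh L N < h0" "j < N" for N j
      using C0(3)[OF that(1,2) assms(14)[OF that(1)] that(3)] by blast
  qed blast+
  have "(MAX j\<in>{..<N}. \<bar>\<pi>h N j / mesh L N - \<pi> (node L N j)\<bar>) \<le> (C0 + C1) * mesh L N"
    if N: "N > 0" "mesh L N < h0" for N
  proof (rule Max.boundedI)
    fix a assume "a \<in> (\<lambda>j. \<bar>\<pi>h N j / mesh L N - \<pi> (node L N j)\<bar>) ` {..<N}"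
    then obtain j where j: "j < N" "a = \<bar>\<pi>h N j / mesh L N - q (node L N j)\<bar>" by (auto simp: \<pi>)
    have "a \<le> C0 * mesh L N" using C0(3)[OF N assms(14)[OF N(1)] j(1)] by (simp add: j(2))
    also have "\<dots> \<le> (C0 + C1) * mesh L N" using C1(1) h_pos[OF N(1)] by (intro mult_right_mono) auto
    finally show "a \<le> (C0 + C1) * mesh L N" .
  qed (use N in auto)
  moreover have "(\<Sum>j<N. mesh L N * \<bar>\<rho> (node L N j) t - \<rho>h N j t\<bar>) \<le> (C0 + C1) * mesh L N"
    if N: "N > 0" "mesh L N < h0" and t: "t \<ge> 0" for N t
  proof -
    have "C1 * mesh L N \<le> (C0 + C1) * mesh L N" using C0(1) h_pos[OF N(1)] by (intro mult_right_mono) auto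
    then show ?thesis using C1(2)[OF N t] by linarith
  qed
  ultimately show ?thesis
    using C0(1,2) C1(1) by (intro exI[of _ "C0 + C1"] exI[of _ h0] conjI allI impI) auto
qed

end
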